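(* Let $g\in\mathcal{C}^2(\mathbb{R})$ be bounded, (strictly) increasing, and have exactly one inflection point, and denote $g(\pm\infty)=\lim_{s\to\pm\infty}g(s)$. Let $p:\mathbb{R}\to\mathbb{R}$ be continuous and bounded, and suppose that $p$ admits an asymptotic average $A(p)\in\mathbb{R}$. Then the equation $$\ddot u(t)+g(u(t))=p(t),\qquad t\in\mathbb{R},$$ admits a bounded solution if and only if $$g(-\infty)<A(p)<g(+\infty).$$ In such a case, the equation admits a countable set of bounded solutions having arbitrarily large $L^\infty$-norm (i.e. there is a sequence $(u_m)$ of bounded solutions with $\|u_m\|_{L^\infty(\mathbb{R})}\to+\infty$).
   Context: A bounded solution is a $\mathcal{C}^2$ solution $u:\mathbb{R}\to\mathbb{R}$ defined on the whole real line such that both $u$ and $\dot u$ are bounded on $\mathbb{R}$. That $g$ has exactly one inflection point means: there is $s_0\in\mathbb{R}$ such that $g$ is strictly convex on $(-\infty,s_0)$ and strictly concave on $(s_0,+\infty)$. $p$ admits asymptotic average $A(p)\in\mathbb{R}$ if $\lim_{T\to+\infty}\frac1T\int_t^{t+T}p(s)\,ds=A(p)$ uniformly in $t\in\mathbb{R}$. *)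

theory Defs
  imports "HOL-Analysis.Analysis" "HOL-Probability.Essential_Supremum"
begin

definition C2 :: "(real \<Rightarrow> real) \<Rightarrow> bool" where
  "C2 f \<longleftrightarrow>
     (\<forall>x. f differentiable (at x)) \<and>
     (\<forall>x. deriv f differentiable (at x)) \<and>
     continuous_on UNIV (deriv (deriv f))"

definition strictly_convex_on :: "real set \<Rightarrow> (real \<Rightarrow> real) \<Rightarrow> bool" where
  "strictly_convex_on S f \<longleftrightarrow> convex S \<and>
     (\<forall>x\<in>S. \<forall>y\<in>S. \<forall>t. x \<noteq> y \<and> 0 < t \<and> t < 1 \<longrightarrow>
        f ((1 - t) * x + t * y) < (1 - t) * f x + t * f y)"

definition strictly_concave_on :: "real set \<Rightarrow> (real \<Rightarrow> real) \<Rightarrow> bool" where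
  "strictly_concave_on S f \<longleftrightarrow> strictly_convex_on S (\<lambda>x. - f x)"

text \<open>The order is part of the notion: convex to the left, concave to the right.\<close>

definition exactly_one_inflection_point :: "(real \<Rightarrow> real) \<Rightarrow> bool" where
  "exactly_one_inflection_point g \<longleftrightarrow>
     (\<exists>s0. strictly_convex_on {..<s0} g \<and> strictly_concave_on {s0<..} g)"

definition has_asymptotic_average :: "(real \<Rightarrow> real) \<Rightarrow> real \<Rightarrow> bool" where
  "has_asymptotic_average p A \<longleftrightarrow>
     uniform_limit UNIV (\<lambda>T t. (1 / T) * integral {t..t + T} p) (\<lambda>t. A) at_top"

definition bounded_solution ::
    "(real \<Rightarrow> real) \<Rightarrow> (real \<Rightarrow> real) \<Rightarrow> (real \<Rightarrow> real) \<Rightarrow> bool" where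
  "bounded_solution g p u \<longleftrightarrow>
     C2 u \<and> (\<forall>t. deriv (deriv u) t + g (u t) = p t) \<and>
     bounded (range u) \<and> bounded (range (deriv u))"

definition Linf_norm :: "(real \<Rightarrow> real) \<Rightarrow> ereal" where
  "Linf_norm u = esssup lborel (\<lambda>t. ereal \<bar>u t\<bar>)"

end

theory Submission
  imports Defs
begin

text \<open>
  Subtracting \<open>A\<close> from \<open>g\<close> and \<open>p\<close> we may take the average to be 0. Necessity: averaging the equation shows that
  \<open>A\<close> is the mean of \<open>g \<circ> u\<close>, which stays strictly between the limits of \<open>g\<close>.

  Sufficiency: on a long interval \<open>[a, b]\<close> the Dirichlet problem has a positive solution close to the parabola
  \<open>g(\<infinity>) (t - a) (b - t) / 2\<close>; concavity makes \<open>g'\<close> decay so fast that it is the fixed point of a contraction. Its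
  action \<open>h(a, b)\<close> is differentiable, with partial derivatives \<open>u'(a)^2 / 2\<close> and \<open>- u'(b)^2 / 2\<close>, and is
  comparable to \<open>- (b - a)^3\<close>. Choose nodes \<open>t_0 < ... < t_N\<close> with fixed ends that maximise the sum of the actions of
  arcs of alternating sign, all gaps being at least \<open>d\<close>. Deleting two nodes from a region of short gaps and inserting
  two into a long gap shows that all gaps of a maximiser are comparable; hence the constraint is inactive, the slopes
  match at every node, and the arcs form a solution with bounds independent of \<open>N\<close>. Letting the ends tend to
  infinity gives a bounded solution, whose size grows with \<open>d\<close>.
\<close>

section \<open>Green's operator of the Dirichlet problem\<close>

text \<open>Only the mean of \<open>p\<close> is controlled, so \<open>p\<close> cannot be estimated
  pointwise. It enters through a primitive, which grows sublinearly after normalisation, and on long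
  intervals it is negligible against the constant push \<open>gi\<close> of \<open>g\<close>.
  Differentiability of \<open>h\<close> is not taken from smooth dependence of arcs on their ends.
  The contraction makes arcs on nested intervals differ by a multiple of the displacement of the
  ends, and this gives the action a quadratic remainder. Maximising is natural because
  \<open>h\<close> behaves like minus the cube of the gap, which penalises unequal gaps. However,
  slopes and actions are known only up to a factor 2, so varying a single node merely bounds the
  ratio of neighbouring gaps by a constant \<open>K\<close>. Iterated along the chain this gives a
  power of \<open>K\<close> growing with the number of nodes, useless in the limit. Exchanging nodes
  compares distant gaps at once and needs only the order of magnitude of \<open>h\<close>. Two nodes
  are moved rather than one, because the signs of the arcs alternate.\<close>

lemmas integral_split = Henstock_Kurzweil_Integration.integral_combine

text \<open>Integration of \<open>f\<close> against the Dirichlet Green function of - d^2/dt^2,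
  split at the diagonal: the kernel is (s - a)(b - t) / (b - a) for s \<le> t, and symmetric beyond.
  The second derivative is therefore - f.\<close>

definition green :: "real \<Rightarrow> real \<Rightarrow> (real \<Rightarrow> real) \<Rightarrow> real \<Rightarrow> real" where
  "green a b f t = ((b - t) * integral {a..t} (\<lambda>s. (s - a) * f s)
      + (t - a) * integral {t..b} (\<lambda>s. (b - s) * f s)) / (b - a)"

definition green_slope :: "real \<Rightarrow> real \<Rightarrow> (real \<Rightarrow> real) \<Rightarrow> real \<Rightarrow> real" where
  "green_slope a b f t =
     (integral {t..b} (\<lambda>s. (b - s) * f s) - integral {a..t} (\<lambda>s. (s - a) * f s)) / (b - a)"

lemma integral_upper_has_real_derivative:
  fixes f :: "real \<Rightarrow> real"
  assumes "continuous_on {a..b} f" "t \<in> {a..b}"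
  shows "((\<lambda>x. integral {x..b} f) has_real_derivative - f t) (at t within {a..b})"
proof -
  have eq: "integral {x..b} f = integral {a..b} f - integral {a..x} f" if "x \<in> {a..b}" for x
    using integral_split[of a x b f] that
      integrable_continuous_real[OF assms(1)] by simp
  have "((\<lambda>x. integral {a..b} f - integral {a..x} f) has_real_derivative - f t) (at t within {a..b})"
    using DERIV_diff[OF DERIV_const integral_has_real_derivative[OF assms]] by simp
  then show ?thesis
    by (rule has_field_derivative_transform_within[of _ _ _ _ 1]) (use eq[symmetric] assms in auto)
qed

lemma green_has_derivative:
  assumes "a < b" "continuous_on {a..b} f" "t \<in> {a..b}"
  shows "(green a b f has_real_derivative green_slope a b f t) (at t within {a..b})"
    and "(green_slope a b f has_real_derivative - f t) (at t within {a..b})"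
proof -
  have d1: "((\<lambda>x. integral {a..x} (\<lambda>s. (s - a) * f s)) has_real_derivative (t - a) * f t) (at t within {a..b})"
    by (rule integral_has_real_derivative) (use assms in \<open>auto intro!: continuous_intros\<close>)
  have d2: "((\<lambda>x. integral {x..b} (\<lambda>s. (b - s) * f s)) has_real_derivative - ((b - t) * f t)) (at t within {a..b})"
    by (rule integral_upper_has_real_derivative) (use assms in \<open>auto intro!: continuous_intros\<close>)
  have l1: "((\<lambda>x. b - x) has_real_derivative - 1) (at t within {a..b})"
    and l2: "((\<lambda>x. x - a) has_real_derivative 1) (at t within {a..b})"
    by (auto intro!: derivative_eq_intros)
  show "(green a b f has_real_derivative green_slope a b f t) (at t within {a..b})"
    unfolding green_def[abs_def] green_slope_def
    by (rule DERIV_cong, rule DERIV_cdivide, rule DERIV_add,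
        rule DERIV_mult[OF l1 d1], rule DERIV_mult[OF l2 d2]) (simp add: algebra_simps)
  show "(green_slope a b f has_real_derivative - f t) (at t within {a..b})"
    unfolding green_slope_def[abs_def]
    by (rule DERIV_cong, rule DERIV_cdivide, rule DERIV_diff[OF d2 d1])
      (use assms in \<open>simp add: field_simps\<close>)
qed

lemma green_endpoints [simp]: "green a b f a = 0" "green a b f b = 0"
  by (simp_all add: green_def)

lemma green_diff:
  assumes "continuous_on {a..b} f" "continuous_on {a..b} k" "t \<in> {a..b}"
  shows "green a b (\<lambda>s. f s - k s) t = green a b f t - green a b k t"
proof -
  have c: "continuous_on {a..t} f" "continuous_on {a..t} k" "continuous_on {t..b} f" "continuous_on {t..b} k"
    using assms by (auto elim!: continuous_on_subset)
  have 1: "integral {a..t} (\<lambda>s. (s - a) * (f s - k s))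
      = integral {a..t} (\<lambda>s. (s - a) * f s) - integral {a..t} (\<lambda>s. (s - a) * k s)"
    unfolding right_diff_distrib
    by (rule integral_diff; rule integrable_continuous_real; intro continuous_intros c)
  have 2: "integral {t..b} (\<lambda>s. (b - s) * (f s - k s))
      = integral {t..b} (\<lambda>s. (b - s) * f s) - integral {t..b} (\<lambda>s. (b - s) * k s)"
    unfolding right_diff_distrib[of "b - _"]
    by (rule integral_diff; rule integrable_continuous_real; intro continuous_intros c)
  show ?thesis unfolding green_def 1 2 by (simp add: algebra_simps add_divide_distrib diff_divide_distrib)
qed

text \<open>The difference to \<open>green a b f\<close> has vanishing second derivative, hence is
  affine and interpolates the boundary values. These need not be 0, because an arc over a larger
  interval will be compared with one over a smaller interval.\<close>

lemma green_unique:
  assumes ab: "a < b" and f: "continuous_on {a..b} f"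
    and w: "\<And>t. t \<in> {a..b} \<Longrightarrow> (w has_real_derivative w' t) (at t within {a..b})"
    and w': "\<And>t. t \<in> {a..b} \<Longrightarrow> (w' has_real_derivative - f t) (at t within {a..b})"
    and t: "t \<in> {a..b}"
  shows "w t = green a b f t + ((b - t) * w a + (t - a) * w b) / (b - a)"
proof -
  define z where "z = (\<lambda>t. w t - green a b f t)"
  define z' where "z' = (\<lambda>t. w' t - green_slope a b f t)"
  have z: "(z has_real_derivative z' t) (at t within {a..b})" if "t \<in> {a..b}" for t
    unfolding z_def z'_def by (intro derivative_intros w green_has_derivative ab f that)
  have z': "(z' has_real_derivative 0) (at t within {a..b})" if "t \<in> {a..b}" for t
    using DERIV_diff[OF w'[OF that] green_has_derivative(2)[OF ab f that]] by (simp add: z'_def)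
  obtain c where c: "\<And>t. t \<in> {a..b} \<Longrightarrow> z' t = c"
    using has_field_derivative_zero_constant[of "{a..b}" z'] z' by auto
  have "((\<lambda>t. z t - c * t) has_real_derivative 0) (at t within {a..b})" if "t \<in> {a..b}" for t
    using DERIV_diff[OF z[OF that] DERIV_cmult_Id[of c]] c that by simp
  then obtain e where e: "\<And>t. t \<in> {a..b} \<Longrightarrow> z t - c * t = e"
    using has_field_derivative_zero_constant[of "{a..b}" "\<lambda>t. z t - c * t"] by auto
  have za: "w a = e + c * a" "w b = e + c * b" "z t = e + c * t"
    using e[of a] e[of b] e[of t] ab t by (auto simp: z_def)
  have "((b - t) * w a + (t - a) * w b) / (b - a) = e + c * t"
    unfolding za using ab by (simp add: field_simps)
  then show ?thesis using za(3) by (simp add: z_def)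
qed

lemma green_const:
  assumes "a < b" "t \<in> {a..b}"
  shows "green a b (\<lambda>_. c) t = c / 2 * ((t - a) * (b - t))"
proof -
  have "c / 2 * ((t - a) * (b - t)) = green a b (\<lambda>_. c) t +
     ((b - t) * (c / 2 * ((a - a) * (b - a))) + (t - a) * (c / 2 * ((b - a) * (b - b)))) / (b - a)"
    by (rule green_unique[where w="\<lambda>t. c / 2 * ((t - a) * (b - t))" and w'="\<lambda>t. c / 2 * (a + b - 2 * t)"])
      (auto intro!: derivative_eq_intros simp: assms field_simps, use assms in auto)
  then show ?thesis by simp
qed

text \<open>The kernel at (t, s) is at most its diagonal value at t and at most its diagonal value
  at s. The first bound keeps a factor vanishing at the ends, as a comparison with parabolas needs.
  The second puts the weight (s - a)(b - s) on \<open>f\<close>, which compensates an integrand that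
  is large near the ends.\<close>

lemma abs_green_le:
  assumes ab: "a < b" and f: "continuous_on {a..b} f" and t: "t \<in> {a..b}"
  shows "\<bar>green a b f t\<bar> \<le> (t - a) * (b - t) / (b - a) * integral {a..b} (\<lambda>s. \<bar>f s\<bar>)"
    and "\<bar>green a b f t\<bar> \<le> 1 / (b - a) * integral {a..b} (\<lambda>s. (s - a) * (b - s) * \<bar>f s\<bar>)"
proof -
  have c: "continuous_on {a..t} f" "continuous_on {t..b} f"
    using f t by (auto elim!: continuous_on_subset)
  define I where "I = integral {a..t} (\<lambda>s. (s - a) * f s)"
  define J where "J = integral {t..b} (\<lambda>s. (b - s) * f s)"
  have I1: "\<bar>(b - t) * I\<bar> \<le> integral {a..t} (\<lambda>s. (b - t) * ((s - a) * \<bar>f s\<bar>))"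
  proof -
    have "\<bar>I\<bar> \<le> integral {a..t} (\<lambda>s. (s - a) * \<bar>f s\<bar>)"
      unfolding I_def real_norm_def[symmetric]
      by (rule integral_norm_bound_integral) (auto intro!: integrable_continuous_real continuous_intros c simp: abs_mult)
    then show ?thesis using t by (simp add: abs_mult mult_left_mono)
  qed
  have J1: "\<bar>(t - a) * J\<bar> \<le> integral {t..b} (\<lambda>s. (t - a) * ((b - s) * \<bar>f s\<bar>))"
  proof -
    have "\<bar>J\<bar> \<le> integral {t..b} (\<lambda>s. (b - s) * \<bar>f s\<bar>)"
      unfolding J_def real_norm_def[symmetric]
      by (rule integral_norm_bound_integral) (auto intro!: integrable_continuous_real continuous_intros c simp: abs_mult)
    then show ?thesis using t by (simp add: abs_mult mult_left_mono)
  qed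
  \<comment> \<open>Any common majorant \<open>k\<close> of the two branches of the integrand will
    do; the two claims insert the two diagonal values.\<close>
  have main: "\<bar>green a b f t\<bar> \<le> 1 / (b - a) * integral {a..b} k"
    if k: "continuous_on {a..b} k"
      and le1: "\<And>s. s \<in> {a..t} \<Longrightarrow> (b - t) * ((s - a) * \<bar>f s\<bar>) \<le> k s"
      and le2: "\<And>s. s \<in> {t..b} \<Longrightarrow> (t - a) * ((b - s) * \<bar>f s\<bar>) \<le> k s" for k
  proof -
    have ck: "continuous_on {a..t} k" "continuous_on {t..b} k"
      using k t by (auto elim!: continuous_on_subset)
    have "\<bar>(b - t) * I + (t - a) * J\<bar> \<le> integral {a..t} (\<lambda>s. (b - t) * ((s - a) * \<bar>f s\<bar>))
        + integral {t..b} (\<lambda>s. (t - a) * ((b - s) * \<bar>f s\<bar>))"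
      using I1 J1 by linarith
    also have "\<dots> \<le> integral {a..t} k + integral {t..b} k"
      by (intro add_mono integral_le integrable_continuous_real continuous_intros c ck le1 le2)
    also have "\<dots> = integral {a..b} k"
      using integral_split[of a t b k] t
      integrable_continuous_real[OF k] by simp
    finally show ?thesis using ab by (simp add: green_def I_def J_def divide_right_mono)
  qed
  have "\<bar>green a b f t\<bar> \<le> 1 / (b - a) * integral {a..b} (\<lambda>s. (t - a) * (b - t) * \<bar>f s\<bar>)"
  proof (rule main)
    fix s assume "s \<in> {a..t}"
    then have "(b - t) * (s - a) * \<bar>f s\<bar> \<le> (b - t) * (t - a) * \<bar>f s\<bar>"
      using t by (intro mult_right_mono mult_left_mono) auto
    then show "(b - t) * ((s - a) * \<bar>f s\<bar>) \<le> (t - a) * (b - t) * \<bar>f s\<bar>" by (simp add: mult_ac)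
  next
    fix s assume "s \<in> {t..b}"
    then have "(t - a) * (b - s) * \<bar>f s\<bar> \<le> (t - a) * (b - t) * \<bar>f s\<bar>"
      using t by (intro mult_right_mono mult_left_mono) auto
    then show "(t - a) * ((b - s) * \<bar>f s\<bar>) \<le> (t - a) * (b - t) * \<bar>f s\<bar>" by (simp add: mult_ac)
  qed (auto intro!: continuous_intros f)
  then show "\<bar>green a b f t\<bar> \<le> (t - a) * (b - t) / (b - a) * integral {a..b} (\<lambda>s. \<bar>f s\<bar>)"
    by simp
  show "\<bar>green a b f t\<bar> \<le> 1 / (b - a) * integral {a..b} (\<lambda>s. (s - a) * (b - s) * \<bar>f s\<bar>)"
  proof (rule main)
    fix s assume "s \<in> {a..t}"
    then have "(b - t) * (s - a) * \<bar>f s\<bar> \<le> (b - s) * (s - a) * \<bar>f s\<bar>"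
      using t by (intro mult_right_mono) auto
    then show "(b - t) * ((s - a) * \<bar>f s\<bar>) \<le> (s - a) * (b - s) * \<bar>f s\<bar>" by (simp add: mult_ac)
  next
    fix s assume "s \<in> {t..b}"
    then have "(t - a) * (b - s) * \<bar>f s\<bar> \<le> (s - a) * (b - s) * \<bar>f s\<bar>"
      using t by (intro mult_right_mono) auto
    then show "(t - a) * ((b - s) * \<bar>f s\<bar>) \<le> (s - a) * (b - s) * \<bar>f s\<bar>" by (simp add: mult_ac)
  qed (auto intro!: continuous_intros f)
qed

text \<open>Since \<open>p\<close> itself is not small, the derivative is moved from
  \<open>P\<close> onto the kernel, whose slope in s is constant on each side of t. Subtracting
  \<open>P t\<close> from the primitive removes the boundary terms, and only the oscillation of
  \<open>P\<close> remains.\<close>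

lemma abs_green_derivative_le:
  assumes ab: "a < b" and t: "t \<in> {a..b}"
    and P: "\<And>t. (P has_real_derivative p t) (at t)" and p: "continuous_on UNIV p"
    and le: "\<And>s t. \<bar>P t - P s\<bar> \<le> \<epsilon> * \<bar>t - s\<bar> + C" and \<epsilon>: "0 \<le> \<epsilon>"
  shows "\<bar>green a b p t\<bar> \<le> (\<epsilon> + 2 * C / (b - a)) * ((t - a) * (b - t))"
proof -
  have PW: "(P has_real_derivative p t) (at t within S)" for t S
    using P has_field_derivative_at_within by blast
  have "continuous_on {x..y} P" for x y
    by (meson P DERIV_isCont continuous_at_imp_continuous_on)
  note cP = this
  have I: "((\<lambda>s. (s - a) * p s - (P t - P s)) has_integral 0) {a..t}"
  proof -
    have "((\<lambda>s. (s - a) * p s - (P t - P s)) has_integral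
       ((t - a) * (P t - P t) - (a - a) * (P a - P t))) {a..t}"
      by (rule fundamental_theorem_of_calculus) (use t in \<open>auto intro!: derivative_eq_intros PW
           simp flip: has_real_derivative_iff_has_vector_derivative\<close>)
    then show ?thesis by simp
  qed
  have J: "((\<lambda>s. (b - s) * p s - (P s - P t)) has_integral 0) {t..b}"
  proof -
    have "((\<lambda>s. (b - s) * p s - (P s - P t)) has_integral
       ((b - b) * (P b - P t) - (b - t) * (P t - P t))) {t..b}"
      by (rule fundamental_theorem_of_calculus) (use t in \<open>auto intro!: derivative_eq_intros PW
           simp flip: has_real_derivative_iff_has_vector_derivative\<close>)
    then show ?thesis by simp
  qed
  have cp: "continuous_on {x..y} p" for x y using p continuous_on_subset by blast
  have I': "integral {a..t} (\<lambda>s. (s - a) * p s) = integral {a..t} (\<lambda>s. P t - P s)"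
  proof -
    have "integral {a..t} (\<lambda>s. (s - a) * p s - (P t - P s))
      = integral {a..t} (\<lambda>s. (s - a) * p s) - integral {a..t} (\<lambda>s. P t - P s)"
      by (intro integral_diff integrable_continuous_real continuous_intros cP cp)
    then show ?thesis using integral_unique[OF I] by simp
  qed
  have J': "integral {t..b} (\<lambda>s. (b - s) * p s) = integral {t..b} (\<lambda>s. P s - P t)"
  proof -
    have "integral {t..b} (\<lambda>s. (b - s) * p s - (P s - P t))
      = integral {t..b} (\<lambda>s. (b - s) * p s) - integral {t..b} (\<lambda>s. P s - P t)"
      by (intro integral_diff integrable_continuous_real continuous_intros cP cp)
    then show ?thesis using integral_unique[OF J] by simp
  qed
  have "norm (integral {a..t} (\<lambda>s. P t - P s)) \<le> (\<epsilon> * (t - a) + C) * (t - a)"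
  proof (rule integral_bound)
    show "norm (P t - P s) \<le> \<epsilon> * (t - a) + C" if "s \<in> {a..t}" for s
    proof -
      have "\<epsilon> * \<bar>t - s\<bar> \<le> \<epsilon> * (t - a)" using that \<epsilon> by (intro mult_left_mono) auto
      then show ?thesis using le[of t s] by (auto simp: abs_minus_commute)
    qed
  qed (use t in \<open>auto intro!: continuous_intros cP\<close>)
  then have 1: "\<bar>(b - t) * integral {a..t} (\<lambda>s. P t - P s)\<bar> \<le> (b - t) * ((\<epsilon> * (t - a) + C) * (t - a))"
    using t by (simp add: abs_mult mult_left_mono)
  have "norm (integral {t..b} (\<lambda>s. P s - P t)) \<le> (\<epsilon> * (b - t) + C) * (b - t)"
  proof (rule integral_bound)
    show "norm (P s - P t) \<le> \<epsilon> * (b - t) + C" if "s \<in> {t..b}" for s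
    proof -
      have "\<epsilon> * \<bar>t - s\<bar> \<le> \<epsilon> * (b - t)" using that \<epsilon> by (intro mult_left_mono) auto
      then show ?thesis using le[of t s] by (auto simp: abs_minus_commute)
    qed
  qed (use t in \<open>auto intro!: continuous_intros cP\<close>)
  then have 2: "\<bar>(t - a) * integral {t..b} (\<lambda>s. P s - P t)\<bar> \<le> (t - a) * ((\<epsilon> * (b - t) + C) * (b - t))"
    using t by (simp add: abs_mult mult_left_mono)
  have "\<bar>green a b p t\<bar> = \<bar>(b - t) * integral {a..t} (\<lambda>s. P t - P s) + (t - a) * integral {t..b} (\<lambda>s. P s - P t)\<bar> / (b - a)"
    using ab by (simp add: green_def I' J')
  also have "\<dots> \<le> ((b - t) * ((\<epsilon> * (t - a) + C) * (t - a)) + (t - a) * ((\<epsilon> * (b - t) + C) * (b - t))) / (b - a)"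
    using 1 2 ab by (intro divide_right_mono) linarith+
  also have "\<dots> = (\<epsilon> + 2 * C / (b - a)) * ((t - a) * (b - t))"
    using ab by (simp add: field_simps)
  finally show ?thesis .
qed

text \<open>Meant for functions of an arc: near the zeros of the arc only a crude bound
  \<open>B\<close> is available, and the shortness of the edges pays for it.\<close>

lemma integral_le_edges:
  fixes f :: "real \<Rightarrow> real"
  assumes f: "continuous_on {a..b} f" and "0 \<le> \<delta>" "2 * \<delta> \<le> b - a" "0 \<le> \<epsilon>"
    and edge: "\<And>s. s \<in> {a..a+\<delta>} \<union> {b-\<delta>..b} \<Longrightarrow> f s \<le> B"
    and mid: "\<And>s. s \<in> {a+\<delta>..b-\<delta>} \<Longrightarrow> f s \<le> \<epsilon>"
  shows "integral {a..b} f \<le> 2 * \<delta> * B + \<epsilon> * (b - a)"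
proof -
  have i: "f integrable_on {x..y}" if "a \<le> x" "y \<le> b" for x y
    using that f by (intro integrable_continuous_real) (auto elim!: continuous_on_subset)
  have "integral {a..b} f = integral {a..a+\<delta>} f + integral {a+\<delta>..b-\<delta>} f + integral {b-\<delta>..b} f"
    using integral_split[of a "a+\<delta>" "b-\<delta>" f]
      integral_split[of a "b-\<delta>" b f] i assms by auto
  moreover have "integral {a..a+\<delta>} f \<le> integral {a..a+\<delta>} (\<lambda>_. B)"
    by (rule integral_le) (use i edge assms in auto)
  then have "integral {a..a+\<delta>} f \<le> \<delta> * B" using assms by simp
  moreover have "integral {b-\<delta>..b} f \<le> integral {b-\<delta>..b} (\<lambda>_. B)"
    by (rule integral_le) (use i edge assms in auto)
  then have "integral {b-\<delta>..b} f \<le> \<delta> * B" using assms by simp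
  moreover have "integral {a+\<delta>..b-\<delta>} f \<le> integral {a+\<delta>..b-\<delta>} (\<lambda>_. \<epsilon>)"
    by (rule integral_le) (use i mid assms in auto)
  then have "integral {a+\<delta>..b-\<delta>} f \<le> \<epsilon> * (b - \<delta> - (a + \<delta>))" using assms by (simp add: mult.commute)
  moreover have "\<epsilon> * (b - \<delta> - (a + \<delta>)) \<le> \<epsilon> * (b - a)"
    using assms by (intro mult_left_mono) auto
  ultimately show ?thesis by linarith
qed

section \<open>Positive arcs\<close>

text \<open>First-order form, with derivatives relative to \<open>S\<close>: on a closed interval
  they are one-sided at the ends, which suits gluing at nodes, and \<open>S = UNIV\<close> gives
  global solutions.\<close>

definition solves_on :: "(real \<Rightarrow> real) \<Rightarrow> (real \<Rightarrow> real) \<Rightarrow> real set \<Rightarrow> (real \<Rightarrow> real) \<Rightarrow> (real \<Rightarrow> real) \<Rightarrow> bool" where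
  "solves_on g p S u v \<longleftrightarrow> (\<forall>t\<in>S. (u has_real_derivative v t) (at t within S) \<and>
     (v has_real_derivative p t - g (u t)) (at t within S))"

lemma solves_onD:
  assumes "solves_on g p S u v" "t \<in> S"
  shows "(u has_real_derivative v t) (at t within S)"
    and "(v has_real_derivative p t - g (u t)) (at t within S)"
  using assms by (auto simp: solves_on_def)

lemma solves_on_continuous:
  assumes "solves_on g p S u v"
  shows "continuous_on S u" "continuous_on S v"
  using assms by (auto simp: solves_on_def intro!: DERIV_continuous_on)

lemma solves_on_subset: "solves_on g p S u v \<Longrightarrow> T \<subseteq> S \<Longrightarrow> solves_on g p T u v"
  unfolding solves_on_def by (meson DERIV_subset subsetD)

text \<open>\<open>g\<close> and \<open>p\<close> are normalised so that \<open>p\<close> has asymptotic average 0; \<open>gi\<close> is the limit of \<open>g\<close> at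
  infinity. Negative arcs are obtained from the reflected data \<open>- g (- x)\<close>, \<open>- p\<close>.\<close>

locale half_oscillator =
  fixes g p P :: "real \<Rightarrow> real" and M \<Gamma> gi :: real
  assumes g_bound: "\<And>x. \<bar>g x\<bar> \<le> M" and p_bound: "\<And>t. \<bar>p t\<bar> \<le> M"
    and g_lip: "\<And>x y. \<bar>g x - g y\<bar> \<le> \<Gamma> * \<bar>x - y\<bar>" and \<Gamma>_pos: "0 < \<Gamma>"
    and p_cont: "continuous_on UNIV p"
    and P_deriv: "\<And>t. (P has_real_derivative p t) (at t)"
    and P_small: "\<And>\<epsilon>. 0 < \<epsilon> \<Longrightarrow> \<exists>C. \<forall>s t. \<bar>P t - P s\<bar> \<le> \<epsilon> * \<bar>t - s\<bar> + C"
    and g_lim: "(g \<longlongrightarrow> gi) at_top" and gi_pos: "0 < gi"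
    and g_decay: "\<And>\<epsilon>. 0 < \<epsilon> \<Longrightarrow> \<exists>R>0. \<forall>z\<ge>R. \<forall>x\<ge>z. \<forall>y\<ge>z. \<bar>g x - g y\<bar> \<le> \<epsilon> / z * \<bar>x - y\<bar>"
begin

section \<open>Estimates on long intervals and existence of positive arcs\<close>

lemma M_nonneg: "0 \<le> M"
  using g_bound[of 0] by linarith

lemma g_cont: "continuous_on S g"
proof -
  have "\<Gamma>-lipschitz_on UNIV g"
    using g_lip \<Gamma>_pos by (intro lipschitz_onI) (auto simp: dist_real_def)
  then show ?thesis
    using lipschitz_on_continuous_on continuous_on_subset by blast
qed

lemma continuous_on_g_comp: "continuous_on S u \<Longrightarrow> continuous_on S (\<lambda>x. g (u x))"
  using continuous_on_compose2[OF g_cont[of UNIV]] by blast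

lemma p_cont': "continuous_on S p"
  using p_cont continuous_on_subset by blast

text \<open>The expected arc has the coefficient \<open>gi / 2\<close>. The weaker
  \<open>gi / 4\<close> leaves a margin for the error \<open>gi / 16\<close> and still forces
  \<open>w\<close> to be large away from the ends.\<close>

definition above :: "real \<Rightarrow> real \<Rightarrow> (real \<Rightarrow> real) \<Rightarrow> bool" where
  "above a b w \<longleftrightarrow> continuous_on {a..b} w \<and> (\<forall>s\<in>{a..b}. gi / 4 * ((s - a) * (b - s)) \<le> w s)"

definition green_contracts :: "real \<Rightarrow> real \<Rightarrow> bool" where
  "green_contracts a b \<longleftrightarrow> (\<forall>w1 w2 N. \<forall>t\<in>{a..b}. above a b w1 \<longrightarrow> above a b w2 \<longrightarrow>
     (\<forall>s\<in>{a..b}. \<bar>w1 s - w2 s\<bar> \<le> N) \<longrightarrow> \<bar>green a b (\<lambda>s. g (w1 s) - g (w2 s)) t\<bar> \<le> N / 2)"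

definition green_near_parabola :: "real \<Rightarrow> real \<Rightarrow> bool" where
  "green_near_parabola a b \<longleftrightarrow> (\<forall>w. \<forall>t\<in>{a..b}. above a b w \<longrightarrow>
     \<bar>green a b (\<lambda>s. g (w s) - p s) t - gi / 2 * ((t - a) * (b - t))\<bar> \<le> gi / 16 * ((t - a) * (b - t)))"

text \<open>Away from the ends both functions exceed a multiple of q = (s - a)(b - s), so the decay
  of \<open>g\<close> bounds the difference of forces by N / (4 q), and the weight q in the second
  kernel bound cancels the denominator. Near the ends only the Lipschitz constant is available, but
  there q \<le> \<delta> (b - a).\<close>

lemma green_contracts_if_long: "\<exists>L. \<forall>a b. L \<le> b - a \<longrightarrow> green_contracts a b"
proof -
  \<comment> \<open>With this choice the two edges contribute at most 2 \<delta>^2 \<Gamma> N \<le>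
    N / 4; the middle contributes the other N / 4.\<close>
  define \<delta> where "\<delta> = min 1 (1 / (8 * \<Gamma>))"
  have \<delta>: "0 < \<delta>" "\<delta> \<le> 1" "\<delta> * \<Gamma> \<le> 1 / 8" using \<Gamma>_pos by (auto simp: \<delta>_def min_def field_simps)
  obtain R where R: "0 < R" "\<And>z x y. R \<le> z \<Longrightarrow> z \<le> x \<Longrightarrow> z \<le> y \<Longrightarrow> \<bar>g x - g y\<bar> \<le> (gi / 16) / z * \<bar>x - y\<bar>"
    using g_decay[of "gi / 16"] gi_pos by auto
  \<comment> \<open>At distance at least \<delta> from the ends, q \<ge> \<delta> (b - a) / 2 \<ge>
    4 R / gi, so both functions exceed \<open>R\<close> there.\<close>
  define L0 where "L0 = 2 + 8 * R / (gi * \<delta>)"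
  have L0: "L0 > 0" "L0 \<ge> 2" using R gi_pos \<delta> by (auto simp: L0_def add_pos_pos)
  have "\<bar>green a b (\<lambda>s. g (w1 s) - g (w2 s)) t\<bar> \<le> N / 2"
    if ab: "L0 \<le> b - a" and c: "continuous_on {a..b} w1" "continuous_on {a..b} w2"
      and ge: "\<And>s. s \<in> {a..b} \<Longrightarrow> gi / 4 * ((s - a) * (b - s)) \<le> w1 s"
          "\<And>s. s \<in> {a..b} \<Longrightarrow> gi / 4 * ((s - a) * (b - s)) \<le> w2 s"
      and N: "\<And>s. s \<in> {a..b} \<Longrightarrow> \<bar>w1 s - w2 s\<bar> \<le> N" and t: "t \<in> {a..b}"
    for a b w1 w2 N t
  proof -
    define q where "q = (\<lambda>s. (s - a) * (b - s))"
    define e where "e = (\<lambda>s. \<bar>g (w1 s) - g (w2 s)\<bar>)"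
    have "a < b" using ab L0 by simp
    have N0: "0 \<le> N" using N[of a] \<open>a < b\<close> by auto
    have e1: "e s \<le> \<Gamma> * N" if "s \<in> {a..b}" for s
      using g_lip[of "w1 s" "w2 s"] mult_left_mono[OF N[OF that], of \<Gamma>] \<Gamma>_pos unfolding e_def by linarith
    have q0: "0 \<le> q s" if "s \<in> {a..b}" for s using that by (auto simp: q_def)
    have edge: "q s * e s \<le> \<delta> * (b - a) * (\<Gamma> * N)" if s: "s \<in> {a..a+\<delta>} \<union> {b-\<delta>..b}" for s
    proof -
      have s': "s \<in> {a..b}" using s \<delta> ab L0 by auto
      have "q s \<le> \<delta> * (b - a)"
      proof (cases "s \<le> a + \<delta>")
        case True
        have "(s - a) * (b - s) \<le> \<delta> * (b - a)" using True s' \<delta> by (intro mult_mono) auto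
        then show ?thesis by (simp add: q_def)
      next
        case False
        have "(b - s) * (s - a) \<le> \<delta> * (b - a)" using False s s' \<delta> by (intro mult_mono) auto
        then show ?thesis by (simp add: q_def mult.commute)
      qed
      then show ?thesis using e1[OF s'] q0[OF s']
        by (intro mult_mono) (auto simp: e_def)
    qed
    have mid: "q s * e s \<le> N / 4" if s: "s \<in> {a+\<delta>..b-\<delta>}" for s
    proof -
      have s': "s \<in> {a..b}" using s \<delta> by auto
      have "q s \<ge> \<delta> * ((b - a) / 2)"
      proof (cases "s - a \<le> (b - a) / 2")
        case True
        then show ?thesis unfolding q_def using s \<delta> by (intro mult_mono) auto
      next
        case False
        then have "(b - s) * (s - a) \<ge> \<delta> * ((b - a) / 2)" using s \<delta> by (intro mult_mono) auto
        then show ?thesis unfolding q_def by (simp add: mult.commute)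
      qed
      moreover have "\<delta> * ((b - a) / 2) \<ge> \<delta> * (L0 / 2)"
        using ab \<delta> by (intro mult_left_mono) auto
      moreover have "\<delta> * (L0 / 2) = \<delta> + 4 * R / gi" using \<delta> gi_pos by (simp add: L0_def field_simps)
      ultimately have q: "q s \<ge> 4 * R / gi" "q s > 0" using \<delta> R gi_pos by (smt (verit) divide_nonneg_pos)+
      then have "gi / 4 * q s \<ge> R" using gi_pos by (simp add: field_simps)
      then have "e s \<le> (gi / 16) / (gi / 4 * q s) * \<bar>w1 s - w2 s\<bar>"
        unfolding e_def using ge[OF s'] by (intro R) (auto simp: q_def)
      also have "\<dots> \<le> (gi / 16) / (gi / 4 * q s) * N"
        using N[OF s'] gi_pos q by (intro mult_left_mono) auto
      also have "\<dots> = N / 4 / q s" using gi_pos q by (simp add: field_simps)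
      finally show ?thesis using q by (simp add: field_simps)
    qed
    have "\<bar>green a b (\<lambda>s. g (w1 s) - g (w2 s)) t\<bar> \<le> 1 / (b - a) * integral {a..b} (\<lambda>s. q s * e s)"
      unfolding q_def e_def
      by (rule abs_green_le) (use \<open>a < b\<close> t in \<open>auto intro!: continuous_intros continuous_on_g_comp c\<close>)
    also have "\<dots> \<le> 1 / (b - a) * (2 * \<delta> * (\<delta> * (b - a) * (\<Gamma> * N)) + N / 4 * (b - a))"
      by (intro mult_left_mono integral_le_edges edge mid)
        (use \<delta> ab L0 N0 in \<open>auto simp: q_def e_def intro!: continuous_intros continuous_on_g_comp c\<close>)
    also have "\<dots> = 2 * \<delta> * ((\<delta> * \<Gamma>) * N) + N / 4" using \<open>a < b\<close> by (simp add: field_simps)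
    also have "2 * \<delta> * ((\<delta> * \<Gamma>) * N) \<le> 2 * 1 * ((1 / 8) * N)"
      using \<delta> N0 \<Gamma>_pos by (intro mult_mono) auto
    finally show ?thesis by linarith
  qed
  then show ?thesis unfolding green_contracts_def above_def by (intro exI[of _ L0]) blast
qed

text \<open>Write \<open>g (w s) - p s\<close> as \<open>gi\<close>, which yields exactly the
  parabola, plus \<open>g (w s) - gi\<close>, small except near the ends, minus \<open>p\<close>,
  small in the mean. Each of the two errors may use up \<open>gi / 32\<close>.\<close>

lemma green_near_parabola_if_long: "\<exists>L. \<forall>a b. L \<le> b - a \<longrightarrow> green_near_parabola a b"
proof -
  obtain C where C: "\<And>s t. \<bar>P t - P s\<bar> \<le> gi / 64 * \<bar>t - s\<bar> + C"
    using P_small[of "gi / 64"] gi_pos by auto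
  have C0: "0 \<le> C" using C[of 0 0] by simp
  obtain R0 where R0: "\<And>x. R0 \<le> x \<Longrightarrow> \<bar>g x - gi\<bar> < gi / 64"
    using tendstoD[OF g_lim, of "gi / 64"] gi_pos
    by (auto simp: eventually_at_top_linorder dist_real_def)
  define R where "R = max 1 R0"
  \<comment> \<open>The term 8 R / gi makes \<open>w\<close> exceed \<open>R0\<close> at distance 1
    from the ends, 128 C / gi makes 2 C / (b - a) \<le> gi / 64, and 512 M / gi absorbs the
    contribution 4 M of the edges.\<close>
  define L0 where "L0 = 4 + 8 * R / gi + 128 * C / gi + 512 * M / gi"
  have L0: "L0 > 0" "L0 \<ge> 4" "L0 \<ge> 8 * R / gi" "L0 \<ge> 128 * C / gi" "L0 \<ge> 512 * M / gi"
    using gi_pos C0 M_nonneg by (auto simp: L0_def R_def add_nonneg_nonneg add_pos_nonneg)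
  have gi_le: "gi \<le> M"
    using tendsto_upperbound[OF g_lim, of M] g_bound
    by (metis abs_le_D1 always_eventually trivial_limit_at_top_linorder)
  have "\<bar>green a b (\<lambda>s. g (w s) - p s) t - gi / 2 * ((t - a) * (b - t))\<bar> \<le> gi / 16 * ((t - a) * (b - t))"
    if ab: "L0 \<le> b - a" and c: "continuous_on {a..b} w"
      and ge: "\<And>s. s \<in> {a..b} \<Longrightarrow> gi / 4 * ((s - a) * (b - s)) \<le> w s" and t: "t \<in> {a..b}"
    for a b w t
  proof -
    define q where "q = (\<lambda>s. (s - a) * (b - s))"
    have "a < b" using ab L0 by simp
    have qt: "0 \<le> q t" using t by (simp add: q_def)
    have mid: "\<bar>g (w s) - gi\<bar> \<le> gi / 64" if s: "s \<in> {a+1..b-1}" for s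
    proof -
      have s': "s \<in> {a..b}" using s by auto
      have "q s \<ge> 1 * ((b - a) / 2)"
      proof (cases "s - a \<le> (b - a) / 2")
        case True
        then show ?thesis unfolding q_def using s by (intro mult_mono) auto
      next
        case False
        then have "(b - s) * (s - a) \<ge> 1 * ((b - a) / 2)" using s by (intro mult_mono) auto
        then show ?thesis unfolding q_def by (simp add: mult.commute)
      qed
      then have "gi * L0 \<le> gi * (2 * q s)" using ab gi_pos by (intro mult_left_mono) auto
      moreover have "8 * R \<le> gi * L0" using L0(3) gi_pos by (simp add: field_simps)
      ultimately have "gi / 4 * q s \<ge> R" by simp
      then have "w s \<ge> R0" using ge[OF s'] by (auto simp: q_def R_def)
      then show ?thesis using R0 by force
    qed
    have "integral {a..b} (\<lambda>s. \<bar>g (w s) - gi\<bar>) \<le> 2 * 1 * (2 * M) + gi / 64 * (b - a)"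
    proof (rule integral_le_edges)
      show "\<bar>g (w s) - gi\<bar> \<le> 2 * M" for s using g_bound[of "w s"] gi_le gi_pos by linarith
    qed (use mid ab L0 gi_pos in \<open>auto intro!: continuous_intros continuous_on_g_comp c\<close>)
    moreover have "4 * M \<le> gi / 64 * (b - a)"
    proof -
      have "512 * M \<le> gi * L0" using L0(5) gi_pos by (simp add: field_simps)
      also have "\<dots> \<le> gi * (b - a)" using ab gi_pos by (intro mult_left_mono) auto
      finally show ?thesis using M_nonneg by simp
    qed
    ultimately have int: "integral {a..b} (\<lambda>s. \<bar>g (w s) - gi\<bar>) \<le> gi / 32 * (b - a)" by simp
    have A: "\<bar>green a b (\<lambda>s. g (w s) - gi) t\<bar> \<le> gi / 32 * q t"
    proof -
      have "\<bar>green a b (\<lambda>s. g (w s) - gi) t\<bar> \<le> q t / (b - a) * integral {a..b} (\<lambda>s. \<bar>g (w s) - gi\<bar>)"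
        unfolding q_def by (rule abs_green_le) (use \<open>a < b\<close> t in \<open>auto intro!: continuous_intros continuous_on_g_comp c\<close>)
      also have "\<dots> \<le> q t / (b - a) * (gi / 32 * (b - a))"
        using int qt \<open>a < b\<close> by (intro mult_left_mono) auto
      finally show ?thesis using \<open>a < b\<close> by (simp add: mult.commute)
    qed
    have B: "\<bar>green a b p t\<bar> \<le> gi / 32 * q t"
    proof -
      have "\<bar>green a b p t\<bar> \<le> (gi / 64 + 2 * C / (b - a)) * q t"
        unfolding q_def by (rule abs_green_derivative_le[OF \<open>a < b\<close> t P_deriv p_cont C]) (use gi_pos in auto)
      also have "2 * C / (b - a) \<le> gi / 64"
      proof -
        have "128 * C \<le> gi * L0" using L0(4) gi_pos by (simp add: field_simps)
        also have "\<dots> \<le> gi * (b - a)" using ab gi_pos by (intro mult_left_mono) auto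
        finally show ?thesis using \<open>a < b\<close> by (simp add: field_simps)
      qed
      finally show ?thesis using qt by (simp add: mult_right_mono)
    qed
    have "green a b (\<lambda>s. g (w s) - p s) t = green a b (\<lambda>s. g (w s)) t - green a b p t"
      by (rule green_diff) (use t in \<open>auto intro!: continuous_intros continuous_on_g_comp c p_cont'\<close>)
    moreover have "green a b (\<lambda>s. g (w s) - gi) t = green a b (\<lambda>s. g (w s)) t - green a b (\<lambda>s. gi) t"
      by (rule green_diff) (use t in \<open>auto intro!: continuous_intros continuous_on_g_comp c p_cont'\<close>)
    moreover have "green a b (\<lambda>s. gi) t = gi / 2 * q t"
      unfolding q_def by (rule green_const[OF \<open>a < b\<close> t])
    ultimately show ?thesis using A B unfolding q_def by linarith
  qed
  then show ?thesis unfolding green_near_parabola_def above_def by (intro exI[of _ L0]) blast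
qed

definition L0 :: real where
  "L0 = (SOME L. 1 \<le> L \<and> (\<forall>a b. L \<le> b - a \<longrightarrow> green_contracts a b \<and> green_near_parabola a b))"

lemma L0: "1 \<le> L0" "L0 \<le> b - a \<Longrightarrow> green_contracts a b" "L0 \<le> b - a \<Longrightarrow> green_near_parabola a b"
proof -
  obtain l1 l2 where "\<forall>a b. l1 \<le> b - a \<longrightarrow> green_contracts a b" "\<forall>a b. l2 \<le> b - a \<longrightarrow> green_near_parabola a b"
    using green_contracts_if_long green_near_parabola_if_long by blast
  then have "\<exists>L. 1 \<le> L \<and> (\<forall>a b. L \<le> b - a \<longrightarrow> green_contracts a b \<and> green_near_parabola a b)"
    by (intro exI[of _ "max 1 (max l1 l2)"]) auto
  then have "1 \<le> L0 \<and> (\<forall>a b. L0 \<le> b - a \<longrightarrow> green_contracts a b \<and> green_near_parabola a b)"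
    unfolding L0_def by (rule someI_ex)
  then show "1 \<le> L0" "L0 \<le> b - a \<Longrightarrow> green_contracts a b" "L0 \<le> b - a \<Longrightarrow> green_near_parabola a b" by auto
qed

lemma green_contraction:
  assumes "L0 \<le> b - a" "above a b w1" "above a b w2"
    "\<And>s. s \<in> {a..b} \<Longrightarrow> \<bar>w1 s - w2 s\<bar> \<le> N" "t \<in> {a..b}"
  shows "\<bar>green a b (\<lambda>s. g (w1 s) - g (w2 s)) t\<bar> \<le> N / 2"
  using L0(2)[OF assms(1)] assms(2-) unfolding green_contracts_def by blast

definition positive_arc :: "real \<Rightarrow> real \<Rightarrow> (real \<Rightarrow> real) \<Rightarrow> (real \<Rightarrow> real) \<Rightarrow> bool" where
  "positive_arc a b u v \<longleftrightarrow> solves_on g p {a..b} u v \<and> u a = 0 \<and> u b = 0 \<and>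
     (\<forall>t\<in>{a..b}. \<bar>u t - gi / 2 * ((t - a) * (b - t))\<bar> \<le> gi / 16 * ((t - a) * (b - t)))"

text \<open>The Green operator contracts only among functions above the parabola, and these do not
  fill a complete space of functions on the line. The integrand is therefore truncated from below by
  \<open>q\<close>; the parabola estimate then shows that the truncation is inactive at the fixed
  point.\<close>

lemma positive_arc_exists:
  assumes ab: "L0 \<le> b - a"
  shows "\<exists>u v. positive_arc a b u v"
proof -
  have "a < b" using ab L0(1) by simp
  define q where "q = (\<lambda>s. gi / 4 * ((s - a) * (b - s)))"
  define F where "F = (\<lambda>(v::real \<Rightarrow>\<^sub>C real) s. g (max (v s) (q s)) - p s)"
  \<comment> \<open>Clamping the time turns functions on [a, b] into bounded continuous functions on
    the whole line, where the fixed point theorem is applied.\<close>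
  define k where "k = (\<lambda>t. max a (min b t))"
  have k: "k t \<in> {a..b}" for t using \<open>a < b\<close> by (auto simp: k_def)
  have kc: "continuous_on S k" for S unfolding k_def by (intro continuous_intros)
  have cv: "continuous_on S (apply_bcontfun v)" for v :: "real \<Rightarrow>\<^sub>C real" and S
    using continuous_on_apply_bcontfun continuous_on_subset by blast
  have cm: "continuous_on S (\<lambda>s. max (apply_bcontfun v s) (q s))" for v S
    unfolding q_def by (intro continuous_intros cv)
  have above: "above a b (\<lambda>s. max (apply_bcontfun v s) (q s))" for v
    unfolding above_def using cm by (auto simp: q_def)
  have cF: "continuous_on S (F v)" for v S
    unfolding F_def by (intro continuous_intros continuous_on_g_comp cm p_cont')
  have gc: "continuous_on {a..b} (green a b (F v))" for v
    by (rule DERIV_continuous_on[OF green_has_derivative(1)[OF \<open>a < b\<close> cF]])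
  define T where "T = (\<lambda>v. Bcontfun (\<lambda>t. green a b (F v) (k t)))"
  have T: "apply_bcontfun (T v) t = green a b (F v) (k t)" for v t
  proof -
    have "bounded (green a b (F v) ` {a..b})"
      by (intro compact_imp_bounded compact_continuous_image gc) auto
    then obtain B where B: "\<And>x. x \<in> {a..b} \<Longrightarrow> norm (green a b (F v) x) \<le> B"
      unfolding bounded_iff by blast
    have "(\<lambda>t. green a b (F v) (k t)) \<in> bcontfun"
    proof (rule bcontfun_normI)
      show "continuous_on UNIV (\<lambda>t. green a b (F v) (k t))"
        by (rule continuous_on_compose2[OF gc kc]) (use k in auto)
      show "norm (green a b (F v) (k t)) \<le> B" for t using B k by blast
    qed
    then show ?thesis unfolding T_def by (simp add: Bcontfun_inverse)
  qed
  have "\<exists>!v. T v = v"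
  proof (rule banach_fix_type[of "1/2"])
    show "\<forall>v w. dist (T v) (T w) \<le> 1 / 2 * dist v w"
    proof (intro allI dist_bound)
      fix v w :: "real \<Rightarrow>\<^sub>C real" and t
      have "\<bar>green a b (\<lambda>s. g (max (v s) (q s)) - g (max (w s) (q s))) (k t)\<bar> \<le> dist v w / 2"
      proof (rule green_contraction[OF ab above above])
        fix s
        have "\<bar>v s - w s\<bar> \<le> dist v w"
          using dist_bounded[of v s w] by (simp add: dist_real_def)
        then show "\<bar>max (v s) (q s) - max (w s) (q s)\<bar> \<le> dist v w" by linarith
      qed (rule k)
      moreover have "green a b (\<lambda>s. g (max (v s) (q s)) - g (max (w s) (q s))) (k t)
           = green a b (F v) (k t) - green a b (F w) (k t)"
        using green_diff[OF cF cF k, of v w t] by (simp add: F_def)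
      ultimately show "dist (T v t) (T w t) \<le> 1 / 2 * dist v w"
        by (simp add: T dist_real_def)
    qed
  qed auto
  then obtain v where v: "T v = v" by auto
  define u where "u = green a b (F v)"
  have ku: "k t = t" if "t \<in> {a..b}" for t using that by (auto simp: k_def)
  have uv: "v t = u t" if "t \<in> {a..b}" for t
    using T[of v t] v ku[OF that] by (simp add: u_def)
  have est: "\<bar>u t - gi / 2 * ((t - a) * (b - t))\<bar> \<le> gi / 16 * ((t - a) * (b - t))" if "t \<in> {a..b}" for t
    using L0(3)[OF ab] above that unfolding green_near_parabola_def u_def F_def by blast
  \<comment> \<open>The coefficient 1/2 - 1/16 exceeds 1/4, so the maximum with \<open>q\<close> is
    attained by the solution itself.\<close>
  have uq: "q t \<le> u t" if "t \<in> {a..b}" for t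
  proof -
    have "0 \<le> gi * ((t - a) * (b - t))" using that gi_pos by auto
    then show ?thesis using est[OF that] unfolding q_def by linarith
  qed
  have Fu: "F v t = g (u t) - p t" if "t \<in> {a..b}" for t
    using uv[OF that] uq[OF that] by (simp add: F_def max_def)
  have "positive_arc a b u (green_slope a b (F v))"
    unfolding positive_arc_def solves_on_def
  proof (intro conjI ballI)
    fix t assume t: "t \<in> {a..b}"
    show "(u has_real_derivative green_slope a b (F v) t) (at t within {a..b})"
      unfolding u_def by (intro green_has_derivative \<open>a < b\<close> cF t)
    have "(green_slope a b (F v) has_real_derivative - F v t) (at t within {a..b})"
      by (intro green_has_derivative \<open>a < b\<close> cF t)
    then show "(green_slope a b (F v) has_real_derivative p t - g (u t)) (at t within {a..b})"
      using Fu[OF t] by simp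
  qed (use est in \<open>auto simp: u_def\<close>)
  then show ?thesis by blast
qed

end

section \<open>Calculus: primitives, one-sided derivatives, quadratic remainders\<close>

lemma antiderivative_exists:
  fixes f :: "real \<Rightarrow> real"
  assumes "continuous_on UNIV f"
  obtains F where "\<And>x. (F has_real_derivative f x) (at x)" "F 0 = 0"
proof -
  \<comment> \<open>An integral over a reversed interval is 0, so at most one of the two terms is
    active, according to the sign of \<open>x\<close>.\<close>
  define F where "F = (\<lambda>x. integral {0..x} f - integral {x..0} f)"
  have i: "f integrable_on {a..b}" for a b
    using assms continuous_on_subset by (intro integrable_continuous_real) blast
  have "(F has_real_derivative f x) (at x)" for x
  proof -
    define N where "N = \<bar>x\<bar> + 1"
    have eq: "F y = integral {- N..y} f - integral {- N..0} f" if "y \<in> {- N<..<N}" for y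
    proof (cases "y \<ge> 0")
      case True
      then have "integral {y..0} f = 0" by (cases "y = 0") auto
      then show ?thesis
        using integral_split[of "- N" 0 y f] i that True by (simp add: F_def N_def)
    next
      case False
      then have "integral {0..y} f = 0" by auto
      then show ?thesis
        using integral_split[of "- N" y 0 f] i that False by (simp add: F_def)
    qed
    have "((\<lambda>y. integral {- N..y} f) has_real_derivative f x) (at x within {- N..N})"
      using assms by (intro integral_has_real_derivative) (auto simp: N_def elim: continuous_on_subset)
    moreover have "at x within {- N..N} = at x"
      by (intro at_within_interior) (auto simp: N_def)
    ultimately have "((\<lambda>y. integral {- N..y} f - integral {- N..0} f) has_real_derivative f x) (at x)"
      by (auto intro!: derivative_eq_intros)
    then show ?thesis
      by (rule has_field_derivative_transform_within_open[of _ _ _ "{- N<..<N}"])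
        (use eq in \<open>auto simp: N_def\<close>)
  qed
  moreover have "F 0 = 0" by (simp add: F_def)
  ultimately show ?thesis using that by blast
qed

lemma has_real_derivative_nonneg_left:
  fixes f :: "real \<Rightarrow> real"
  assumes "(f has_real_derivative D) (at a within {a..b})" "a < b" "f a = 0"
    and "\<And>t. t \<in> {a..b} \<Longrightarrow> 0 \<le> f t"
  shows "0 \<le> D"
proof (rule tendsto_lowerbound)
  show "((\<lambda>t. (f t - f a) / (t - a)) \<longlongrightarrow> D) (at a within {a..b})"
    using assms(1) by (simp add: has_field_derivative_iff)
  show "\<forall>\<^sub>F t in at a within {a..b}. 0 \<le> (f t - f a) / (t - a)"
    unfolding eventually_at_filter using assms by (intro always_eventually) auto
  show "at a within {a..b} \<noteq> bot"
    using assms(2) by (simp add: at_within_Icc_at_right)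
qed

lemma has_real_derivative_nonpos_right:
  fixes f :: "real \<Rightarrow> real"
  assumes "(f has_real_derivative D) (at b within {a..b})" "a < b" "f b = 0"
    and "\<And>t. t \<in> {a..b} \<Longrightarrow> 0 \<le> f t"
  shows "D \<le> 0"
proof (rule tendsto_upperbound)
  show "((\<lambda>t. (f t - f b) / (t - b)) \<longlongrightarrow> D) (at b within {a..b})"
    using assms(1) by (simp add: has_field_derivative_iff)
  show "\<forall>\<^sub>F t in at b within {a..b}. (f t - f b) / (t - b) \<le> 0"
    unfolding eventually_at_filter using assms
    by (intro always_eventually) (auto simp: divide_nonneg_nonpos)
  show "at b within {a..b} \<noteq> bot"
    using assms(2) by (simp add: at_within_Icc_at_left)
qed

text \<open>The expansion is available only about the left one of two points, because arcs are
  compared on nested intervals. For y < c the base point is changed from y to c, and the Lipschitz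
  bound on \<open>D\<close> pays for this change.\<close>

lemma has_real_derivative_quadratic_remainder:
  fixes f D :: "real \<Rightarrow> real"
  assumes "0 < e"
    and f: "\<And>x y. \<bar>x - c\<bar> < e \<Longrightarrow> \<bar>y - c\<bar> < e \<Longrightarrow> x \<le> y \<Longrightarrow> \<bar>f y - f x - D x * (y - x)\<bar> \<le> B * (y - x)\<^sup>2"
    and D: "\<And>x y. \<bar>x - c\<bar> < e \<Longrightarrow> \<bar>y - c\<bar> < e \<Longrightarrow> x \<le> y \<Longrightarrow> \<bar>D y - D x\<bar> \<le> B * (y - x)"
  shows "(f has_real_derivative D c) (at c)"
proof -
  have "\<bar>(f y - f c) / (y - c) - D c\<bar> \<le> 2 * \<bar>B\<bar> * \<bar>y - c\<bar>" if y: "\<bar>y - c\<bar> < e" "y \<noteq> c" for y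
  proof -
    have "\<bar>f y - f c - D c * (y - c)\<bar> \<le> 2 * \<bar>B\<bar> * (y - c)\<^sup>2"
    proof (cases "c \<le> y")
      case True
      have "B * (y - c)\<^sup>2 \<le> \<bar>B\<bar> * (y - c)\<^sup>2" "0 \<le> \<bar>B\<bar> * (y - c)\<^sup>2" by (auto intro!: mult_right_mono)
      moreover have "\<bar>f y - f c - D c * (y - c)\<bar> \<le> B * (y - c)\<^sup>2" using f[of c y] True y \<open>0 < e\<close> by simp
      ultimately show ?thesis by linarith
    next
      case False
      have 1: "\<bar>f c - f y - D y * (c - y)\<bar> \<le> B * (c - y)\<^sup>2" using f[of y c] False y \<open>0 < e\<close> by simp
      have "\<bar>D c - D y\<bar> \<le> B * (c - y)" using D[of y c] False y \<open>0 < e\<close> by simp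
      then have "\<bar>D c - D y\<bar> * (c - y) \<le> B * (c - y) * (c - y)" using False by (intro mult_right_mono) auto
      then have 2: "\<bar>(D c - D y) * (c - y)\<bar> \<le> B * (c - y)\<^sup>2"
        using False by (simp add: abs_mult power2_eq_square)
      have "f y - f c - D c * (y - c) = (D c - D y) * (c - y) - (f c - f y - D y * (c - y))"
        by (simp add: algebra_simps)
      then have "\<bar>f y - f c - D c * (y - c)\<bar> \<le> 2 * B * (c - y)\<^sup>2" using 1 2 by linarith
      also have "\<dots> \<le> 2 * \<bar>B\<bar> * (c - y)\<^sup>2" by (intro mult_right_mono) auto
      finally show ?thesis by (simp add: power2_commute)
    qed
    then have "\<bar>f y - f c - D c * (y - c)\<bar> / \<bar>y - c\<bar> \<le> 2 * \<bar>B\<bar> * (y - c)\<^sup>2 / \<bar>y - c\<bar>"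
      by (rule divide_right_mono) simp
    also have "2 * \<bar>B\<bar> * (y - c)\<^sup>2 / \<bar>y - c\<bar> = 2 * \<bar>B\<bar> * \<bar>y - c\<bar>"
    proof -
      define r where "r = \<bar>y - c\<bar>"
      have "(y - c)\<^sup>2 = r * r" "r \<noteq> 0" using y(2) by (auto simp: power2_eq_square r_def)
      then show ?thesis by (simp flip: r_def)
    qed
    also have "\<bar>f y - f c - D c * (y - c)\<bar> / \<bar>y - c\<bar> = \<bar>(f y - f c) / (y - c) - D c\<bar>"
      using y(2) by (simp add: diff_divide_distrib flip: abs_divide)
    finally show ?thesis .
  qed
  then have ev: "\<forall>\<^sub>F y in at c. norm ((f y - f c) / (y - c) - D c) \<le> 2 * \<bar>B\<bar> * \<bar>y - c\<bar>"
    unfolding eventually_at using \<open>0 < e\<close> by (intro exI[of _ e]) (auto simp: dist_real_def)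
  have "((\<lambda>y. 2 * \<bar>B\<bar> * \<bar>y - c\<bar>) \<longlongrightarrow> 0) (at c)"
    by (auto intro!: tendsto_eq_intros)
  from Lim_null_comparison[OF ev this] show ?thesis
    by (simp add: has_field_derivative_iff LIM_zero_iff)
qed

lemma real_lipschitz_of_derivative:
  fixes f :: "real \<Rightarrow> real"
  assumes "convex S" "\<And>x. x \<in> S \<Longrightarrow> (f has_real_derivative f' x) (at x within S)"
    "\<And>x. x \<in> S \<Longrightarrow> \<bar>f' x\<bar> \<le> B" "x \<in> S" "y \<in> S"
  shows "\<bar>f x - f y\<bar> \<le> B * \<bar>x - y\<bar>"
  using field_differentiable_bound[of S f f' B x y] assms by simp

section \<open>Potential, stability and a priori bounds of positive arcs\<close>

context half_oscillator
begin

definition G :: "real \<Rightarrow> real" where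
  "G = (SOME F. (\<forall>x. (F has_real_derivative g x) (at x)) \<and> F 0 = 0)"

lemma G: "(G has_real_derivative g x) (at x within S)" "G 0 = 0"
proof -
  have "\<exists>F. (\<forall>x. (F has_real_derivative g x) (at x)) \<and> F 0 = 0"
    using antiderivative_exists[OF g_cont[of UNIV]] by metis
  then have "(\<forall>x. (G has_real_derivative g x) (at x)) \<and> G 0 = 0"
    unfolding G_def by (rule someI_ex)
  then show "(G has_real_derivative g x) (at x within S)" "G 0 = 0"
    using has_field_derivative_at_within by blast+
qed

lemma abs_G_le: "\<bar>G x\<bar> \<le> M * \<bar>x\<bar>"
  using real_lipschitz_of_derivative[of UNIV G g M x 0] G g_bound by auto

lemma G_remainder: "\<bar>G y - G x - g x * (y - x)\<bar> \<le> \<Gamma> * (y - x)\<^sup>2"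
proof -
  have "\<bar>(G y - g x * y) - (G x - g x * x)\<bar> \<le> \<Gamma> * \<bar>y - x\<bar> * \<bar>y - x\<bar>"
  proof (rule real_lipschitz_of_derivative[where S="closed_segment x y" and f="\<lambda>z. G z - g x * z" and f'="\<lambda>z. g z - g x"])
    fix z assume z: "z \<in> closed_segment x y"
    show "((\<lambda>z. G z - g x * z) has_real_derivative g z - g x) (at z within closed_segment x y)"
      by (auto intro!: derivative_eq_intros G)
    have "\<bar>z - x\<bar> \<le> \<bar>y - x\<bar>" using z by (auto simp: closed_segment_eq_real_ivl split: if_splits)
    then have "\<Gamma> * \<bar>z - x\<bar> \<le> \<Gamma> * \<bar>y - x\<bar>" using \<Gamma>_pos by simp
    then show "\<bar>g z - g x\<bar> \<le> \<Gamma> * \<bar>y - x\<bar>" using g_lip[of z x] by linarith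
  qed auto
  moreover have "(G y - g x * y) - (G x - g x * x) = G y - G x - g x * (y - x)" by (simp add: algebra_simps)
  ultimately show ?thesis by (simp add: power2_eq_square)
qed

lemma continuous_on_G_comp: "continuous_on S u \<Longrightarrow> continuous_on S (\<lambda>x. G (u x))"
  using continuous_on_compose2[OF DERIV_continuous_on[OF G(1), of UNIV]] by blast

text \<open>The difference w of the solutions is \<open>green\<close> of the difference of the
  forces plus the affine interpolation of the boundary values. Where |w| is maximal the contraction
  gives |w| \<le> |w| / 2 + \<beta>. The case \<beta> = 0 is uniqueness of the arc above the
  parabola.\<close>

lemma stability:
  assumes ab: "L0 \<le> b - a" and u1: "positive_arc a b u1 v1" and u2: "solves_on g p {a..b} u2 v2"
    and ge: "\<And>s. s \<in> {a..b} \<Longrightarrow> gi / 4 * ((s - a) * (b - s)) \<le> u2 s"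
    and bd: "\<bar>u2 a\<bar> \<le> \<beta>" "\<bar>u2 b\<bar> \<le> \<beta>" and t: "t \<in> {a..b}"
  shows "\<bar>u2 t - u1 t\<bar> \<le> 2 * \<beta>"
proof -
  have "a < b" using ab L0(1) by simp
  define w where "w = (\<lambda>t. u2 t - u1 t)"
  have s1: "solves_on g p {a..b} u1 v1" and z: "u1 a = 0" "u1 b = 0" using u1 by (auto simp: positive_arc_def)
  note c = solves_on_continuous[OF s1] solves_on_continuous[OF u2]
  have ge1: "gi / 4 * ((s - a) * (b - s)) \<le> u1 s" if "s \<in> {a..b}" for s
  proof -
    have "0 \<le> gi * ((s - a) * (b - s))" using that gi_pos by auto
    moreover have "\<bar>u1 s - gi / 2 * ((s - a) * (b - s))\<bar> \<le> gi / 16 * ((s - a) * (b - s))"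
      using u1 that by (auto simp: positive_arc_def)
    ultimately show ?thesis by linarith
  qed
  have "continuous_on {a..b} (\<lambda>t. \<bar>w t\<bar>)" unfolding w_def by (intro continuous_intros c)
  then obtain t0 where t0: "t0 \<in> {a..b}" "\<And>t. t \<in> {a..b} \<Longrightarrow> \<bar>w t\<bar> \<le> \<bar>w t0\<bar>"
    using continuous_attains_sup[of "{a..b}" "\<lambda>t. \<bar>w t\<bar>"] \<open>a < b\<close> by auto
  have "w t0 = green a b (\<lambda>s. g (u2 s) - g (u1 s)) t0 + ((b - t0) * w a + (t0 - a) * w b) / (b - a)"
  proof (rule green_unique[where w'="\<lambda>t. v2 t - v1 t", OF \<open>a < b\<close> _ _ _ t0(1)])
    show "continuous_on {a..b} (\<lambda>s. g (u2 s) - g (u1 s))"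
      by (intro continuous_intros continuous_on_g_comp c)
    fix t assume t: "t \<in> {a..b}"
    show "(w has_real_derivative v2 t - v1 t) (at t within {a..b})"
      unfolding w_def by (intro DERIV_diff solves_onD[OF s1 t] solves_onD[OF u2 t])
    show "((\<lambda>t. v2 t - v1 t) has_real_derivative - (g (u2 t) - g (u1 t))) (at t within {a..b})"
      by (rule DERIV_cong[OF DERIV_diff[OF solves_onD(2)[OF u2 t] solves_onD(2)[OF s1 t]]]) simp
  qed
  moreover have "\<bar>green a b (\<lambda>s. g (u2 s) - g (u1 s)) t0\<bar> \<le> \<bar>w t0\<bar> / 2"
    by (rule green_contraction[OF ab]) (use c ge ge1 t0 in \<open>auto simp: w_def above_def\<close>)
  moreover have "\<bar>((b - t0) * w a + (t0 - a) * w b) / (b - a)\<bar> \<le> \<beta>"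
  proof -
    have "\<bar>(b - t0) * w a + (t0 - a) * w b\<bar> \<le> \<bar>(b - t0) * w a\<bar> + \<bar>(t0 - a) * w b\<bar>" by (rule abs_triangle_ineq)
    also have "\<dots> \<le> (b - t0) * \<beta> + (t0 - a) * \<beta>"
      using t0 bd z by (auto simp: abs_mult w_def intro!: add_mono mult_left_mono)
    also have "\<dots> = \<beta> * (b - a)" by (simp add: algebra_simps)
    finally show ?thesis using \<open>a < b\<close> by (simp add: pos_divide_le_eq)
  qed
  moreover have "\<bar>x\<bar> \<le> 2 * \<beta>" if "x = y + z" "\<bar>y\<bar> \<le> \<bar>x\<bar> / 2" "\<bar>z\<bar> \<le> \<beta>" for x y z :: real
    using that by linarith
  ultimately have "\<bar>w t0\<bar> \<le> 2 * \<beta>" by blast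
  then show ?thesis using t0(2)[OF t] by (simp add: w_def)
qed

lemma positive_arcD:
  assumes "positive_arc a b u v"
  shows "solves_on g p {a..b} u v" "u a = 0" "u b = 0"
    and "t \<in> {a..b} \<Longrightarrow> 7 / 16 * gi * ((t - a) * (b - t)) \<le> u t"
    and "t \<in> {a..b} \<Longrightarrow> u t \<le> 9 / 16 * gi * ((t - a) * (b - t))"
proof -
  show "solves_on g p {a..b} u v" "u a = 0" "u b = 0" using assms by (auto simp: positive_arc_def)
  assume t: "t \<in> {a..b}"
  have *: "\<bar>u t - gi / 2 * ((t - a) * (b - t))\<bar> \<le> gi / 16 * ((t - a) * (b - t))"
    using assms t by (auto simp: positive_arc_def)
  define q where "q = gi * ((t - a) * (b - t))"
  have "\<bar>u t - q / 2\<bar> \<le> q / 16" using * by (simp add: q_def)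
  then have "7 / 16 * q \<le> u t" "u t \<le> 9 / 16 * q" by linarith+
  then show "7 / 16 * gi * ((t - a) * (b - t)) \<le> u t" "u t \<le> 9 / 16 * gi * ((t - a) * (b - t))"
    by (auto simp: q_def mult.assoc)
qed

text \<open>The arc lies between two parabolas with which it agrees at the ends, so the one-sided
  slopes there are ordered; 7/16 and 9/16 are 1/2 minus and plus 1/16.\<close>

lemma positive_arc_slopes:
  assumes "positive_arc a b u v" "a < b"
  shows "7 / 16 * gi * (b - a) \<le> v a" "v a \<le> 9 / 16 * gi * (b - a)"
    and "7 / 16 * gi * (b - a) \<le> - v b" "- v b \<le> 9 / 16 * gi * (b - a)"
proof -
  note s = positive_arcD[OF assms(1)]
  have q: "((\<lambda>t. c * gi * ((t - a) * (b - t))) has_real_derivative c * gi * (a + b - 2 * t)) (at t within {a..b})" for c t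
    by (auto intro!: derivative_eq_intros simp: algebra_simps)
  have ins: "a \<in> {a..b}" "b \<in> {a..b}" using assms by auto
  have "0 \<le> v a - 7 / 16 * gi * (a + b - 2 * a)"
    by (rule has_real_derivative_nonneg_left[OF DERIV_diff[OF solves_onD(1)[OF s(1) ins(1)] q] assms(2)])
      (use s in auto)
  then show "7 / 16 * gi * (b - a) \<le> v a" by simp
  have "0 \<le> 9 / 16 * gi * (a + b - 2 * a) - v a"
    by (rule has_real_derivative_nonneg_left[OF DERIV_diff[OF q solves_onD(1)[OF s(1) ins(1)]] assms(2)])
      (use s in auto)
  then show "v a \<le> 9 / 16 * gi * (b - a)" by simp
  have "v b - 7 / 16 * gi * (a + b - 2 * b) \<le> 0"
    by (rule has_real_derivative_nonpos_right[OF DERIV_diff[OF solves_onD(1)[OF s(1) ins(2)] q] assms(2)])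
      (use s in auto)
  then show "7 / 16 * gi * (b - a) \<le> - v b" by (simp add: algebra_simps)
  have "9 / 16 * gi * (a + b - 2 * b) - v b \<le> 0"
    by (rule has_real_derivative_nonpos_right[OF DERIV_diff[OF q solves_onD(1)[OF s(1) ins(2)]] assms(2)])
      (use s in auto)
  then show "- v b \<le> 9 / 16 * gi * (b - a)" by (simp add: algebra_simps)
qed

lemma slope_lipschitz:
  assumes "solves_on g p {a..b} u v" "s \<in> {a..b}" "t \<in> {a..b}"
  shows "\<bar>v s - v t\<bar> \<le> 2 * M * \<bar>s - t\<bar>"
proof (rule real_lipschitz_of_derivative[of "{a..b}" v "\<lambda>t. p t - g (u t)"])
  show "\<bar>p x - g (u x)\<bar> \<le> 2 * M" for x using p_bound[of x] g_bound[of "u x"] by linarith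
qed (use assms in \<open>auto simp: solves_on_def\<close>)

lemma positive_arc_bounds:
  assumes u: "positive_arc a b u v" and ab: "a < b" "b - a \<le> D" and t: "t \<in> {a..b}"
  shows "\<bar>v t\<bar> \<le> (gi + 2 * M) * D" "0 \<le> u t" "u t \<le> gi * D\<^sup>2"
proof -
  have "\<bar>v t\<bar> \<le> \<bar>v a\<bar> + \<bar>v t - v a\<bar>" by simp
  also have "\<bar>v t - v a\<bar> \<le> 2 * M * \<bar>t - a\<bar>"
    by (rule slope_lipschitz[OF positive_arcD(1)[OF u]]) (use t in auto)
  also have "\<dots> \<le> 2 * M * D" using ab t M_nonneg by (intro mult_left_mono) auto
  also have "\<bar>v a\<bar> \<le> 9 / 16 * gi * (b - a)"
  proof -
    have "0 \<le> gi * (b - a)" using gi_pos ab by simp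
    then show ?thesis using positive_arc_slopes(1,2)[OF u ab(1)] by linarith
  qed
  also have "9 / 16 * gi * (b - a) \<le> gi * D" using gi_pos ab by (intro mult_mono) auto
  finally show "\<bar>v t\<bar> \<le> (gi + 2 * M) * D" by (simp add: algebra_simps)
  have q: "0 \<le> gi * ((t - a) * (b - t))" using gi_pos t by auto
  show "0 \<le> u t" using positive_arcD(4)[OF u t] q by linarith
  have "gi * ((t - a) * (b - t)) \<le> gi * (D * D)"
    using gi_pos ab t by (intro mult_left_mono mult_mono) auto
  then show "u t \<le> gi * D\<^sup>2" using positive_arcD(5)[OF u t] q by (simp add: power2_eq_square)
qed

end

section \<open>The action of an arc\<close>

lemma integral_near_const:
  fixes f :: "real \<Rightarrow> real"
  assumes "a \<le> b" "continuous_on {a..b} f" "\<And>t. t \<in> {a..b} \<Longrightarrow> \<bar>f t - c\<bar> \<le> e"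
  shows "\<bar>integral {a..b} f - c * (b - a)\<bar> \<le> e * (b - a)"
proof -
  have "norm (integral {a..b} (\<lambda>t. f t - c)) \<le> e * (b - a)"
    by (rule integral_bound) (use assms in \<open>auto intro!: continuous_intros\<close>)
  moreover have "integral {a..b} (\<lambda>t. f t - c) = integral {a..b} f - integral {a..b} (\<lambda>t. c)"
    by (intro integral_diff integrable_continuous_real assms continuous_intros)
  ultimately show ?thesis using assms(1) by (simp add: mult.commute)
qed

context half_oscillator
begin

text \<open>The Euler-Lagrange equation of this integrand is u'' = p - g(u), so arcs are critical
  for the action under variations that fix their ends.\<close>

definition lagrangian :: "(real \<Rightarrow> real) \<Rightarrow> (real \<Rightarrow> real) \<Rightarrow> real \<Rightarrow> real" where
  "lagrangian u v t = (v t)\<^sup>2 / 2 - G (u t) + p t * u t"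

lemma lagrangian_continuous:
  "continuous_on S u \<Longrightarrow> continuous_on S v \<Longrightarrow> continuous_on S (lagrangian u v)"
  unfolding lagrangian_def by (intro continuous_intros continuous_on_G_comp p_cont') auto

text \<open>Close to a node \<open>u\<close> is small, and only the kinetic energy of the slope
  \<open>c\<close> at the node survives.\<close>

lemma lagrangian_near_zero:
  assumes "\<bar>u t\<bar> \<le> X" "\<bar>v t - c\<bar> \<le> Y" "\<bar>v t\<bar> \<le> Z" "\<bar>c\<bar> \<le> Z"
  shows "\<bar>lagrangian u v t - c\<^sup>2 / 2\<bar> \<le> Z * Y + 2 * M * X"
proof -
  have "\<bar>(v t)\<^sup>2 / 2 - c\<^sup>2 / 2\<bar> = \<bar>v t + c\<bar> / 2 * \<bar>v t - c\<bar>"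
    by (simp add: power2_eq_square algebra_simps flip: abs_mult diff_divide_distrib)
  also have "\<dots> \<le> Z * Y" using assms by (intro mult_mono) auto
  finally have 1: "\<bar>(v t)\<^sup>2 / 2 - c\<^sup>2 / 2\<bar> \<le> Z * Y" .
  have "\<bar>G (u t)\<bar> \<le> M * X" using abs_G_le[of "u t"] mult_left_mono[OF assms(1) M_nonneg] by linarith
  moreover have "\<bar>p t * u t\<bar> \<le> M * X" using p_bound[of t] assms(1) M_nonneg by (auto simp: abs_mult intro!: mult_mono)
  ultimately show ?thesis unfolding lagrangian_def using 1 by linarith
qed

definition action :: "real \<Rightarrow> real \<Rightarrow> (real \<Rightarrow> real) \<Rightarrow> (real \<Rightarrow> real) \<Rightarrow> real" where
  "action a b u v = integral {a..b} (lagrangian u v)"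

text \<open>On the smaller interval the longer arc solves the same equation with boundary values at
  most \<open>B1 * \<delta>\<close>, so \<open>stability\<close> compares positions. For velocities,
  the mean value theorem provides one point where they are close, and the Lipschitz bound on
  \<open>g\<close> propagates this to the whole interval.\<close>

lemma nested_arcs_close:
  assumes nest: "a' \<le> a" "b \<le> b'" and L: "L0 \<le> b - a" "b' - a' \<le> D"
    and u1: "positive_arc a b u1 v1" and u2: "positive_arc a' b' u2 v2"
    and t: "t \<in> {a..b}"
  defines "\<delta> \<equiv> (a - a') + (b' - b)" and "B1 \<equiv> (gi + 2 * M) * D"
  shows "\<bar>u2 t - u1 t\<bar> \<le> 2 * B1 * \<delta>" and "\<bar>v2 t - v1 t\<bar> \<le> (2 * B1 + 2 * \<Gamma> * B1 * D) * \<delta>"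
proof -
  have ab: "a < b" "a' < b'" using L L0(1) nest by auto
  note s1 = positive_arcD[OF u1] and s2 = positive_arcD[OF u2]
  have D0: "D \<ge> 1" using L L0(1) nest by linarith
  have B10: "0 \<le> B1" unfolding B1_def using gi_pos M_nonneg D0 by auto
  have sub: "{a..b} \<subseteq> {a'..b'}" using nest by auto
  have s2': "solves_on g p {a..b} u2 v2" using solves_on_subset[OF s2(1) sub] .
  have lip: "\<bar>u2 x - u2 y\<bar> \<le> B1 * \<bar>x - y\<bar>" if "x \<in> {a'..b'}" "y \<in> {a'..b'}" for x y
    by (rule real_lipschitz_of_derivative[of "{a'..b'}" u2 v2])
      (use that s2(1) positive_arc_bounds(1)[OF u2 ab(2) L(2)] in \<open>auto simp: solves_on_def B1_def\<close>)
  have \<delta>0: "a - a' \<le> \<delta>" "b' - b \<le> \<delta>" "0 \<le> \<delta>" using nest by (auto simp: \<delta>_def)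
  have bda: "\<bar>u2 a\<bar> \<le> B1 * \<delta>"
  proof -
    have "\<bar>u2 a - u2 a'\<bar> \<le> B1 * \<bar>a - a'\<bar>" by (rule lip) (use nest ab in auto)
    also have "\<dots> \<le> B1 * \<delta>" using \<delta>0 nest B10 by (intro mult_left_mono) auto
    finally show ?thesis using s2 by simp
  qed
  have bdb: "\<bar>u2 b\<bar> \<le> B1 * \<delta>"
  proof -
    have "\<bar>u2 b - u2 b'\<bar> \<le> B1 * \<bar>b - b'\<bar>" by (rule lip) (use nest ab in auto)
    also have "\<dots> \<le> B1 * \<delta>" using \<delta>0 nest B10 by (intro mult_left_mono) auto
    finally show ?thesis using s2 by simp
  qed
  have ge: "gi / 4 * ((s - a) * (b - s)) \<le> u2 s" if s: "s \<in> {a..b}" for s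
  proof -
    have s': "s \<in> {a'..b'}" using s sub by auto
    have "(s - a) * (b - s) \<le> (s - a') * (b' - s)" using s nest by (intro mult_mono) auto
    then have "gi / 4 * ((s - a) * (b - s)) \<le> gi / 4 * ((s - a') * (b' - s))"
      using gi_pos by (intro mult_left_mono) auto
    also have "\<dots> \<le> 7 / 16 * gi * ((s - a') * (b' - s))"
      using gi_pos s' by (intro mult_right_mono) auto
    also have "\<dots> \<le> u2 s" by (rule s2(4)[OF s'])
    finally show ?thesis .
  qed
  have w: "\<bar>u2 t - u1 t\<bar> \<le> 2 * B1 * \<delta>" if "t \<in> {a..b}" for t
    using stability[OF L(1) u1 s2' ge bda bdb that] by simp
  then show "\<bar>u2 t - u1 t\<bar> \<le> 2 * B1 * \<delta>" using t by blast
  have "\<exists>x\<in>{a<..<b}. (u2 b - u1 b) - (u2 a - u1 a) = (v2 x - v1 x) * (b - a)"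
    by (rule mvt_simple[OF ab(1)])
      (use s1(1) s2' in \<open>auto simp: solves_on_def has_field_derivative_def[symmetric] intro!: DERIV_diff\<close>)
  then obtain x where x: "x \<in> {a<..<b}" "(u2 b - u1 b) - (u2 a - u1 a) = (v2 x - v1 x) * (b - a)" by blast
  have "\<bar>v2 x - v1 x\<bar> * 1 \<le> \<bar>v2 x - v1 x\<bar> * (b - a)" using L L0(1) by (intro mult_left_mono) auto
  also have "\<dots> = \<bar>u2 b - u2 a\<bar>" using x ab s1 by (simp add: abs_mult)
  also have "\<dots> \<le> 2 * B1 * \<delta>" using bda bdb by linarith
  finally have vx: "\<bar>v2 x - v1 x\<bar> \<le> 2 * B1 * \<delta>" by simp
  have "\<bar>(v2 t - v1 t) - (v2 x - v1 x)\<bar> \<le> (\<Gamma> * (2 * B1 * \<delta>)) * \<bar>t - x\<bar>"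
  proof (rule real_lipschitz_of_derivative[of "{a..b}" "\<lambda>t. v2 t - v1 t" "\<lambda>t. (p t - g (u2 t)) - (p t - g (u1 t))"])
    fix s assume s: "s \<in> {a..b}"
    show "((\<lambda>t. v2 t - v1 t) has_real_derivative p s - g (u2 s) - (p s - g (u1 s))) (at s within {a..b})"
      by (intro DERIV_diff solves_onD(2)[OF s1(1) s] solves_onD(2)[OF s2' s])
    have "\<bar>g (u2 s) - g (u1 s)\<bar> \<le> \<Gamma> * (2 * B1 * \<delta>)"
      using g_lip[of "u2 s" "u1 s"] mult_left_mono[OF w[OF s], of \<Gamma>] \<Gamma>_pos by linarith
    then show "\<bar>p s - g (u2 s) - (p s - g (u1 s))\<bar> \<le> \<Gamma> * (2 * B1 * \<delta>)" by linarith
  qed (use t x in auto)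
  also have "\<dots> \<le> (\<Gamma> * (2 * B1 * \<delta>)) * D"
    using \<Gamma>_pos B10 \<delta>0 t x L nest by (intro mult_left_mono) auto
  finally have "\<bar>v2 t - v1 t\<bar> \<le> 2 * B1 * \<delta> + (\<Gamma> * (2 * B1 * \<delta>)) * D" using vx by linarith
  then show "\<bar>v2 t - v1 t\<bar> \<le> (2 * B1 + 2 * \<Gamma> * B1 * D) * \<delta>" by (simp add: algebra_simps)
qed

text \<open>Expanding the action of one solution around another, the first-order term integrates to the
  boundary contribution \<open>v1 * (u2 - u1)\<close>, because \<open>u1\<close> solves the equation.\<close>

lemma action_nested_middle:
  assumes u1: "solves_on g p {a..b} u1 v1" and u2: "solves_on g p {a..b} u2 v2" and "a \<le> b"
    and W: "\<And>t. t \<in> {a..b} \<Longrightarrow> \<bar>u2 t - u1 t\<bar> \<le> W" "\<And>t. t \<in> {a..b} \<Longrightarrow> \<bar>v2 t - v1 t\<bar> \<le> W'"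
  shows "\<bar>action a b u2 v2 - action a b u1 v1 - (v1 b * (u2 b - u1 b) - v1 a * (u2 a - u1 a))\<bar>
    \<le> (W'\<^sup>2 / 2 + \<Gamma> * W\<^sup>2) * (b - a)"
proof -
  define E where "E = (\<lambda>t. lagrangian u2 v2 t - lagrangian u1 v1 t
     - (v1 t * (v2 t - v1 t) + (p t - g (u1 t)) * (u2 t - u1 t)))"
  note c = solves_on_continuous[OF u1] solves_on_continuous[OF u2]
  have I: "((\<lambda>t. v1 t * (v2 t - v1 t) + (p t - g (u1 t)) * (u2 t - u1 t)) has_integral
      (v1 b * (u2 b - u1 b) - v1 a * (u2 a - u1 a))) {a..b}"
  proof (rule fundamental_theorem_of_calculus[OF \<open>a \<le> b\<close>])
    fix t assume t: "t \<in> {a..b}"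
    show "((\<lambda>t. v1 t * (u2 t - u1 t)) has_vector_derivative
       v1 t * (v2 t - v1 t) + (p t - g (u1 t)) * (u2 t - u1 t)) (at t within {a..b})"
      unfolding has_real_derivative_iff_has_vector_derivative[symmetric]
      by (rule DERIV_cong[OF DERIV_mult[OF solves_onD(2)[OF u1 t]
              DERIV_diff[OF solves_onD(1)[OF u2 t] solves_onD(1)[OF u1 t]]]]) (simp add: mult.commute)
  qed
  have "integral {a..b} E = action a b u2 v2 - action a b u1 v1
      - integral {a..b} (\<lambda>t. v1 t * (v2 t - v1 t) + (p t - g (u1 t)) * (u2 t - u1 t))"
    unfolding E_def action_def
    by (subst integral_diff integral_diff[of "lagrangian u2 v2"]; (intro integrable_diff integrable_continuous_real lagrangian_continuous
      continuous_intros continuous_on_g_comp p_cont' c)?)+ simp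
  then have eq: "integral {a..b} E = action a b u2 v2 - action a b u1 v1 - (v1 b * (u2 b - u1 b) - v1 a * (u2 a - u1 a))"
    using integral_unique[OF I] by simp
  have "norm (integral {a..b} E) \<le> (W'\<^sup>2 / 2 + \<Gamma> * W\<^sup>2) * (b - a)"
  proof (rule integral_bound[OF \<open>a \<le> b\<close>])
    show "continuous_on {a..b} E" unfolding E_def
      by (intro continuous_intros lagrangian_continuous continuous_on_g_comp p_cont' c)
    fix t assume t: "t \<in> {a..b}"
    \<comment> \<open>With the first-order terms removed, a square and the Taylor remainder of
      \<open>G\<close> are left, both quadratic in the difference.\<close>
    have E: "E t = (v2 t - v1 t)\<^sup>2 / 2 - (G (u2 t) - G (u1 t) - g (u1 t) * (u2 t - u1 t))"
      unfolding E_def lagrangian_def by (simp add: power2_eq_square field_simps)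
    have "\<bar>u2 t - u1 t\<bar>\<^sup>2 \<le> W\<^sup>2" "\<bar>v2 t - v1 t\<bar>\<^sup>2 \<le> W'\<^sup>2"
      using power_mono[OF W(1)[OF t], of 2] power_mono[OF W(2)[OF t], of 2] by simp_all
    then have sq: "(u2 t - u1 t)\<^sup>2 \<le> W\<^sup>2" "(v2 t - v1 t)\<^sup>2 \<le> W'\<^sup>2" by simp_all
    then have "\<Gamma> * (u2 t - u1 t)\<^sup>2 \<le> \<Gamma> * W\<^sup>2" using \<Gamma>_pos by simp
    moreover have "0 \<le> (v2 t - v1 t)\<^sup>2" by simp
    ultimately show "norm (E t) \<le> W'\<^sup>2 / 2 + \<Gamma> * W\<^sup>2"
      using G_remainder[of "u2 t" "u1 t"] sq unfolding E real_norm_def by linarith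
  qed
  then show ?thesis using eq by simp
qed

definition nested_arc_estimate :: "real \<Rightarrow> real \<Rightarrow> bool" where
  "nested_arc_estimate D B \<longleftrightarrow> (\<forall>a' a b b' u1 v1 u2 v2 \<delta>. a' \<le> a \<longrightarrow> b \<le> b' \<longrightarrow> L0 \<le> b - a \<longrightarrow> b' - a' \<le> D \<longrightarrow>
     positive_arc a b u1 v1 \<longrightarrow> positive_arc a' b' u2 v2 \<longrightarrow> \<delta> = (a - a') + (b' - b) \<longrightarrow>
     \<bar>v2 a' - v1 a\<bar> \<le> B * \<delta> \<and> \<bar>v2 b' - v1 b\<bar> \<le> B * \<delta> \<and>
     \<bar>action a' b' u2 v2 - action a b u1 v1 + (v1 a)\<^sup>2 / 2 * (a - a') + (v1 b)\<^sup>2 / 2 * (b' - b)\<bar> \<le> B * \<delta>\<^sup>2)"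

text \<open>Split the larger interval at \<open>a\<close> and \<open>b\<close>. The outer piece at
  \<open>a\<close> contributes about (v1 a)^2 / 2 per unit of length. The middle piece contributes
  the boundary term \<open>- v1 a * u2 a\<close>, which is about - (v1 a)^2 per unit, since
  \<open>u2\<close> leaves 0 with a slope near \<open>v1 a\<close>. The sum is - (v1 a)^2 / 2 per
  unit; the end \<open>b\<close> is treated likewise.\<close>

lemma nested_arc_estimate_exists:
  assumes D: "1 \<le> D"
  shows "\<exists>B\<ge>0. nested_arc_estimate D B"
proof -
  define B1 where "B1 = (gi + 2 * M) * D"
  define W where "W = 2 * B1"
  define B2 where "B2 = 2 * B1 + 2 * \<Gamma> * B1 * D"
  \<comment> \<open>\<open>B2\<close> controls velocity differences on the common interval; 2 M
    bounds the acceleration and so accounts for the outer pieces.\<close>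
  define B3 where "B3 = B2 + 2 * M"
  define B4 where "B4 = B1 * B3 + 2 * M * B1"
  define B5 where "B5 = (B2\<^sup>2 / 2 + \<Gamma> * W\<^sup>2) * D + 2 * (B1 * B3) + 2 * B4"
  define B where "B = max B3 B5"
  have B10: "0 \<le> B1" using gi_pos M_nonneg D by (auto simp: B1_def)
  have B20: "0 \<le> B2" using B10 \<Gamma>_pos D by (auto simp: B2_def)
  have B30: "0 \<le> B3" using B20 M_nonneg by (auto simp: B3_def)
  have B40: "0 \<le> B4" using B10 B30 M_nonneg by (auto simp: B4_def)
  have "\<bar>v2 a' - v1 a\<bar> \<le> B * \<delta> \<and> \<bar>v2 b' - v1 b\<bar> \<le> B * \<delta> \<and>
     \<bar>action a' b' u2 v2 - action a b u1 v1 + (v1 a)\<^sup>2 / 2 * (a - a') + (v1 b)\<^sup>2 / 2 * (b' - b)\<bar> \<le> B * \<delta>\<^sup>2"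
    if nest: "a' \<le> a" "b \<le> b'" and L: "L0 \<le> b - a" "b' - a' \<le> D"
      and u1: "positive_arc a b u1 v1" and u2: "positive_arc a' b' u2 v2"
      and \<delta>: "\<delta> = (a - a') + (b' - b)"
    for a' a b b' u1 v1 u2 v2 \<delta>
  proof -
    have ab: "a < b" "a' < b'" using L L0(1) nest by auto
    note s1 = positive_arcD[OF u1] and s2 = positive_arcD[OF u2]
    have sub: "{a..b} \<subseteq> {a'..b'}" using nest by auto
    have s2': "solves_on g p {a..b} u2 v2" using solves_on_subset[OF s2(1) sub] .
    have \<delta>0: "a - a' \<le> \<delta>" "b' - b \<le> \<delta>" "0 \<le> \<delta>" "0 \<le> a - a'" "0 \<le> b' - b" using nest by (auto simp: \<delta>)
    note close = nested_arcs_close[OF nest L u1 u2, folded \<delta> B1_def]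
    have w: "\<bar>u2 t - u1 t\<bar> \<le> W * \<delta>" if "t \<in> {a..b}" for t
      using close(1)[OF that] by (simp add: W_def)
    have w': "\<bar>v2 t - v1 t\<bar> \<le> B2 * \<delta>" if "t \<in> {a..b}" for t
      using close(2)[OF that] by (simp add: B2_def)
    have vb1: "\<bar>v1 a\<bar> \<le> B1" "\<bar>v1 b\<bar> \<le> B1"
      unfolding B1_def by (rule positive_arc_bounds(1)[OF u1]; use ab nest L in auto)+
    have vb2: "\<bar>v2 t\<bar> \<le> B1" if "t \<in> {a'..b'}" for t
      unfolding B1_def by (rule positive_arc_bounds(1)[OF u2]) (use that ab L in auto)
    have left: "\<bar>v2 t - v1 a\<bar> \<le> B3 * \<delta>" if t: "t \<in> {a'..a}" for t
    proof -
      have "\<bar>v2 t - v2 a\<bar> \<le> 2 * M * \<bar>t - a\<bar>"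
        by (rule slope_lipschitz[OF s2(1)]) (use t nest ab in auto)
      also have "\<dots> \<le> 2 * M * \<delta>" using t \<delta>0 M_nonneg by (intro mult_left_mono) auto
      finally show ?thesis using w'[of a] ab by (simp add: B3_def algebra_simps)
    qed
    have right: "\<bar>v2 t - v1 b\<bar> \<le> B3 * \<delta>" if t: "t \<in> {b..b'}" for t
    proof -
      have "\<bar>v2 t - v2 b\<bar> \<le> 2 * M * \<bar>t - b\<bar>"
        by (rule slope_lipschitz[OF s2(1)]) (use t nest ab in auto)
      also have "\<dots> \<le> 2 * M * \<delta>" using t \<delta>0 M_nonneg by (intro mult_left_mono) auto
      finally show ?thesis using w'[of b] ab by (simp add: B3_def algebra_simps)
    qed
    have lip: "\<bar>u2 x - u2 y\<bar> \<le> B1 * \<bar>x - y\<bar>" if "x \<in> {a'..b'}" "y \<in> {a'..b'}" for x y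
      by (rule real_lipschitz_of_derivative[of "{a'..b'}" u2 v2])
        (use that s2(1) vb2 in \<open>auto simp: solves_on_def\<close>)
    have uleft: "\<bar>u2 t\<bar> \<le> B1 * \<delta>" if t: "t \<in> {a'..a}" for t
    proof -
      have "\<bar>u2 t - u2 a'\<bar> \<le> B1 * \<bar>t - a'\<bar>" by (rule lip) (use t nest ab in auto)
      also have "\<dots> \<le> B1 * \<delta>" using t \<delta>0 B10 by (intro mult_left_mono) auto
      finally show ?thesis using s2 by simp
    qed
    have uright: "\<bar>u2 t\<bar> \<le> B1 * \<delta>" if t: "t \<in> {b..b'}" for t
    proof -
      have "\<bar>u2 t - u2 b'\<bar> \<le> B1 * \<bar>t - b'\<bar>" by (rule lip) (use t nest ab in auto)
      also have "\<dots> \<le> B1 * \<delta>" using t \<delta>0 B10 by (intro mult_left_mono) auto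
      finally show ?thesis using s2 by simp
    qed
    have cl: "continuous_on {x..y} (lagrangian u2 v2)" if "a' \<le> x" "y \<le> b'" for x y
      by (rule lagrangian_continuous; rule continuous_on_subset[OF solves_on_continuous(1)[OF s2(1)]]
          continuous_on_subset[OF solves_on_continuous(2)[OF s2(1)]]; use that in auto)
    have A1: "\<bar>action a' a u2 v2 - (v1 a)\<^sup>2 / 2 * (a - a')\<bar> \<le> B4 * \<delta> * (a - a')"
      unfolding action_def
    proof (rule integral_near_const[OF nest(1) cl])
      fix t assume t: "t \<in> {a'..a}"
      have "\<bar>lagrangian u2 v2 t - (v1 a)\<^sup>2 / 2\<bar> \<le> B1 * (B3 * \<delta>) + 2 * M * (B1 * \<delta>)"
        by (rule lagrangian_near_zero) (use uleft[OF t] left[OF t] vb1 vb2[of t] t nest ab in auto)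
      then show "\<bar>lagrangian u2 v2 t - (v1 a)\<^sup>2 / 2\<bar> \<le> B4 * \<delta>" by (simp add: B4_def algebra_simps)
    qed (use nest ab in auto)
    have A2: "\<bar>action b b' u2 v2 - (v1 b)\<^sup>2 / 2 * (b' - b)\<bar> \<le> B4 * \<delta> * (b' - b)"
      unfolding action_def
    proof (rule integral_near_const[OF nest(2) cl])
      fix t assume t: "t \<in> {b..b'}"
      have "\<bar>lagrangian u2 v2 t - (v1 b)\<^sup>2 / 2\<bar> \<le> B1 * (B3 * \<delta>) + 2 * M * (B1 * \<delta>)"
        by (rule lagrangian_near_zero) (use uright[OF t] right[OF t] vb1 vb2[of t] t nest ab in auto)
      then show "\<bar>lagrangian u2 v2 t - (v1 b)\<^sup>2 / 2\<bar> \<le> B4 * \<delta>" by (simp add: B4_def algebra_simps)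
    qed (use nest ab in auto)
    have ua: "\<bar>u2 a - v1 a * (a - a')\<bar> \<le> B3 * \<delta> * (a - a')"
    proof -
      have "\<bar>(u2 a - v1 a * a) - (u2 a' - v1 a * a')\<bar> \<le> B3 * \<delta> * \<bar>a - a'\<bar>"
        by (rule real_lipschitz_of_derivative[of "{a'..a}" "\<lambda>t. u2 t - v1 a * t" "\<lambda>t. v2 t - v1 a"])
          (use solves_on_subset[OF s2(1), of "{a'..a}"] left nest ab in
            \<open>auto simp: solves_on_def intro!: derivative_eq_intros\<close>)
      then show ?thesis using s2 nest by (simp add: algebra_simps)
    qed
    have ub: "\<bar>u2 b + v1 b * (b' - b)\<bar> \<le> B3 * \<delta> * (b' - b)"
    proof -
      have "\<bar>(u2 b - v1 b * b) - (u2 b' - v1 b * b')\<bar> \<le> B3 * \<delta> * \<bar>b - b'\<bar>"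
        by (rule real_lipschitz_of_derivative[of "{b..b'}" "\<lambda>t. u2 t - v1 b * t" "\<lambda>t. v2 t - v1 b"])
          (use solves_on_subset[OF s2(1), of "{b..b'}"] right nest ab in
            \<open>auto simp: solves_on_def intro!: derivative_eq_intros\<close>)
      then show ?thesis using s2 nest by (simp add: algebra_simps)
    qed
    have "\<bar>v1 a * (u2 a - v1 a * (a - a'))\<bar> \<le> B1 * (B3 * \<delta> * (a - a'))"
      unfolding abs_mult using vb1 ua B10 by (intro mult_mono) auto
    then have A3: "\<bar>v1 a * u2 a - (v1 a)\<^sup>2 * (a - a')\<bar> \<le> B1 * B3 * \<delta> * (a - a')"
      by (simp add: algebra_simps power2_eq_square)
    have "\<bar>v1 b * (u2 b + v1 b * (b' - b))\<bar> \<le> B1 * (B3 * \<delta> * (b' - b))"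
      unfolding abs_mult using vb1 ub B10 by (intro mult_mono) auto
    then have A4: "\<bar>v1 b * u2 b + (v1 b)\<^sup>2 * (b' - b)\<bar> \<le> B1 * B3 * \<delta> * (b' - b)"
      by (simp add: algebra_simps power2_eq_square)
    have "\<bar>action a b u2 v2 - action a b u1 v1 - (v1 b * (u2 b - u1 b) - v1 a * (u2 a - u1 a))\<bar>
        \<le> ((B2 * \<delta>)\<^sup>2 / 2 + \<Gamma> * (W * \<delta>)\<^sup>2) * (b - a)"
      by (rule action_nested_middle[OF s1(1) s2' _ w w']) (use ab in auto)
    also have "\<dots> \<le> ((B2 * \<delta>)\<^sup>2 / 2 + \<Gamma> * (W * \<delta>)\<^sup>2) * D"
      using \<Gamma>_pos nest L by (intro mult_left_mono) auto
    also have "\<dots> = (B2\<^sup>2 / 2 + \<Gamma> * W\<^sup>2) * D * \<delta>\<^sup>2" by (simp add: power_mult_distrib algebra_simps)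
    finally have A5: "\<bar>action a b u2 v2 - action a b u1 v1 - (v1 b * u2 b - v1 a * u2 a)\<bar>
        \<le> (B2\<^sup>2 / 2 + \<Gamma> * W\<^sup>2) * D * \<delta>\<^sup>2" using s1 by simp
    have split: "action a' b' u2 v2 = action a' a u2 v2 + action a b u2 v2 + action b b' u2 v2"
      unfolding action_def
      using integral_split[of a' a b' "lagrangian u2 v2"]
       integral_split[of a b b' "lagrangian u2 v2"]
       nest ab integrable_continuous_real[OF cl] by auto
    have e: "B4 * \<delta> * (a - a') \<le> B4 * \<delta>\<^sup>2" "B4 * \<delta> * (b' - b) \<le> B4 * \<delta>\<^sup>2"
        "B1 * B3 * \<delta> * (a - a') \<le> B1 * B3 * \<delta>\<^sup>2" "B1 * B3 * \<delta> * (b' - b) \<le> B1 * B3 * \<delta>\<^sup>2"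
      unfolding power2_eq_square mult.assoc using B10 B30 B40 \<delta>0 by (auto intro!: mult_left_mono)
    have fin: "B5 * \<delta>\<^sup>2 = (B2\<^sup>2 / 2 + \<Gamma> * W\<^sup>2) * D * \<delta>\<^sup>2 + 2 * (B1 * B3 * \<delta>\<^sup>2) + 2 * (B4 * \<delta>\<^sup>2)"
      by (simp add: B5_def algebra_simps)
    have half: "(v1 a)\<^sup>2 / 2 * (a - a') = (v1 a)\<^sup>2 * (a - a') / 2" "(v1 b)\<^sup>2 / 2 * (b' - b) = (v1 b)\<^sup>2 * (b' - b) / 2" by simp_all
    have "\<bar>action a' b' u2 v2 - action a b u1 v1 + (v1 a)\<^sup>2 / 2 * (a - a') + (v1 b)\<^sup>2 / 2 * (b' - b)\<bar> \<le> B5 * \<delta>\<^sup>2"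
      using A1 A2 A3 A4 A5 e unfolding split fin half by linarith
    moreover have "\<bar>v2 a' - v1 a\<bar> \<le> B3 * \<delta>" "\<bar>v2 b' - v1 b\<bar> \<le> B3 * \<delta>"
      using left[of a'] right[of b'] nest by auto
    moreover have "B3 * \<delta> \<le> B * \<delta>" "B5 * \<delta>\<^sup>2 \<le> B * \<delta>\<^sup>2"
      using \<delta>0 by (auto simp: B_def intro!: mult_right_mono)
    ultimately show ?thesis by linarith
  qed
  then have "nested_arc_estimate D B" unfolding nested_arc_estimate_def by blast
  then show ?thesis using B30 by (intro exI[of _ B]) (auto simp: B_def)
qed

end

section \<open>Partial derivatives and size of the action\<close>

context half_oscillator
begin

definition arc :: "real \<Rightarrow> real \<Rightarrow> (real \<Rightarrow> real) \<times> (real \<Rightarrow> real)" where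
  "arc a b = (SOME uv. positive_arc a b (fst uv) (snd uv))"

text \<open>The sign in \<open>V\<close> makes both slopes positive: a positive arc leaves
  \<open>a\<close> upwards and arrives at \<open>b\<close> downwards.\<close>

definition U :: "real \<Rightarrow> real \<Rightarrow> real" where "U a b = snd (arc a b) a"
definition V :: "real \<Rightarrow> real \<Rightarrow> real" where "V a b = - snd (arc a b) b"
definition h :: "real \<Rightarrow> real \<Rightarrow> real" where "h a b = action a b (fst (arc a b)) (snd (arc a b))"

lemma arc: "L0 \<le> b - a \<Longrightarrow> positive_arc a b (fst (arc a b)) (snd (arc a b))"
  unfolding arc_def by (rule someI_ex) (use positive_arc_exists[of b a] in auto)

lemma U_V_bounds:
  assumes "L0 \<le> b - a"
  shows "7 / 16 * gi * (b - a) \<le> U a b" "U a b \<le> 9 / 16 * gi * (b - a)"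
    and "7 / 16 * gi * (b - a) \<le> V a b" "V a b \<le> 9 / 16 * gi * (b - a)"
  using positive_arc_slopes[OF arc[OF assms]] assms L0(1) by (auto simp: U_def V_def)

definition nested_action_estimate :: "real \<Rightarrow> real \<Rightarrow> bool" where
  "nested_action_estimate D K \<longleftrightarrow> (\<forall>a' a b b' \<delta>. a' \<le> a \<longrightarrow> b \<le> b' \<longrightarrow> L0 \<le> b - a \<longrightarrow> b' - a' \<le> D \<longrightarrow> \<delta> = (a - a') + (b' - b) \<longrightarrow>
     \<bar>(U a' b')\<^sup>2 / 2 - (U a b)\<^sup>2 / 2\<bar> \<le> K * \<delta> \<and> \<bar>(V a' b')\<^sup>2 / 2 - (V a b)\<^sup>2 / 2\<bar> \<le> K * \<delta> \<and>
     \<bar>h a' b' - h a b + (U a b)\<^sup>2 / 2 * (a - a') + (V a b)\<^sup>2 / 2 * (b' - b)\<bar> \<le> K * \<delta>\<^sup>2)"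

lemma nested_action_estimate_exists:
  assumes "1 \<le> D"
  shows "\<exists>K\<ge>0. nested_action_estimate D K"
proof -
  obtain B where B: "0 \<le> B" "nested_arc_estimate D B" using nested_arc_estimate_exists[OF assms] by blast
  define K where "K = B * (gi * D) + B"
  have K: "B \<le> K" "0 \<le> K" using B(1) gi_pos assms by (auto simp: K_def)
  have sq: "\<bar>x\<^sup>2 / 2 - y\<^sup>2 / 2\<bar> \<le> K * \<delta>" if "\<bar>x - y\<bar> \<le> B * \<delta>" "0 \<le> \<delta>" "\<bar>x\<bar> \<le> gi * D" "\<bar>y\<bar> \<le> gi * D" for x y \<delta> :: real
  proof -
    have "\<bar>x\<^sup>2 / 2 - y\<^sup>2 / 2\<bar> = \<bar>x + y\<bar> / 2 * \<bar>x - y\<bar>"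
      by (simp add: power2_eq_square algebra_simps flip: abs_mult diff_divide_distrib)
    also have "\<dots> \<le> (gi * D) * (B * \<delta>)" using that by (intro mult_mono) auto
    also have "\<dots> \<le> K * \<delta>" using B(1) that by (simp add: K_def algebra_simps)
    finally show ?thesis .
  qed
  have bd: "\<bar>U a b\<bar> \<le> gi * D" "\<bar>V a b\<bar> \<le> gi * D" if "L0 \<le> b - a" "b - a \<le> D" for a b
  proof -
    have "0 \<le> gi * (b - a)" using that L0(1) gi_pos by auto
    moreover have "gi * (b - a) \<le> gi * D" using that gi_pos by auto
    ultimately show "\<bar>U a b\<bar> \<le> gi * D" "\<bar>V a b\<bar> \<le> gi * D" using U_V_bounds[OF that(1)] by linarith+
  qed
  have "nested_action_estimate D K" unfolding nested_action_estimate_def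
  proof (intro allI impI)
    fix a' a b b' \<delta> assume nest: "a' \<le> a" "b \<le> b'" "L0 \<le> b - a" "b' - a' \<le> D" and \<delta>: "\<delta> = a - a' + (b' - b)"
    have \<delta>0: "0 \<le> \<delta>" using nest by (simp add: \<delta>)
    have nest': "L0 \<le> b' - a'" using nest by simp
    note main = B(2)[unfolded nested_arc_estimate_def, rule_format, OF nest arc[OF nest(3)] arc[OF nest'] \<delta>]
    have m: "\<bar>U a' b' - U a b\<bar> \<le> B * \<delta>" "\<bar>V a' b' - V a b\<bar> \<le> B * \<delta>" using main by (auto simp: U_def V_def)
    have "\<bar>(U a' b')\<^sup>2 / 2 - (U a b)\<^sup>2 / 2\<bar> \<le> K * \<delta>" by (rule sq[OF m(1) \<delta>0]; rule bd; use nest in simp)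
    moreover have "\<bar>(V a' b')\<^sup>2 / 2 - (V a b)\<^sup>2 / 2\<bar> \<le> K * \<delta>" by (rule sq[OF m(2) \<delta>0]; rule bd; use nest in simp)
    moreover have "\<bar>h a' b' - h a b + (U a b)\<^sup>2 / 2 * (a - a') + (V a b)\<^sup>2 / 2 * (b' - b)\<bar> \<le> K * \<delta>\<^sup>2"
    proof -
      have "B * \<delta>\<^sup>2 \<le> K * \<delta>\<^sup>2" using K by (intro mult_right_mono) auto
      then show ?thesis using main by (simp add: h_def U_def V_def)
    qed
    ultimately show "\<bar>(U a' b')\<^sup>2 / 2 - (U a b)\<^sup>2 / 2\<bar> \<le> K * \<delta> \<and> \<bar>(V a' b')\<^sup>2 / 2 - (V a b)\<^sup>2 / 2\<bar> \<le> K * \<delta> \<and>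
       \<bar>h a' b' - h a b + (U a b)\<^sup>2 / 2 * (a - a') + (V a b)\<^sup>2 / 2 * (b' - b)\<bar> \<le> K * \<delta>\<^sup>2" by blast
  qed
  then show ?thesis using K by blast
qed

text \<open>Moving the right end alone is the nested case with a common left end. Lengths near the
  given one stay below b - a + 1, so one constant \<open>B\<close> serves a whole
  neighbourhood.\<close>

lemma h_deriv_right:
  assumes "L0 < b - a"
  shows "((\<lambda>b. h a b) has_real_derivative - (V a b)\<^sup>2 / 2) (at b)"
proof -
  define e where "e = min 1 (b - a - L0)"
  have e: "0 < e" using assms by (simp add: e_def)
  have "1 \<le> b - a + 1" using assms L0(1) by simp
  then obtain B where B0: "0 \<le> B" and B: "nested_action_estimate (b - a + 1) B"
    using nested_action_estimate_exists by blast
  show ?thesis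
  proof (rule has_real_derivative_quadratic_remainder[OF e, where B = B and D = "\<lambda>b. - (V a b)\<^sup>2 / 2"])
    fix x y assume xy: "\<bar>x - b\<bar> < e" "\<bar>y - b\<bar> < e" "x \<le> y"
    then have "L0 \<le> x - a" "y - a \<le> b - a + 1" by (auto simp: e_def)
    note B = B[unfolded nested_action_estimate_def, rule_format, OF order_refl[of a] xy(3) this refl]
    show "\<bar>h a y - h a x - - (V a x)\<^sup>2 / 2 * (y - x)\<bar> \<le> B * (y - x)\<^sup>2" using B by simp
    show "\<bar>- (V a y)\<^sup>2 / 2 - - (V a x)\<^sup>2 / 2\<bar> \<le> B * (y - x)" using B by (simp add: abs_minus_commute)
  qed
qed

lemma h_deriv_left:
  assumes "L0 < b - a"
  shows "((\<lambda>a. h a b) has_real_derivative (U a b)\<^sup>2 / 2) (at a)"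
proof -
  define e where "e = min 1 (b - a - L0)"
  have e: "0 < e" using assms by (simp add: e_def)
  have "1 \<le> b - a + 1" using assms L0(1) by simp
  then obtain B where B0: "0 \<le> B" and B: "nested_action_estimate (b - a + 1) B"
    using nested_action_estimate_exists by blast
  show ?thesis
  \<comment> \<open>Here the interval grows when its left end decreases, so the nested estimate
    expands about \<open>y\<close>; rebasing it at \<open>x\<close> costs a second
    \<open>B\<close>.\<close>
  proof (rule has_real_derivative_quadratic_remainder[OF e, where B = "2 * B" and D = "\<lambda>a. (U a b)\<^sup>2 / 2"])
    fix x y assume xy: "\<bar>x - a\<bar> < e" "\<bar>y - a\<bar> < e" "x \<le> y"
    then have "L0 \<le> b - y" "b - x \<le> b - a + 1" by (auto simp: e_def)
    note B = B[unfolded nested_action_estimate_def, rule_format, OF xy(3) order_refl[of b] this refl]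
    have d: "\<bar>(U x b)\<^sup>2 / 2 - (U y b)\<^sup>2 / 2\<bar> \<le> B * (y - x)" using B by simp
    then show "\<bar>(U y b)\<^sup>2 / 2 - (U x b)\<^sup>2 / 2\<bar> \<le> 2 * B * (y - x)"
      using mult_nonneg_nonneg[OF B0, of "y - x"] xy by linarith
    have 1: "\<bar>h x b - h y b + (U y b)\<^sup>2 / 2 * (y - x)\<bar> \<le> B * (y - x)\<^sup>2" using B by simp
    have "\<bar>(U x b)\<^sup>2 / 2 - (U y b)\<^sup>2 / 2\<bar> * (y - x) \<le> B * (y - x) * (y - x)"
      using d xy by (intro mult_right_mono) auto
    then have "\<bar>((U x b)\<^sup>2 / 2 - (U y b)\<^sup>2 / 2) * (y - x)\<bar> \<le> B * (y - x)\<^sup>2"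
      using xy by (simp add: abs_mult power2_eq_square)
    moreover have "h y b - h x b - (U x b)\<^sup>2 / 2 * (y - x)
      = - (h x b - h y b + (U y b)\<^sup>2 / 2 * (y - x)) - ((U x b)\<^sup>2 / 2 - (U y b)\<^sup>2 / 2) * (y - x)"
      by (simp add: algebra_simps)
    ultimately show "\<bar>h y b - h x b - (U x b)\<^sup>2 / 2 * (y - x)\<bar> \<le> 2 * B * (y - x)\<^sup>2" using 1 by linarith
  qed
qed

lemma abs_h_le:
  assumes "L0 \<le> b - a" "b - a \<le> D"
  shows "\<bar>h a b\<bar> \<le> (((gi + 2 * M) * D)\<^sup>2 + 2 * M * (gi * D\<^sup>2)) * D"
proof -
  note u = arc[OF assms(1)]
  have ab: "a < b" using assms L0(1) by simp
  define u v where "u = fst (arc a b)" "v = snd (arc a b)"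
  note uv = arc[OF assms(1), folded u_v_def]
  have "norm (integral {a..b} (lagrangian u v)) \<le> (((gi + 2 * M) * D)\<^sup>2 + 2 * M * (gi * D\<^sup>2)) * (b - a)"
  proof (rule integral_bound)
    show "continuous_on {a..b} (lagrangian u v)"
      by (intro lagrangian_continuous solves_on_continuous[OF positive_arcD(1)[OF uv]])
    fix t assume t: "t \<in> {a..b}"
    note b = positive_arc_bounds[OF uv ab assms(2) t]
    have "\<bar>lagrangian u v t - 0\<^sup>2 / 2\<bar> \<le> ((gi + 2 * M) * D) * ((gi + 2 * M) * D) + 2 * M * (gi * D\<^sup>2)"
      by (rule lagrangian_near_zero) (use b in auto)
    then show "norm (lagrangian u v t) \<le> ((gi + 2 * M) * D)\<^sup>2 + 2 * M * (gi * D\<^sup>2)"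
      by (simp add: power2_eq_square)
  qed (use ab in auto)
  also have "\<dots> \<le> (((gi + 2 * M) * D)\<^sup>2 + 2 * M * (gi * D\<^sup>2)) * D"
    using assms M_nonneg gi_pos by (intro mult_left_mono) auto
  finally show ?thesis by (simp add: h_def action_def u_v_def)
qed

text \<open>Integrate the derivative with respect to the right end, which lies between two negative
  multiples of the squared length. The contribution of the initial length \<open>l\<close> is a
  constant and is absorbed on long intervals.\<close>

lemma h_bounds:
  "\<exists>d>L0. \<forall>a b. d \<le> b - a \<longrightarrow> gi\<^sup>2 / 32 * (b - a) ^ 3 \<le> - h a b \<and> - h a b \<le> 2 * (gi\<^sup>2 / 32) * (b - a) ^ 3"
proof -
  define l where "l = L0 + 1"
  define C where "C = (((gi + 2 * M) * l)\<^sup>2 + 2 * M * (gi * l\<^sup>2)) * l"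
  \<comment> \<open>49/1536 = (7/16)^2 / 6 and 27/512 = (9/16)^2 / 6 arise from integrating V^2 / 2
    with the two slope bounds. The target coefficients 1/32 = 48/1536 and 1/16 leave room on both
    sides; \<open>d\<close> is chosen so that gi^2 / 1536 times the cube covers the
    constants.\<close>
  define k1 where "k1 = 49 / 1536 * gi\<^sup>2"
  define k2 where "k2 = 27 / 512 * gi\<^sup>2"
  define d where "d = l + 1536 * (C + k1 * l ^ 3) / gi\<^sup>2"
  have l: "1 \<le> l" "L0 < l" using L0(1) by (auto simp: l_def)
  have C0: "0 \<le> C" using l gi_pos M_nonneg by (auto simp: C_def)
  have k: "0 < k1" "0 < k2" using gi_pos by (auto simp: k1_def k2_def)
  have dl: "l \<le> d" using C0 k l gi_pos by (auto simp: d_def)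
  have "gi\<^sup>2 / 32 * (b - a) ^ 3 \<le> - h a b \<and> - h a b \<le> 2 * (gi\<^sup>2 / 32) * (b - a) ^ 3" if ab: "d \<le> b - a" for a b
  proof -
    define b0 where "b0 = a + l"
    have hb0: "\<bar>h a b0\<bar> \<le> C" unfolding C_def by (rule abs_h_le) (use l in \<open>auto simp: b0_def\<close>)
    have le: "b0 \<le> b" using ab dl by (simp add: b0_def)
    have V: "3 * k1 * (x - a)\<^sup>2 \<le> (V a x)\<^sup>2 / 2" "(V a x)\<^sup>2 / 2 \<le> 3 * k2 * (x - a)\<^sup>2" if "b0 \<le> x" for x
    proof -
      have x: "L0 \<le> x - a" using that l by (simp add: b0_def)
      have x0: "0 \<le> 7 / 16 * gi * (x - a)" using x L0(1) gi_pos by auto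
      have "(7 / 16 * gi * (x - a))\<^sup>2 \<le> (V a x)\<^sup>2" using U_V_bounds[OF x] x0 by (intro power_mono) auto
      then show "3 * k1 * (x - a)\<^sup>2 \<le> (V a x)\<^sup>2 / 2"
        unfolding k1_def by (simp add: power_mult_distrib power_divide)
      have "(V a x)\<^sup>2 \<le> (9 / 16 * gi * (x - a))\<^sup>2" using U_V_bounds[OF x] x0 by (intro power_mono) auto
      then show "(V a x)\<^sup>2 / 2 \<le> 3 * k2 * (x - a)\<^sup>2"
        unfolding k2_def by (simp add: power_mult_distrib power_divide)
    qed
    have der: "((\<lambda>x. h a x + k * (x - a) ^ 3) has_real_derivative (- (V a x)\<^sup>2 / 2 + 3 * k * (x - a)\<^sup>2)) (at x)"
      if "b0 \<le> x" for x k
    proof -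
      have "((\<lambda>x. (x - a) ^ 3) has_real_derivative 3 * (x - a)\<^sup>2) (at x)"
        by (auto intro!: derivative_eq_intros)
      from DERIV_add[OF h_deriv_right[of x a] DERIV_cmult[OF this, of k]]
      show ?thesis using that l by (simp add: b0_def mult_ac)
    qed
    have "h a b + k1 * (b - a) ^ 3 \<le> h a b0 + k1 * (b0 - a) ^ 3"
      by (rule DERIV_nonpos_imp_nonincreasing[OF le]) (use der V in force)
    then have lo: "k1 * (b - a) ^ 3 - (C + k1 * l ^ 3) \<le> - h a b" using hb0 by (simp add: b0_def)
    have "h a b0 + k2 * (b0 - a) ^ 3 \<le> h a b + k2 * (b - a) ^ 3"
      by (rule DERIV_nonneg_imp_nondecreasing[OF le]) (use der V in force)
    moreover have "0 \<le> k2 * (b0 - a) ^ 3" using k l by (simp add: b0_def)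
    ultimately have hi: "- h a b \<le> k2 * (b - a) ^ 3 + C" using hb0 by linarith
    have L1: "1 \<le> b - a" using ab dl l by simp
    then have "1 \<le> (b - a)\<^sup>2" using power_mono[of 1 "b - a" 2] by simp
    then have "(b - a) * 1 \<le> (b - a) * (b - a)\<^sup>2" using L1 by (intro mult_left_mono) auto
    then have "b - a \<le> (b - a) ^ 3" by (simp add: power3_eq_cube power2_eq_square)
    then have "1536 * (C + k1 * l ^ 3) / gi\<^sup>2 \<le> (b - a) ^ 3" using ab l by (simp add: d_def)
    then have big: "C + k1 * l ^ 3 \<le> gi\<^sup>2 / 1536 * (b - a) ^ 3" using gi_pos by (simp add: field_simps)
    have "0 \<le> k1 * l ^ 3" "0 \<le> gi\<^sup>2 * (b - a) ^ 3" using k l L1 by auto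
    then show ?thesis using lo hi big C0 unfolding k1_def k2_def by (auto simp: algebra_simps)
  qed
  then show ?thesis using dl l by (intro exI[of _ d]) auto
qed

end

section \<open>Optimal chains of nodes\<close>

lemma successively_iff_nth:
  "successively P l \<longleftrightarrow> (\<forall>i. Suc i < length l \<longrightarrow> P (l ! i) (l ! Suc i))"
proof (induction l)
  case (Cons x l)
  have split0: "(\<forall>i. Q i) \<longleftrightarrow> Q 0 \<and> (\<forall>i. Q (Suc i))" for Q by (metis not0_implies_Suc)
  show ?case
  proof (cases l)
    case (Cons y ys)
    have "(\<forall>i. Suc i < length (x # l) \<longrightarrow> P ((x # l) ! i) ((x # l) ! Suc i)) \<longleftrightarrow>
      P x y \<and> (\<forall>i. Suc i < length l \<longrightarrow> P (l ! i) (l ! Suc i))"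
      unfolding Cons by (subst split0) auto
    then show ?thesis using Cons Cons.IH by simp
  qed auto
qed auto

text \<open>\<open>h \<sigma> a b\<close> abstracts the action of the positive (\<open>\<sigma> = True\<close>) or negative arc vanishing at \<open>a\<close> and \<open>b\<close>,
  \<open>U\<close> and \<open>V\<close> its absolute slopes at the two ends.\<close>

locale twist_chain =
  fixes h U V :: "bool \<Rightarrow> real \<Rightarrow> real \<Rightarrow> real" and d0 :: real and k \<alpha> :: "bool \<Rightarrow> real"
  assumes d0: "1 \<le> d0" and k_pos: "0 < k \<sigma>" and \<alpha>_pos: "0 < \<alpha> \<sigma>"
    and h_right: "d0 < b - a \<Longrightarrow> ((\<lambda>b. h \<sigma> a b) has_real_derivative - (V \<sigma> a b)\<^sup>2 / 2) (at b)"
    and h_left: "d0 < b - a \<Longrightarrow> ((\<lambda>a. h \<sigma> a b) has_real_derivative (U \<sigma> a b)\<^sup>2 / 2) (at a)"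
    and U_ge: "d0 \<le> b - a \<Longrightarrow> k \<sigma> * (b - a) \<le> U \<sigma> a b" and U_le: "d0 \<le> b - a \<Longrightarrow> U \<sigma> a b \<le> 2 * k \<sigma> * (b - a)"
    and V_ge: "d0 \<le> b - a \<Longrightarrow> k \<sigma> * (b - a) \<le> V \<sigma> a b" and V_le: "d0 \<le> b - a \<Longrightarrow> V \<sigma> a b \<le> 2 * k \<sigma> * (b - a)"
    and h_ge: "d0 \<le> b - a \<Longrightarrow> \<alpha> \<sigma> * (b - a) ^ 3 \<le> - h \<sigma> a b"
    and h_le: "d0 \<le> b - a \<Longrightarrow> - h \<sigma> a b \<le> 2 * \<alpha> \<sigma> * (b - a) ^ 3"
begin

lemma U_V_nonneg:
  assumes "d0 \<le> b - a"
  shows "0 \<le> U \<sigma> a b" "0 \<le> V \<sigma> a b"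
proof -
  have "0 \<le> k \<sigma> * (b - a)" using assms d0 k_pos[of \<sigma>] by auto
  then show "0 \<le> U \<sigma> a b" "0 \<le> V \<sigma> a b" using U_ge[OF assms] V_ge[OF assms] by (auto intro: order_trans)
qed

fun H :: "bool \<Rightarrow> real list \<Rightarrow> real" where
  "H \<sigma> [] = 0"
| "H \<sigma> [x] = 0"
| "H \<sigma> (x # y # l) = h \<sigma> x y + H (\<not> \<sigma>) (y # l)"

definition spaced :: "real \<Rightarrow> real list \<Rightarrow> bool" where
  "spaced d = successively (\<lambda>x y. d \<le> y - x)"

definition optimal :: "bool \<Rightarrow> real \<Rightarrow> real list \<Rightarrow> bool" where
  "optimal \<sigma> d l \<longleftrightarrow> spaced d l \<and>
     (\<forall>l'. length l' = length l \<and> hd l' = hd l \<and> last l' = last l \<and> spaced d l' \<longrightarrow> H \<sigma> l' \<le> H \<sigma> l)"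

lemma optimalD:
  assumes "optimal \<sigma> d l" "length l' = length l" "hd l' = hd l" "last l' = last l" "spaced d l'"
  shows "H \<sigma> l' \<le> H \<sigma> l"
  using assms by (auto simp: optimal_def)

text \<open>The boolean equality \<open>even (length xs) = \<sigma>\<close> is the sign reached from
  \<sigma> after one alternation per entry of \<open>xs\<close>.\<close>

lemma H_append: "H \<sigma> (xs @ x # ys) = H \<sigma> (xs @ [x]) + H (even (length xs) = \<sigma>) (x # ys)"
proof (induction xs arbitrary: \<sigma>)
  case (Cons a xs)
  show ?case
  proof (cases xs)
    case (Cons b bs)
    have "H (\<not> \<sigma>) (xs @ x # ys) = H (\<not> \<sigma>) (xs @ [x]) + H (even (length xs) = (\<not> \<sigma>)) (x # ys)" by (rule Cons.IH)
    moreover have "(even (length xs) = (\<not> \<sigma>)) = (even (length (a # xs)) = \<sigma>)" by auto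
    ultimately show ?thesis unfolding Cons by simp
  qed auto
qed auto

lemma H_sum: "H \<sigma> l = (\<Sum>i<length l - 1. h (even i = \<sigma>) (l ! i) (l ! Suc i))"
proof (induction \<sigma> l rule: H.induct)
  case (3 \<sigma> x y l)
  have "(\<Sum>i<length (x # y # l) - 1. h (even i = \<sigma>) ((x # y # l) ! i) ((x # y # l) ! Suc i))
     = h \<sigma> x y + (\<Sum>i<length l. h (odd i = \<sigma>) ((y # l) ! i) ((y # l) ! Suc i))"
    by (simp add: sum.lessThan_Suc_shift del: sum.lessThan_Suc)
  also have "(\<Sum>i<length l. h (odd i = \<sigma>) ((y # l) ! i) ((y # l) ! Suc i)) = H (\<not> \<sigma>) (y # l)"
  proof -
    have "(odd i = \<sigma>) = (even i = (\<not> \<sigma>))" for i :: nat by auto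
    then show ?thesis unfolding 3 by simp
  qed
  finally show ?case by simp
qed auto

text \<open>Joint continuity from separate information: a Lipschitz bound in the left end, uniform
  over nearby right ends, and continuity in the right end for the one fixed left end.\<close>

lemma h_continuous:
  assumes ab: "d0 < b - a"
  shows "isCont (\<lambda>x. h \<sigma> (fst x) (snd x)) (a, b)"
proof -
  define e where "e = min 1 ((b - a - d0) / 2)"
  have e: "0 < e" "2 * e \<le> b - a - d0" "e \<le> 1" using ab by (auto simp: e_def min_def)
  define C where "C = (2 * k \<sigma> * (b - a + 2))\<^sup>2 / 2"
  have near: "\<bar>h \<sigma> a' b' - h \<sigma> a b'\<bar> \<le> C * \<bar>a' - a\<bar>" if "\<bar>a' - a\<bar> < e" "\<bar>b' - b\<bar> < e" for a' b'
  proof (rule real_lipschitz_of_derivative[of "{a - e<..<a + e}" "\<lambda>x. h \<sigma> x b'" "\<lambda>x. (U \<sigma> x b')\<^sup>2 / 2"])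
    fix x assume x: "x \<in> {a - e<..<a + e}"
    then have l: "d0 < b' - x" "b' - x \<le> b - a + 2" using that e by auto
    show "((\<lambda>x. h \<sigma> x b') has_real_derivative (U \<sigma> x b')\<^sup>2 / 2) (at x within {a - e<..<a + e})"
      by (rule has_field_derivative_at_within[OF h_left[OF l(1)]])
    have "0 \<le> k \<sigma> * (b' - x)" using k_pos[of \<sigma>] l d0 by auto
    moreover have "2 * k \<sigma> * (b' - x) \<le> 2 * k \<sigma> * (b - a + 2)" using l k_pos[of \<sigma>] by (intro mult_left_mono) auto
    ultimately have "(U \<sigma> x b')\<^sup>2 \<le> (2 * k \<sigma> * (b - a + 2))\<^sup>2"
      using U_ge[of b' x \<sigma>] U_le[of b' x \<sigma>] l by (intro power_mono) auto
    then show "\<bar>(U \<sigma> x b')\<^sup>2 / 2\<bar> \<le> C" by (simp add: C_def)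
  qed (use that e in auto)
  have "((\<lambda>x. h \<sigma> (fst x) (snd x) - h \<sigma> a b) \<longlongrightarrow> 0) (at (a, b))"
  proof (rule Lim_null_comparison)
    show "\<forall>\<^sub>F x in at (a, b). norm (h \<sigma> (fst x) (snd x) - h \<sigma> a b) \<le> C * \<bar>fst x - a\<bar> + \<bar>h \<sigma> a (snd x) - h \<sigma> a b\<bar>"
      unfolding eventually_at
    proof (intro exI[of _ e] conjI ballI impI)
      fix x assume "x \<noteq> (a, b) \<and> dist x (a, b) < e"
      then have "\<bar>fst x - a\<bar> < e" "\<bar>snd x - b\<bar> < e"
        using dist_fst_le[of x "(a, b)"] dist_snd_le[of x "(a, b)"] by (auto simp: dist_real_def)
      then show "norm (h \<sigma> (fst x) (snd x) - h \<sigma> a b) \<le> C * \<bar>fst x - a\<bar> + \<bar>h \<sigma> a (snd x) - h \<sigma> a b\<bar>"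
        using near[of "fst x" "snd x"] unfolding real_norm_def by linarith
    qed (use e in auto)
    have "isCont (\<lambda>b. h \<sigma> a b) b" by (rule DERIV_isCont[OF h_right[OF ab]])
    then have "isCont (\<lambda>x. h \<sigma> a (snd x)) (a, b)"
      using isCont_o2[of "(a, b)" snd "\<lambda>b. h \<sigma> a b"] by (simp add: isCont_snd)
    then have "((\<lambda>x. h \<sigma> a (snd x)) \<longlongrightarrow> h \<sigma> a b) (at (a, b))" by (simp add: isCont_def)
    then have "((\<lambda>x. h \<sigma> a (snd x) - h \<sigma> a b) \<longlongrightarrow> 0) (at (a, b))" by (simp add: LIM_zero_iff)
    then have 1: "((\<lambda>x. \<bar>h \<sigma> a (snd x) - h \<sigma> a b\<bar>) \<longlongrightarrow> 0) (at (a, b))" by (rule tendsto_rabs_zero)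
    have 2: "((\<lambda>x::real\<times>real. C * \<bar>fst x - a\<bar>) \<longlongrightarrow> 0) (at (a, b))"
      by (auto intro!: tendsto_eq_intros)
    show "((\<lambda>x. C * \<bar>fst x - a\<bar> + \<bar>h \<sigma> a (snd x) - h \<sigma> a b\<bar>) \<longlongrightarrow> 0) (at (a, b))"
      using tendsto_add[OF 2 1] by simp
  qed
  then show ?thesis by (simp add: isCont_def LIM_zero_iff)
qed

text \<open>Chains are encoded as sequences, so that compactness comes from a product of compact
  intervals; entries beyond \<open>N\<close> do not influence the sum. The strict inequality
  \<open>d0 < d\<close> keeps admissible gaps where \<open>h\<close> is continuous.\<close>

lemma optimal_exists:
  assumes d: "d0 < d" and se: "real N * d \<le> e - s" and N: "0 < N"
  shows "\<exists>l. length l = Suc N \<and> hd l = s \<and> last l = e \<and> optimal \<sigma> d l"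
proof -
  define K where "K = {t :: nat \<Rightarrow> real. t 0 = s \<and> t N = e} \<inter> (\<Inter>i\<in>{..<N}. {t. d \<le> t (Suc i) - t i})
    \<inter> Pi\<^sub>E UNIV (\<lambda>_. {s..e})"
  define f where "f = (\<lambda>t :: nat \<Rightarrow> real. \<Sum>i<N. h (even i = \<sigma>) (t i) (t (Suc i)))"
  have co: "continuous_on A (\<lambda>t :: nat \<Rightarrow> real. t i)" for A i
    by (rule continuous_on_subset[OF continuous_on_product_coordinates]) simp
  have "compact (Pi\<^sub>E UNIV (\<lambda>_. {s..e}) :: (nat \<Rightarrow> real) set)"
    using compactin_PiE[of "\<lambda>_. euclidean :: real topology" "UNIV :: nat set" "\<lambda>_. {s..e}"]
    by (simp add: euclidean_product_topology compactin_euclidean_iff)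
  moreover have "closed ({t :: nat \<Rightarrow> real. t 0 = s \<and> t N = e} \<inter> (\<Inter>i\<in>{..<N}. {t. d \<le> t (Suc i) - t i}))"
    by (intro closed_Int closed_INT ballI closed_Collect_conj closed_Collect_eq closed_Collect_le continuous_intros co)
  ultimately have "compact K" unfolding K_def by (rule closed_Int_compact[rotated])
  have d_pos: "0 < d" using d d0 by simp
  define c where "c = (e - s) / N"
  have c: "d \<le> c" "real N * c = e - s" using se N by (auto simp: c_def field_simps)
  \<comment> \<open>The equidistant chain is admissible; \<open>min i N\<close> freezes the
    irrelevant entries at \<open>e\<close>, inside the box.\<close>
  have "(\<lambda>i. s + real (min i N) * c) \<in> K"
  proof -
    have "0 \<le> c" using c d_pos by simp
    then have "0 \<le> real (min i N) * c" "real (min i N) * c \<le> real N * c" for i by (auto intro!: mult_right_mono)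
    then have "s + real (min i N) * c \<in> {s..e}" for i using c(2) by (auto simp: algebra_simps)
    then show ?thesis using c N by (auto simp: K_def PiE_def Pi_def extensional_def algebra_simps min_def)
  qed
  then have "K \<noteq> {}" by blast
  have "continuous_on K f" unfolding f_def
  proof (intro continuous_on_sum)
    fix i assume i: "i \<in> {..<N}"
    have "continuous_on ((\<lambda>t. (t i, t (Suc i))) ` K) (\<lambda>x. h (even i = \<sigma>) (fst x) (snd x))"
    proof (rule continuous_at_imp_continuous_on, intro ballI)
      fix x assume "x \<in> (\<lambda>t. (t i, t (Suc i))) ` K"
      then have "d \<le> snd x - fst x" using i by (auto simp: K_def)
      then show "isCont (\<lambda>x. h (even i = \<sigma>) (fst x) (snd x)) x"
        using h_continuous[of "snd x" "fst x" "even i = \<sigma>"] d by simp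
    qed
    moreover have "continuous_on K (\<lambda>t. (t i, t (Suc i)))" by (intro continuous_intros co)
    ultimately show "continuous_on K (\<lambda>t. h (even i = \<sigma>) (t i) (t (Suc i)))"
      using continuous_on_compose2[of "(\<lambda>t. (t i, t (Suc i))) ` K" "\<lambda>x. h (even i = \<sigma>) (fst x) (snd x)" K "\<lambda>t. (t i, t (Suc i))"]
      by simp
  qed
  then obtain t where t: "t \<in> K" "\<And>t'. t' \<in> K \<Longrightarrow> f t' \<le> f t"
    using continuous_attains_sup[OF \<open>compact K\<close> \<open>K \<noteq> {}\<close>] by blast
  define l where "l = map t [0..<Suc N]"
  have l: "length l = Suc N" and ln: "\<And>i. i \<le> N \<Longrightarrow> l ! i = t i" by (auto simp: l_def simp del: upt_Suc)
  have "l \<noteq> []" using l by auto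
  then have hl: "hd l = s" "last l = e" using t(1) l ln hd_conv_nth[of l] last_conv_nth[of l] by (auto simp: K_def)
  have Hl: "H \<sigma> l = f t" unfolding H_sum f_def using l ln by (intro sum.cong) auto
  have sl: "spaced d l" unfolding spaced_def successively_iff_nth using l ln t(1) by (auto simp: K_def)
  have "H \<sigma> l' \<le> H \<sigma> l" if l': "length l' = length l" "hd l' = hd l" "last l' = last l" "spaced d l'" for l'
  proof -
    define t' where "t' = (\<lambda>i. if i \<le> N then l' ! i else e)"
    have gap: "d \<le> l' ! Suc i - l' ! i" if "i < N" for i
      using l'(1,4) l that unfolding spaced_def successively_iff_nth by auto
    have "l' \<noteq> []" using l' l by auto
    then have ends: "l' ! 0 = s" "l' ! N = e" using l' hl l hd_conv_nth[of l'] last_conv_nth[of l'] by auto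
    have lo: "s \<le> l' ! i" if "i \<le> N" for i using that
    proof (induction i)
      case (Suc i) then show ?case using gap[of i] d_pos by simp
    qed (use ends in simp)
    have hi: "l' ! (N - i) \<le> e" if "i \<le> N" for i using that
    proof (induction i)
      case (Suc i)
      then have "Suc (N - Suc i) = N - i" by simp
      then show ?case using gap[of "N - Suc i"] Suc d_pos by simp
    qed (use ends in simp)
    have hi: "l' ! i \<le> e" if "i \<le> N" for i using hi[of "N - i"] that by simp
    have "s \<le> e" using lo[of N] ends by simp
    then have "t' \<in> K" using ends gap lo hi by (auto simp: K_def t'_def PiE_def Pi_def extensional_def)
    then have "f t' \<le> f t" by (rule t(2))
    moreover have "H \<sigma> l' = f t'" unfolding H_sum f_def using l' l by (intro sum.cong) (auto simp: t'_def)
    ultimately show ?thesis using Hl by simp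
  qed
  then have "optimal \<sigma> d l" using sl by (auto simp: optimal_def)
  then show ?thesis using l hl by blast
qed

lemma spaced_append: "spaced d (xs @ x # ys) \<longleftrightarrow> spaced d (xs @ [x]) \<and> spaced d (x # ys)"
  unfolding spaced_def by (auto simp: successively_append_iff successively_Cons)

lemma spaced_simps [simp]: "spaced d []" "spaced d [x]" "spaced d (x # y # l) \<longleftrightarrow> d \<le> y - x \<and> spaced d (y # l)"
  by (auto simp: spaced_def)

lemma optimal_move:
  assumes "optimal \<sigma> d (xs @ x # y # z # ys)" "d \<le> s - x" "d \<le> z - s"
  defines "\<tau> \<equiv> even (length xs) = \<sigma>"
  shows "h \<tau> x s + h (\<not> \<tau>) s z \<le> h \<tau> x y + h (\<not> \<tau>) y z"
proof -
  have "spaced d (xs @ x # s # z # ys)"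
    using assms(1-3) spaced_append[of d xs x "y # z # ys"] spaced_append[of d xs x "s # z # ys"]
    by (auto simp: optimal_def)
  then have "H \<sigma> (xs @ x # s # z # ys) \<le> H \<sigma> (xs @ x # y # z # ys)"
    by (intro optimalD[OF assms(1)]) (cases xs; auto)+
  then show ?thesis
    using H_append[of \<sigma> xs x "s # z # ys"] H_append[of \<sigma> xs x "y # z # ys"] by (auto simp: \<tau>_def)
qed

text \<open>A gap more than \<open>K\<close> times as long as its neighbour has the larger slope at
  the common node for either sign, even if its own slope is as small and the other one as large as
  the factor 2 permits.\<close>

definition K :: real where "K = 1 + 2 * k True / k False + 2 * k False / k True"

lemma K: "1 \<le> K" "2 * k (\<not> \<sigma>) \<le> K * k \<sigma>"
proof -
  have p: "0 < k True" "0 < k False" using k_pos by auto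
  then have q: "0 \<le> 2 * k True / k False" "0 \<le> 2 * k False / k True" by auto
  then show "1 \<le> K" by (simp add: K_def)
  have "2 * k True / k False \<le> K" "2 * k False / k True \<le> K" using q by (auto simp: K_def)
  then have "2 * k True \<le> K * k False" "2 * k False \<le> K * k True" using p by (simp_all add: pos_divide_le_eq)
  then show "2 * k (\<not> \<sigma>) \<le> K * k \<sigma>" using p by (cases \<sigma>) auto
qed

lemma move_derivative:
  assumes "d0 < y - x" "d0 < z - y"
  shows "((\<lambda>s. h \<tau> x s + h (\<not> \<tau>) s z) has_real_derivative - (V \<tau> x y)\<^sup>2 / 2 + (U (\<not> \<tau>) y z)\<^sup>2 / 2) (at y)"
  by (intro DERIV_add h_right h_left assms)

text \<open>If one gap exceeded \<open>K\<close> times the other, the slopes at the common node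
  would be strictly ordered, and by the derivative formula pushing the node into the longer gap
  would increase the sum. The push respects the spacing: the shorter gap grows, and the longer one
  exceeds \<open>d\<close> strictly because \<open>K\<close> is at least 1.\<close>

lemma optimal_neighbours:
  assumes opt: "optimal \<sigma> d (xs @ x # y # z # ys)" and d: "d0 < d"
  shows "z - y \<le> K * (y - x)" "y - x \<le> K * (z - y)"
proof -
  define \<tau> where "\<tau> = (even (length xs) = \<sigma>)"
  have gaps: "d \<le> y - x" "d \<le> z - y"
    using opt spaced_append[of d xs x "y # z # ys"] by (auto simp: optimal_def)
  have der: "((\<lambda>s. h \<tau> x s + h (\<not> \<tau>) s z) has_real_derivative - (V \<tau> x y)\<^sup>2 / 2 + (U (\<not> \<tau>) y z)\<^sup>2 / 2) (at y)"
    by (rule move_derivative) (use gaps d in auto)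
  note move = optimal_move[OF opt, folded \<tau>_def]
  have pos: "0 < k \<tau>" "0 < k (\<not> \<tau>)" "0 < d" using k_pos d d0 by auto
  show "z - y \<le> K * (y - x)"
  proof (rule ccontr)
    assume "\<not> ?thesis"
    then have big: "K * (y - x) < z - y" by simp
    have "y - x \<le> K * (y - x)" using mult_right_mono[OF K(1), of "y - x"] gaps pos by simp
    then have zy: "d < z - y" using big gaps by linarith
    have "V \<tau> x y \<le> 2 * k \<tau> * (y - x)" using V_le[of y x \<tau>] gaps d by auto
    also have "\<dots> \<le> K * k (\<not> \<tau>) * (y - x)" using K(2)[of "\<not> \<tau>"] gaps pos by (intro mult_right_mono) auto
    also have "\<dots> = k (\<not> \<tau>) * (K * (y - x))" by simp
    also have "\<dots> < k (\<not> \<tau>) * (z - y)" using big pos by (intro mult_strict_left_mono)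
    also have "\<dots> \<le> U (\<not> \<tau>) y z" using U_ge[of z y "\<not> \<tau>"] gaps d by auto
    finally have "V \<tau> x y < U (\<not> \<tau>) y z" .
    moreover have "0 \<le> V \<tau> x y"
      by (rule U_V_nonneg) (use gaps d in auto)
    ultimately have "(V \<tau> x y)\<^sup>2 < (U (\<not> \<tau>) y z)\<^sup>2" by (intro power_strict_mono) auto
    then obtain r where r: "0 < r" "\<And>q. 0 < q \<Longrightarrow> q < r \<Longrightarrow> h \<tau> x y + h (\<not> \<tau>) y z < h \<tau> x (y + q) + h (\<not> \<tau>) (y + q) z"
      using DERIV_pos_inc_right[OF der] by auto
    define q where "q = min (r / 2) (z - y - d)"
    have q: "0 < q" "q < r" "q \<le> z - y - d" using r zy by (auto simp: q_def)
    show False using r(2)[OF q(1,2)] move[of "y + q"] q gaps by simp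
  qed
  show "y - x \<le> K * (z - y)"
  proof (rule ccontr)
    assume "\<not> ?thesis"
    then have big: "K * (z - y) < y - x" by simp
    have "z - y \<le> K * (z - y)" using mult_right_mono[OF K(1), of "z - y"] gaps pos by simp
    then have yx: "d < y - x" using big gaps by linarith
    have "U (\<not> \<tau>) y z \<le> 2 * k (\<not> \<tau>) * (z - y)" using U_le[of z y "\<not> \<tau>"] gaps d by auto
    also have "\<dots> \<le> K * k \<tau> * (z - y)" using K(2)[of \<tau>] gaps pos by (intro mult_right_mono) auto
    also have "\<dots> = k \<tau> * (K * (z - y))" by simp
    also have "\<dots> < k \<tau> * (y - x)" using big pos by (intro mult_strict_left_mono)
    also have "\<dots> \<le> V \<tau> x y" using V_ge[of y x \<tau>] gaps d by auto
    finally have "U (\<not> \<tau>) y z < V \<tau> x y" .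
    moreover have "0 \<le> U (\<not> \<tau>) y z"
      by (rule U_V_nonneg) (use gaps d in auto)
    ultimately have "(U (\<not> \<tau>) y z)\<^sup>2 < (V \<tau> x y)\<^sup>2" by (intro power_strict_mono) auto
    then obtain r where r: "0 < r" "\<And>q. 0 < q \<Longrightarrow> q < r \<Longrightarrow> h \<tau> x y + h (\<not> \<tau>) y z < h \<tau> x (y - q) + h (\<not> \<tau>) (y - q) z"
      using DERIV_neg_dec_left[OF der] by auto
    define q where "q = min (r / 2) (y - x - d)"
    have q: "0 < q" "q < r" "q \<le> y - x - d" using r yx by (auto simp: q_def)
    show False using r(2)[OF q(1,2)] move[of "y - q"] q gaps by simp
  qed
qed

text \<open>With both gaps above \<open>d\<close> the node may move either way, so the derivative
  vanishes, and nonnegativity of the slopes turns equal squares into equal slopes. This is the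
  condition for gluing consecutive arcs of opposite sign.\<close>

lemma optimal_matching:
  assumes opt: "optimal \<sigma> d (xs @ x # y # z # ys)" and d: "d0 < d" and gaps: "d < y - x" "d < z - y"
  defines "\<tau> \<equiv> even (length xs) = \<sigma>"
  shows "V \<tau> x y = U (\<not> \<tau>) y z"
proof -
  have der: "((\<lambda>s. h \<tau> x s + h (\<not> \<tau>) s z) has_real_derivative - (V \<tau> x y)\<^sup>2 / 2 + (U (\<not> \<tau>) y z)\<^sup>2 / 2) (at y)"
    by (rule move_derivative) (use gaps d in auto)
  define r where "r = min (y - x - d) (z - y - d)"
  have "- (V \<tau> x y)\<^sup>2 / 2 + (U (\<not> \<tau>) y z)\<^sup>2 / 2 = 0"
  proof (rule DERIV_local_max[OF der, of r])
    show "\<forall>s. \<bar>y - s\<bar> < r \<longrightarrow> h \<tau> x s + h (\<not> \<tau>) s z \<le> h \<tau> x y + h (\<not> \<tau>) y z"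
    proof (intro allI impI)
      fix s assume "\<bar>y - s\<bar> < r"
      then have "d \<le> s - x" "d \<le> z - s" by (auto simp: r_def abs_if split: if_splits)
      from optimal_move[OF opt this] show "h \<tau> x s + h (\<not> \<tau>) s z \<le> h \<tau> x y + h (\<not> \<tau>) y z"
        by (simp add: \<tau>_def)
    qed
  qed (use gaps in \<open>auto simp: r_def\<close>)
  then have "(V \<tau> x y)\<^sup>2 = (U (\<not> \<tau>) y z)\<^sup>2" by simp
  moreover have "0 \<le> V \<tau> x y" "0 \<le> U (\<not> \<tau>) y z"
    by (rule U_V_nonneg; use gaps d in auto)+
  ultimately show ?thesis by (rule power2_eq_imp_eq)
qed

end

section \<open>Exchange of nodes and comparison of distant gaps\<close>

lemma nth_split: "Suc i < length l \<Longrightarrow> l = take i l @ l ! i # l ! Suc i # drop (Suc (Suc i)) l"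
  by (metis Cons_nth_drop_Suc Suc_lessD append_take_drop_id)

context twist_chain
begin

text \<open>The fraction of a gap given to a new arc of opposite sign. At most 1/3, it makes this
  arc no longer than the two remaining parts; the other bounds keep its action small against that of
  the gap even if the two signs have very different coefficients.\<close>

definition \<eta> :: real where
  "\<eta> = min (1 / 3) (min (\<alpha> True / (8 * \<alpha> False)) (\<alpha> False / (8 * \<alpha> True)))"

lemma \<eta>: "0 < \<eta>" "\<eta> \<le> 1 / 3" "8 * \<alpha> (\<not> \<sigma>) * \<eta> \<le> \<alpha> \<sigma>"
proof -
  have p: "0 < \<alpha> True" "0 < \<alpha> False" using \<alpha>_pos by auto
  then show "0 < \<eta>" "\<eta> \<le> 1 / 3" by (auto simp: \<eta>_def)
  have "\<eta> \<le> \<alpha> True / (8 * \<alpha> False)" "\<eta> \<le> \<alpha> False / (8 * \<alpha> True)" by (auto simp: \<eta>_def)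
  then have "8 * \<alpha> False * \<eta> \<le> \<alpha> True" "8 * \<alpha> True * \<eta> \<le> \<alpha> False" using p by (simp_all add: pos_le_divide_eq mult_ac)
  then show "8 * \<alpha> (\<not> \<sigma>) * \<eta> \<le> \<alpha> \<sigma>" by (cases \<sigma>) auto
qed

text \<open>Since \<open>h\<close> is about \<open>-\<alpha> L^3\<close>, cutting a gap into two long halves and a short arc of the opposite sign
  between them gains a fixed fraction of \<open>L^3\<close>.\<close>

lemma split_gain:
  assumes X: "d0 \<le> \<eta> * (y - x)"
  defines "r \<equiv> (1 - \<eta>) / 2 * (y - x)"
  shows "h \<tau> x y + \<alpha> \<tau> / 4 * (y - x) ^ 3 \<le> h \<tau> x (x + r) + h (\<not> \<tau>) (x + r) (y - r) + h \<tau> (y - r) y"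
proof -
  define X where "X = y - x"
  have "0 < \<eta> * X" using assms(1) d0 unfolding X_def by linarith
  then have X0: "0 < X" using \<eta>(1) by (rule zero_less_mult_pos)
  have r: "r = (1 - \<eta>) / 2 * X" "y - r - (x + r) = \<eta> * X" by (auto simp: r_def X_def field_simps)
  have "\<eta> * X \<le> (1 - \<eta>) / 2 * X" using \<eta> X0 by (intro mult_right_mono) auto
  then have rd: "d0 \<le> r" using X r by (simp add: X_def)
  have "\<eta> * X \<le> 1 * X" using \<eta> X0 by (intro mult_right_mono) auto
  then have Xd: "d0 \<le> X" using X by (simp add: X_def)
  have 1: "- h \<tau> x (x + r) \<le> 2 * \<alpha> \<tau> * r ^ 3" using h_le[of "x + r" x \<tau>] rd by simp
  have 2: "- h (\<not> \<tau>) (x + r) (y - r) \<le> 2 * \<alpha> (\<not> \<tau>) * (\<eta> * X) ^ 3"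
    using h_le[of "y - r" "x + r" "\<not> \<tau>", unfolded r(2)] X unfolding X_def by blast
  have 3: "- h \<tau> (y - r) y \<le> 2 * \<alpha> \<tau> * r ^ 3" using h_le[of y "y - r" \<tau>] rd by simp
  have 4: "\<alpha> \<tau> * X ^ 3 \<le> - h \<tau> x y" using h_ge[of y x \<tau>] Xd by (simp add: X_def)
  have "r \<le> X / 2" using \<eta> X0 by (simp add: r field_simps)
  then have "r ^ 3 \<le> (X / 2) ^ 3" using rd d0 by (intro power_mono) auto
  then have "2 * \<alpha> \<tau> * r ^ 3 \<le> 2 * \<alpha> \<tau> * (X / 2) ^ 3" using \<alpha>_pos[of \<tau>] by (intro mult_left_mono) auto
  then have 5: "2 * \<alpha> \<tau> * r ^ 3 \<le> \<alpha> \<tau> * X ^ 3 / 4" by (simp add: power_divide)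
  have "\<eta> ^ 3 \<le> \<eta>" using \<eta> power_decreasing[of 1 3 \<eta>] by simp
  then have "8 * \<alpha> (\<not> \<tau>) * \<eta> ^ 3 \<le> 8 * \<alpha> (\<not> \<tau>) * \<eta>" using \<alpha>_pos[of "\<not> \<tau>"] by (intro mult_left_mono) auto
  also have "\<dots> \<le> \<alpha> \<tau>" by (rule \<eta>(3))
  finally have "8 * \<alpha> (\<not> \<tau>) * \<eta> ^ 3 * X ^ 3 \<le> \<alpha> \<tau> * X ^ 3" using X0 by (intro mult_right_mono) auto
  then have 6: "2 * \<alpha> (\<not> \<tau>) * (\<eta> * X) ^ 3 \<le> \<alpha> \<tau> * X ^ 3 / 4" by (simp add: power_mult_distrib mult_ac)
  \<comment> \<open>In units of \<open>\<alpha> \<tau> * X ^ 3\<close> each of the three new arcs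
    costs at most 1/4, whereas the undivided gap costs at least 1.\<close>
  have "h \<tau> x y + \<alpha> \<tau> / 4 * X ^ 3 \<le> h \<tau> x (x + r) + h (\<not> \<tau>) (x + r) (y - r) + h \<tau> (y - r) y"
    using 1 2 3 4 5 6 by simp
  then show ?thesis by (simp add: X_def)
qed

definition gain :: real where "gain = min (\<alpha> True) (\<alpha> False) / 4"
definition cost :: real where "cost = 2 * max (\<alpha> True) (\<alpha> False)"

lemma gain: "0 < gain" "gain \<le> \<alpha> \<sigma> / 4" and cost: "0 < cost" "2 * \<alpha> \<sigma> \<le> cost"
  using \<alpha>_pos[of True] \<alpha>_pos[of False] by (auto simp: gain_def cost_def) (cases \<sigma>; simp)+

lemma insert_two:
  assumes sp: "spaced d (as @ a # b # bs)" and d: "d0 < d" and X: "d \<le> \<eta> * (b - a)"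
  shows "\<exists>l. length l = length (as @ a # b # bs) + 2 \<and> hd l = hd (as @ a # b # bs) \<and>
    last l = last (as @ a # b # bs) \<and> spaced d l \<and> H \<sigma> (as @ a # b # bs) + gain * (b - a) ^ 3 \<le> H \<sigma> l"
proof -
  define r where "r = (1 - \<eta>) / 2 * (b - a)"
  define \<tau> where "\<tau> = (even (length as) = \<sigma>)"
  define l where "l = as @ a # (a + r) # (b - r) # b # bs"
  have "0 < \<eta> * (b - a)" using X d d0 by linarith
  then have ba: "0 < b - a" using \<eta>(1) by (rule zero_less_mult_pos)
  have "\<eta> * (b - a) \<le> r" unfolding r_def using \<eta> ba by (intro mult_right_mono) auto
  then have r: "d \<le> r" using X by simp
  have mid: "b - r - (a + r) = \<eta> * (b - a)" by (simp add: r_def field_simps)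
  have "spaced d (as @ [a])" "spaced d (b # bs)" using sp spaced_append[of d as a "b # bs"] by auto
  then have "spaced d l" unfolding l_def spaced_append[of d as a "(a + r) # (b - r) # b # bs"]
    using r mid X by simp
  moreover have "H \<sigma> (as @ a # b # bs) + gain * (b - a) ^ 3 \<le> H \<sigma> l"
  proof -
    have "h \<tau> a b + \<alpha> \<tau> / 4 * (b - a) ^ 3 \<le> h \<tau> a (a + r) + h (\<not> \<tau>) (a + r) (b - r) + h \<tau> (b - r) b"
      unfolding r_def by (rule split_gain) (use X d in auto)
    moreover have "gain * (b - a) ^ 3 \<le> \<alpha> \<tau> / 4 * (b - a) ^ 3"
      using gain(2) ba by (intro mult_right_mono) auto
    ultimately show ?thesis
      unfolding l_def H_append[of \<sigma> as a "b # bs"] H_append[of \<sigma> as a "(a + r) # (b - r) # b # bs"]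
      by (simp add: \<tau>_def[symmetric])
  qed
  ultimately show ?thesis by (intro exI[of _ l]) (cases as; auto simp: l_def)
qed

lemma merge_three:
  assumes "d0 \<le> y - x" "d0 \<le> z - y" "d0 \<le> w - z"
  shows "h \<tau> x y + h (\<not> \<tau>) y z + h \<tau> z w \<le> h \<tau> x w + cost * (w - x) ^ 3"
proof -
  have neg: "h \<sigma> a b \<le> 0" if "d0 \<le> b - a" for \<sigma> a b
  proof -
    have "0 \<le> \<alpha> \<sigma> * (b - a) ^ 3" using \<alpha>_pos[of \<sigma>] that d0 by (intro mult_nonneg_nonneg zero_le_power) auto
    then show ?thesis using h_ge[OF that, of \<sigma>] by linarith
  qed
  have "- h \<tau> x w \<le> 2 * \<alpha> \<tau> * (w - x) ^ 3" using h_le[of w x \<tau>] assms d0 by simp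
  also have "\<dots> \<le> cost * (w - x) ^ 3" using cost(2) assms d0 by (intro mult_right_mono) auto
  finally show ?thesis using neg[OF assms(1), of \<tau>] neg[OF assms(2), of "\<not> \<tau>"] neg[OF assms(3), of \<tau>] by linarith
qed

text \<open>Each summand serves one requirement: 3 K^2 covers gaps inside the window of short gaps,
  1 / \<eta> makes the inserted gaps respect the spacing, and the last makes the gain exceed the
  cost of merging, where \<rho> \<le> \<rho>^3 is used.\<close>

definition \<rho> :: real where "\<rho> = 3 * K\<^sup>2 + 1 / \<eta> + cost * (3 * K\<^sup>2) ^ 3 / gain"

lemma \<rho>: "3 * K\<^sup>2 < \<rho>" "1 \<le> \<eta> * \<rho>" "cost * (3 * K\<^sup>2) ^ 3 < gain * \<rho> ^ 3" "1 \<le> \<rho>"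
proof -
  have k1: "1 \<le> K\<^sup>2" using power_mono[OF K(1), of 2] by simp
  have c: "0 \<le> cost * (3 * K\<^sup>2) ^ 3 / gain" using cost gain by auto
  have e: "0 < 1 / \<eta>" using \<eta> by simp
  show 1: "3 * K\<^sup>2 < \<rho>" using c e unfolding \<rho>_def by linarith
  show r1: "1 \<le> \<rho>" using 1 k1 by simp
  have "1 / \<eta> \<le> \<rho>" using c k1 unfolding \<rho>_def by linarith
  then show "1 \<le> \<eta> * \<rho>" using \<eta> by (simp add: pos_divide_le_eq mult.commute)
  have "cost * (3 * K\<^sup>2) ^ 3 / gain < \<rho>" using e k1 unfolding \<rho>_def by linarith
  also have "\<rho> \<le> \<rho> ^ 3" using r1 power_increasing[of 1 3 \<rho>] by simp
  finally show "cost * (3 * K\<^sup>2) ^ 3 < gain * \<rho> ^ 3" using gain by (simp add: pos_divide_less_eq mult.commute)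
qed

text \<open>Removing two nodes where the gaps are short and inserting two nodes into a long gap leaves the
  number of nodes and the signs of all other arcs unchanged, so this exchange cannot be profitable for an optimal chain.\<close>

lemma exchange_lists:
  assumes opt: "optimal \<sigma> d (xs @ x # y # z # w # ys)" and d: "d0 < d" and m: "d \<le> m"
    and short: "y - x \<le> K\<^sup>2 * m" "z - y \<le> K\<^sup>2 * m" "w - z \<le> K\<^sup>2 * m"
    and long: "xs @ [x] = as @ a # b # bs \<or> w # ys = as @ a # b # bs"
  shows "b - a < \<rho> * m"
proof (rule ccontr)
  assume "\<not> ?thesis"
  then have X: "\<rho> * m \<le> b - a" by simp
  define \<tau> where "\<tau> = (even (length xs) = \<sigma>)"
  have m0: "0 < m" using m d d0 by simp
  have sp: "spaced d (xs @ [x])" "spaced d (w # ys)" "d \<le> y - x" "d \<le> z - y" "d \<le> w - z"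
    using opt spaced_append[of d xs x "y # z # w # ys"] by (auto simp: optimal_def)
  have "\<eta> * (\<rho> * m) \<le> \<eta> * (b - a)" using X \<eta>(1) by (intro mult_left_mono) auto
  moreover have "1 * m \<le> (\<eta> * \<rho>) * m" using \<rho>(2) m0 by (intro mult_right_mono) auto
  ultimately have eX: "d \<le> \<eta> * (b - a)" using m by (simp add: mult.assoc)
  have "h \<tau> x y + h (\<not> \<tau>) y z + h \<tau> z w \<le> h \<tau> x w + cost * (w - x) ^ 3"
    by (rule merge_three) (use sp d in auto)
  also have "cost * (w - x) ^ 3 \<le> cost * (3 * K\<^sup>2 * m) ^ 3"
    using short sp d d0 cost by (intro mult_left_mono power_mono) auto
  also have "\<dots> = cost * (3 * K\<^sup>2) ^ 3 * m ^ 3" by (simp add: power_mult_distrib)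
  also have "\<dots> < gain * \<rho> ^ 3 * m ^ 3" using \<rho>(3) m0 by (intro mult_strict_right_mono) auto
  also have "\<dots> = gain * (\<rho> * m) ^ 3" by (simp add: power_mult_distrib)
  also have "\<dots> \<le> gain * (b - a) ^ 3"
    using X gain \<rho> m0 by (intro mult_left_mono power_mono) auto
  finally have better: "h \<tau> x y + h (\<not> \<tau>) y z + h \<tau> z w < h \<tau> x w + gain * (b - a) ^ 3" by simp
  have Hl: "H \<sigma> (xs @ x # y # z # w # ys) = H \<sigma> (xs @ [x]) + (h \<tau> x y + h (\<not> \<tau>) y z + h \<tau> z w) + H (\<not> \<tau>) (w # ys)"
    unfolding H_append[of \<sigma> xs x "y # z # w # ys"] by (simp add: \<tau>_def)
  from long show False
  proof
    assume eq: "xs @ [x] = as @ a # b # bs"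
    then obtain l where l: "length l = length (xs @ [x]) + 2" "hd l = hd (xs @ [x])" "last l = last (xs @ [x])"
       "spaced d l" "H \<sigma> (xs @ [x]) + gain * (b - a) ^ 3 \<le> H \<sigma> l"
      using insert_two[of d as a b bs \<sigma>] sp(1) d eX by auto
    \<comment> \<open>The modified prefix still ends in \<open>x\<close>. Stripping that entry lets
      the new list continue with \<open>x\<close> and then \<open>w\<close>, and the two inserted
      nodes make up for \<open>y\<close> and \<open>z\<close>.\<close>
    define zs where "zs = butlast l"
    have "l \<noteq> []" using l(1) by auto
    then have zs: "l = zs @ [x]" "length zs = length xs + 2"
      using l append_butlast_last_id[of l] by (auto simp: zs_def)
    have "zs \<noteq> []" using zs by auto
    have "H \<sigma> (zs @ x # w # ys) \<le> H \<sigma> (xs @ x # y # z # w # ys)"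
    proof (rule optimalD[OF opt])
      show "hd (zs @ x # w # ys) = hd (xs @ x # y # z # w # ys)"
        using l(2) zs \<open>zs \<noteq> []\<close> by (cases xs) auto
      show "spaced d (zs @ x # w # ys)"
        using l(4) sp d d0 unfolding spaced_append[of d zs x "w # ys"] zs by auto
    qed (use zs in auto)
    moreover have "H \<sigma> (zs @ x # w # ys) = H \<sigma> l + h \<tau> x w + H (\<not> \<tau>) (w # ys)"
      unfolding H_append[of \<sigma> zs x "w # ys"] zs by (simp add: \<tau>_def zs)
    ultimately show False using Hl better l(5) by linarith
  next
    assume eq: "w # ys = as @ a # b # bs"
    \<comment> \<open>One arc from \<open>x\<close> to \<open>w\<close> has the same parity as
      three, so the part beginning at \<open>w\<close> keeps the sign
      \<open>\<not> \<tau>\<close>.\<close>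
    then obtain l where l: "length l = length (w # ys) + 2" "hd l = hd (w # ys)" "last l = last (w # ys)"
       "spaced d l" "H (\<not> \<tau>) (w # ys) + gain * (b - a) ^ 3 \<le> H (\<not> \<tau>) l"
      using insert_two[of d as a b bs "\<not> \<tau>"] sp(2) d eX by metis
    define zs where "zs = tl l"
    have zs: "l = w # zs" "length zs = length ys + 2" using l by (cases l; auto simp: zs_def)+
    have "H \<sigma> (xs @ x # l) \<le> H \<sigma> (xs @ x # y # z # w # ys)"
    proof (rule optimalD[OF opt])
      show "hd (xs @ x # l) = hd (xs @ x # y # z # w # ys)" by (cases xs) auto
      show "last (xs @ x # l) = last (xs @ x # y # z # w # ys)" using l(3) zs by simp
      show "spaced d (xs @ x # l)"
        using l(4) sp d d0 unfolding zs spaced_append[of d xs x "w # zs"] by auto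
    qed (use zs in auto)
    moreover have "H \<sigma> (xs @ x # l) = H \<sigma> (xs @ [x]) + h \<tau> x w + H (\<not> \<tau>) l"
      unfolding zs H_append[of \<sigma> xs x "w # zs"] by (simp add: \<tau>_def)
    ultimately show False using Hl better l(5) by linarith
  qed
qed

text \<open>Two applications of the neighbour estimate spread one short gap to a window of three
  consecutive gaps of length at most \<open>K\<^sup>2 * m\<close>. Any other gap lies entirely
  before or entirely after the window, where two nodes can be inserted. The ratio \<rho> depends
  neither on the distance of the two gaps nor on the number of nodes.\<close>

lemma exchange:
  assumes opt: "optimal \<sigma> d l" and d: "d0 < d" and len: "4 \<le> length l"
    and j: "Suc j < length l" and i: "Suc i < length l"
  shows "l ! Suc i - l ! i < \<rho> * (l ! Suc j - l ! j)"
proof -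
  define m where "m = l ! Suc j - l ! j"
  have sp: "d \<le> l ! Suc n - l ! n" if "Suc n < length l" for n
    using opt that by (auto simp: optimal_def spaced_def successively_iff_nth)
  have m: "d \<le> m" using sp[OF j] by (simp add: m_def)
  have m0: "0 < m" using m d d0 by simp
  have nb: "l ! Suc (Suc n) - l ! Suc n \<le> K * (l ! Suc n - l ! n)"
      "l ! Suc n - l ! n \<le> K * (l ! Suc (Suc n) - l ! Suc n)" if n: "Suc (Suc n) < length l" for n
  proof -
    have eq: "l = take n l @ l ! n # l ! Suc n # l ! Suc (Suc n) # drop (Suc (Suc (Suc n))) l"
      using n by (metis Cons_nth_drop_Suc Suc_lessD append_take_drop_id)
    have opt': "optimal \<sigma> d (take n l @ l ! n # l ! Suc n # l ! Suc (Suc n) # drop (Suc (Suc (Suc n))) l)"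
      using opt eq by simp
    show "l ! Suc (Suc n) - l ! Suc n \<le> K * (l ! Suc n - l ! n)"
      "l ! Suc n - l ! n \<le> K * (l ! Suc (Suc n) - l ! Suc n)" using optimal_neighbours[OF opt' d] by auto
  qed
  have K2: "1 \<le> K" "K \<le> K\<^sup>2" using K(1) by (auto simp: power2_eq_square mult_left_mono)
  have s0: "l ! Suc j - l ! j \<le> K\<^sup>2 * m" using K2 m0 mult_right_mono[of 1 "K\<^sup>2" m] by (simp add: m_def)
  have km: "K * m \<le> K\<^sup>2 * m" using K2 m0 by (intro mult_right_mono) auto
  have kk: "K * X \<le> K\<^sup>2 * m" if "X \<le> K * m" for X
    using mult_left_mono[OF that, of K] K2 by (simp add: power2_eq_square mult.assoc)
  \<comment> \<open>The window starts at \<open>j\<close>, or one or two places earlier when the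
    chain ends too soon; four nodes leave room for it.\<close>
  have "\<exists>n. Suc (Suc (Suc n)) < length l \<and> (\<forall>q\<in>{n, Suc n, Suc (Suc n)}. l ! Suc q - l ! q \<le> K\<^sup>2 * m)"
  proof (cases "Suc (Suc (Suc j)) < length l")
    case True
    have 1: "l ! Suc (Suc j) - l ! Suc j \<le> K * m" using nb(1)[of j] True by (simp add: m_def)
    have "l ! Suc (Suc (Suc j)) - l ! Suc (Suc j) \<le> K\<^sup>2 * m" using nb(1)[of "Suc j"] True kk[OF 1] by simp
    then show ?thesis using True 1 km s0 by (intro exI[of _ j]) auto
  next
    case False
    then obtain n where n: "j = Suc n" using len j by (cases j) auto
    have 1: "l ! Suc n - l ! n \<le> K * m" using nb(2)[of n] j by (simp add: n m_def)
    show ?thesis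
    proof (cases "Suc (Suc j) < length l")
      case True
      have "l ! Suc (Suc j) - l ! Suc j \<le> K * m" using nb(1)[of j] True by (simp add: m_def)
      then show ?thesis using True 1 km s0 by (intro exI[of _ n]) (auto simp: n)
    next
      case False
      then obtain n' where n': "n = Suc n'" using len j n by (cases n) auto
      have "l ! Suc n' - l ! n' \<le> K\<^sup>2 * m" using nb(2)[of n'] j kk[OF 1] by (simp add: n n')
      then show ?thesis using j 1 km s0 by (intro exI[of _ n']) (auto simp: n n')
    qed
  qed
  then obtain n where n: "Suc (Suc (Suc n)) < length l"
    and short: "\<And>q. q \<in> {n, Suc n, Suc (Suc n)} \<Longrightarrow> l ! Suc q - l ! q \<le> K\<^sup>2 * m" by blast
  show ?thesis
  proof (cases "i \<in> {n, Suc n, Suc (Suc n)}")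
    case True
    have "l ! Suc i - l ! i \<le> K\<^sup>2 * m" by (rule short[OF True])
    also have "\<dots> < \<rho> * m" using \<rho>(1) K2 m0 by (intro mult_strict_right_mono) auto
    finally show ?thesis by (simp add: m_def)
  next
    case False
    define xs where "xs = take n l"
    define ys where "ys = drop (Suc (Suc (Suc (Suc n)))) l"
    have eq: "l = xs @ l ! n # l ! Suc n # l ! Suc (Suc n) # l ! Suc (Suc (Suc n)) # ys"
      unfolding xs_def ys_def using n by (metis Cons_nth_drop_Suc Suc_lessD append_take_drop_id)
    have pre: "xs @ [l ! n] = take (Suc n) l" using n by (simp add: xs_def take_Suc_conv_app_nth)
    have post: "l ! Suc (Suc (Suc n)) # ys = drop (Suc (Suc (Suc n))) l" using n by (simp add: ys_def Cons_nth_drop_Suc)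
    have opt': "optimal \<sigma> d (xs @ l ! n # l ! Suc n # l ! Suc (Suc n) # l ! Suc (Suc (Suc n)) # ys)"
      using opt eq by simp
    have "\<exists>as bs. xs @ [l ! n] = as @ l ! i # l ! Suc i # bs \<or> l ! Suc (Suc (Suc n)) # ys = as @ l ! i # l ! Suc i # bs"
    proof (cases "i < n")
      case True
      then have "take (Suc n) l = take i (take (Suc n) l) @ take (Suc n) l ! i # take (Suc n) l ! Suc i # drop (Suc (Suc i)) (take (Suc n) l)"
        using n by (intro nth_split) auto
      then show ?thesis unfolding pre using True by auto
    next
      case False
      define q where "q = i - Suc (Suc (Suc n))"
      have q: "i = Suc (Suc (Suc n)) + q" using False \<open>i \<notin> _\<close> by (auto simp: q_def)
      let ?d = "drop (Suc (Suc (Suc n))) l"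
      have "?d = take q ?d @ ?d ! q # ?d ! Suc q # drop (Suc (Suc q)) ?d"
        using i q by (intro nth_split) auto
      moreover have "?d ! q = l ! i" "?d ! Suc q = l ! Suc i" using i q n by (auto simp: nth_drop)
      ultimately show ?thesis unfolding post by metis
    qed
    then obtain as bs where "xs @ [l ! n] = as @ l ! i # l ! Suc i # bs \<or> l ! Suc (Suc (Suc n)) # ys = as @ l ! i # l ! Suc i # bs" by blast
    from exchange_lists[OF opt' d m short short short this] show ?thesis by (simp add: m_def)
  qed
qed

text \<open>The ends are placed so that the mean gap is \<rho> d. Some gap is at least the mean, so
  by \<open>exchange\<close> every gap exceeds \<open>d\<close> strictly and the spacing constraint
  is inactive. Some gap is at most the mean, so no gap exceeds \<rho> times it. Both bounds are
  independent of \<open>n\<close>.\<close>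

lemma chain_exists:
  assumes d: "d0 < d"
  shows "\<exists>D. \<forall>n::nat. \<exists>N t. t 0 \<le> - real n \<and> real n \<le> t N \<and>
    (\<forall>i<N. d \<le> t (Suc i) - t i \<and> t (Suc i) - t i \<le> D) \<and>
    (\<forall>i. Suc i < N \<longrightarrow> V (even i) (t i) (t (Suc i)) = U (odd i) (t (Suc i)) (t (Suc (Suc i))))"
proof (intro exI[of _ "\<rho> * (\<rho> * d)"] allI)
  fix n :: nat
  define L where "L = \<rho> * d"
  have "d \<le> L" using \<rho>(4) d d0 mult_right_mono[of 1 \<rho> d] by (simp add: L_def)
  then have L: "d \<le> L" "1 \<le> L" using d d0 by auto
  \<comment> \<open>The nodes span an interval symmetric about 0; taking n + 2 instead of n
    guarantees the four nodes that \<open>exchange\<close> needs.\<close>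
  define N where "N = 2 * (n + 2)"
  define s where "s = - (real (n + 2) * L)"
  define e where "e = real (n + 2) * L"
  have es: "e - s = real N * L" by (simp add: e_def s_def N_def algebra_simps)
  have "real N * d \<le> e - s" unfolding es using L by (intro mult_left_mono) auto
  then obtain l where l: "length l = Suc N" "hd l = s" "last l = e" "optimal True d l"
    using optimal_exists[OF d, of N e s True] by (auto simp: N_def)
  define t where "t = (\<lambda>i. l ! i)"
  have "l \<noteq> []" using l by auto
  then have ends: "t 0 = s" "t N = e" using l hd_conv_nth[of l] last_conv_nth[of l] by (auto simp: t_def)
  have gap: "d \<le> t (Suc i) - t i" if "i < N" for i
    using l(1,4) that by (auto simp: t_def optimal_def spaced_def successively_iff_nth)
  have ex: "t (Suc i) - t i < \<rho> * (t (Suc j) - t j)" if "i < N" "j < N" for i j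
    unfolding t_def by (rule exchange[OF l(4) d]) (use that l(1) in \<open>auto simp: N_def\<close>)
  have tel: "(\<Sum>i<N. t (Suc i) - t i) = real N * L"
    using sum_lessThan_telescope[of t N] ends es by simp
  have N0: "{..<N} \<noteq> {}" "0 < N" by (auto simp: N_def)
  have "\<exists>i<N. L \<le> t (Suc i) - t i"
  proof (rule ccontr)
    assume "\<not> ?thesis"
    then have "(\<Sum>i<N. t (Suc i) - t i) < (\<Sum>i<N. L)"
      using N0 by (intro sum_strict_mono) (auto simp: not_le)
    then show False using tel by simp
  qed
  then obtain i0 where i0: "i0 < N" "L \<le> t (Suc i0) - t i0" by blast
  have "\<exists>i<N. t (Suc i) - t i \<le> L"
  proof (rule ccontr)
    assume "\<not> ?thesis"
    then have "(\<Sum>i<N. L) < (\<Sum>i<N. t (Suc i) - t i)"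
      using N0 by (intro sum_strict_mono) (auto simp: not_le)
    then show False using tel by simp
  qed
  then obtain j0 where j0: "j0 < N" "t (Suc j0) - t j0 \<le> L" by blast
  have \<rho>0: "0 < \<rho>" using \<rho>(4) by simp
  have upper: "t (Suc i) - t i \<le> \<rho> * L" if "i < N" for i
    using ex[OF that j0(1)] mult_left_mono[OF j0(2) less_imp_le[OF \<rho>0]] by linarith
  have strict: "d < t (Suc i) - t i" if "i < N" for i
  proof -
    have "\<rho> * d < \<rho> * (t (Suc i) - t i)" using ex[OF i0(1) that] i0(2) by (simp add: L_def)
    then show ?thesis using \<rho>0 by simp
  qed
  have match: "V (even i) (t i) (t (Suc i)) = U (odd i) (t (Suc i)) (t (Suc (Suc i)))" if i: "Suc i < N" for i
  proof -
    have eq: "l = take i l @ l ! i # l ! Suc i # l ! Suc (Suc i) # drop (Suc (Suc (Suc i))) l"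
      using i l(1) by (metis Cons_nth_drop_Suc Suc_lessD append_take_drop_id Suc_less_eq)
    have opt': "optimal True d (take i l @ l ! i # l ! Suc i # l ! Suc (Suc i) # drop (Suc (Suc (Suc i))) l)"
      using l(4) eq by simp
    have "length (take i l) = i" using i l(1) by simp
    with optimal_matching[OF opt' d] strict[of i] strict[of "Suc i"] i show ?thesis by (simp add: t_def)
  qed
  have "real n * 1 \<le> real (n + 2) * L" using L by (intro mult_mono) auto
  then have "t 0 \<le> - real n" "real n \<le> t N" by (auto simp: ends s_def e_def)
  then show "\<exists>N t. t 0 \<le> - real n \<and> real n \<le> t N \<and>
    (\<forall>i<N. d \<le> t (Suc i) - t i \<and> t (Suc i) - t i \<le> \<rho> * (\<rho> * d)) \<and>
    (\<forall>i. Suc i < N \<longrightarrow> V (even i) (t i) (t (Suc i)) = U (odd i) (t (Suc i)) (t (Suc (Suc i))))"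
    using gap upper match by (intro exI[of _ N] exI[of _ t]) (auto simp: L_def)
qed

end

section \<open>Gluing arcs and passing to the limit\<close>

text \<open>A derivative relative to a union of two sets only has to be checked relative to each. If
  \<open>s\<close> lies outside one of the intervals, the filter there is trivial and nothing
  remains to be shown.\<close>

lemma has_real_derivative_glue:
  fixes f1 f2 :: "real \<Rightarrow> real"
  assumes f1: "\<And>s. s \<in> {a..b} \<Longrightarrow> (f1 has_real_derivative D1 s) (at s within {a..b})"
    and f2: "\<And>s. s \<in> {b..c} \<Longrightarrow> (f2 has_real_derivative D2 s) (at s within {b..c})"
    and eq: "f1 b = f2 b" "D1 b = D2 b" and abc: "a \<le> b" "b \<le> c" and s: "s \<in> {a..c}"
  shows "((\<lambda>s. if s \<le> b then f1 s else f2 s) has_real_derivative (if s \<le> b then D1 s else D2 s)) (at s within {a..c})"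
    (is "(?f has_real_derivative ?D) _")
proof -
  have 1: "(?f has_real_derivative ?D) (at s within {a..b})"
  proof (cases "s \<le> b")
    case True
    have "(f1 has_real_derivative ?D) (at s within {a..b})" using f1[of s] True s by simp
    then show ?thesis
      by (rule has_field_derivative_transform_within[of _ _ _ _ 1]) (use True s in auto)
  next
    case False
    then have "at s within {a..b} = bot"
      by (simp add: at_within_eq_bot_iff)
    then show ?thesis by (simp add: has_field_derivative_iff)
  qed
  have 2: "(?f has_real_derivative ?D) (at s within {b..c})"
  proof (cases "b \<le> s")
    case True
    have "(f2 has_real_derivative ?D) (at s within {b..c})"
      using f2[of s] True s eq by (cases "s = b") auto
    then show ?thesis
      by (rule has_field_derivative_transform_within[of _ _ _ _ 1]) (use True s eq in auto)
  next
    case False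
    then have "at s within {b..c} = bot"
      by (simp add: at_within_eq_bot_iff)
    then show ?thesis by (simp add: has_field_derivative_iff)
  qed
  have "{a..c} = {a..b} \<union> {b..c}" using abc by auto
  then show ?thesis using 1 2 by (simp add: has_field_derivative_iff Lim_Un)
qed

lemma solves_on_glue:
  assumes 1: "solves_on g p {a..b} u1 v1" and 2: "solves_on g p {b..c} u2 v2"
    and eq: "u1 b = u2 b" "v1 b = v2 b" and abc: "a \<le> b" "b \<le> c"
  shows "solves_on g p {a..c} (\<lambda>s. if s \<le> b then u1 s else u2 s) (\<lambda>s. if s \<le> b then v1 s else v2 s)"
  unfolding solves_on_def
proof (intro ballI conjI)
  have acc: "p b - g (u1 b) = p b - g (u2 b)" using eq(1) by simp
  fix s assume s: "s \<in> {a..c}"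
  show "((\<lambda>s. if s \<le> b then u1 s else u2 s) has_real_derivative (if s \<le> b then v1 s else v2 s)) (at s within {a..c})"
    by (rule has_real_derivative_glue[OF solves_onD(1)[OF 1] solves_onD(1)[OF 2] eq abc s])
  have "((\<lambda>s. if s \<le> b then v1 s else v2 s) has_real_derivative
     (if s \<le> b then p s - g (u1 s) else p s - g (u2 s))) (at s within {a..c})"
    by (rule has_real_derivative_glue[OF solves_onD(2)[OF 1] solves_onD(2)[OF 2] eq(2) acc abc s])
  then show "((\<lambda>s. if s \<le> b then v1 s else v2 s) has_real_derivative
     p s - g (if s \<le> b then u1 s else u2 s)) (at s within {a..c})"
    by (cases "s \<le> b") auto
qed

lemma solves_on_singleton: "solves_on g p {a} u v"
proof -
  have "at a within {a} = bot" by (simp add: at_within_eq_bot_iff)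
  then show ?thesis by (simp add: solves_on_def has_field_derivative_iff)
qed

section \<open>Continuous dependence and compactness of bounded solutions\<close>

lemma solves_on_gronwall:
  assumes 1: "solves_on g p {-T..T} u1 v1" and 2: "solves_on g p {-T..T} u2 v2"
    and lip: "\<And>x y. \<bar>g x - g y\<bar> \<le> \<Gamma> * \<bar>x - y\<bar>" and \<Gamma>: "0 \<le> \<Gamma>" and t: "\<bar>t\<bar> < T"
  shows "(u1 t - u2 t)\<^sup>2 + (v1 t - v2 t)\<^sup>2 \<le> ((u1 0 - u2 0)\<^sup>2 + (v1 0 - v2 0)\<^sup>2) * exp ((1 + \<Gamma>) * \<bar>t\<bar>)"
proof -
  define E where "E = (\<lambda>t. (u1 t - u2 t)\<^sup>2 + (v1 t - v2 t)\<^sup>2)"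
  define E' where "E' = (\<lambda>t. 2 * ((u1 t - u2 t) * (v1 t - v2 t)) + 2 * ((v1 t - v2 t) * (g (u2 t) - g (u1 t))))"
  define c where "c = 1 + \<Gamma>"
  have dE: "(E has_real_derivative E' s) (at s)" if "\<bar>s\<bar> < T" for s
  proof -
    have s: "s \<in> {-T..T}" "at s within {-T..T} = at s" using that by (auto intro!: at_within_interior)
    have "(u1 has_real_derivative v1 s) (at s)" "(v1 has_real_derivative p s - g (u1 s)) (at s)"
      "(u2 has_real_derivative v2 s) (at s)" "(v2 has_real_derivative p s - g (u2 s)) (at s)"
      using solves_onD[OF 1 s(1)] solves_onD[OF 2 s(1)] s(2) by auto
    then show ?thesis unfolding E_def E'_def
      by (auto intro!: derivative_eq_intros simp: algebra_simps)
  qed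
  \<comment> \<open>Velocity drives position with coefficient 1, position drives velocity with
    coefficient \<Gamma>; in both terms 2 w z \<le> w^2 + z^2 gives back \<open>E\<close>. The
    absolute value serves both directions of time.\<close>
  have bE: "\<bar>E' s\<bar> \<le> c * E s" for s
  proof -
    define w z where "w = \<bar>u1 s - u2 s\<bar>" "z = \<bar>v1 s - v2 s\<bar>"
    have nn: "0 \<le> w" "0 \<le> z" by (auto simp: w_z_def)
    have "\<bar>E' s\<bar> \<le> 2 * w * z + 2 * z * \<bar>g (u2 s) - g (u1 s)\<bar>"
      unfolding E'_def w_z_def by (rule order_trans[OF abs_triangle_ineq]) (simp add: abs_mult)
    also have "2 * z * \<bar>g (u2 s) - g (u1 s)\<bar> \<le> 2 * z * (\<Gamma> * w)"
      using lip[of "u2 s" "u1 s"] nn by (intro mult_left_mono) (auto simp: w_z_def abs_minus_commute)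
    also have "2 * w * z + 2 * z * (\<Gamma> * w) = c * (2 * w * z)" by (simp add: c_def algebra_simps)
    also have "\<dots> \<le> c * (w\<^sup>2 + z\<^sup>2)"
      using sum_squares_bound[of w z] \<Gamma> by (intro mult_left_mono) (auto simp: c_def)
    also have "\<dots> = c * E s" by (simp add: E_def w_z_def)
    finally show ?thesis by simp
  qed
  have "E t \<le> E 0 * exp (c * \<bar>t\<bar>)"
  proof (cases "0 \<le> t")
    case True
    have "E t * exp (- c * t) \<le> E 0 * exp (- c * 0)"
    proof (rule DERIV_nonpos_imp_nonincreasing[OF True])
      fix s assume "0 \<le> s" "s \<le> t"
      then have d: "((\<lambda>s. E s * exp (- c * s)) has_real_derivative (E' s - c * E s) * exp (- c * s)) (at s)"
        using dE[of s] t by (auto intro!: derivative_eq_intros simp: algebra_simps)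
      have "E' s - c * E s \<le> 0" using bE[of s] by linarith
      then have "(E' s - c * E s) * exp (- c * s) \<le> 0" by (simp add: mult_nonpos_nonneg)
      then show "\<exists>y. ((\<lambda>s. E s * exp (- c * s)) has_real_derivative y) (at s) \<and> y \<le> 0" using d by blast
    qed
    then show ?thesis using True by (simp add: exp_minus field_simps)
  next
    case False
    have "E t * exp (c * t) \<le> E 0 * exp (c * 0)"
    proof (rule DERIV_nonneg_imp_nondecreasing[where f="\<lambda>s. E s * exp (c * s)"])
      show "t \<le> 0" using False by simp
    next
      fix s assume "t \<le> s" "s \<le> 0"
      then have d: "((\<lambda>s. E s * exp (c * s)) has_real_derivative (E' s + c * E s) * exp (c * s)) (at s)"
        using dE[of s] t by (auto intro!: derivative_eq_intros simp: algebra_simps)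
      have "0 \<le> E' s + c * E s" using bE[of s] by linarith
      then have "0 \<le> (E' s + c * E s) * exp (c * s)" by simp
      then show "\<exists>y. ((\<lambda>s. E s * exp (c * s)) has_real_derivative y) (at s) \<and> 0 \<le> y" using d by blast
    qed
    then show ?thesis using False by (simp add: exp_minus field_simps)
  qed
  then show ?thesis unfolding E_def c_def .
qed

lemma has_real_derivative_of_estimate:
  fixes f :: "real \<Rightarrow> real"
  assumes "\<And>e. 0 < e \<Longrightarrow> \<exists>\<delta>>0. \<forall>s. \<bar>s - t\<bar> < \<delta> \<longrightarrow> \<bar>f s - f t - D * (s - t)\<bar> \<le> e * \<bar>s - t\<bar>"
  shows "(f has_real_derivative D) (at t)"
  unfolding has_field_derivative_def has_derivative_within_alt
  using assms by (auto simp: bounded_linear_mult_right)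

text \<open>Convergent data at time 0 suffice: by \<open>solves_on_gronwall\<close>, positions and
  velocities are then Cauchy at every time. Derivatives survive because difference quotients are
  controlled uniformly in \<open>n\<close>. Points where the solutions are large are confined to a
  fixed compact interval, so largeness survives as well.\<close>

lemma bounded_solution_limit:
  fixes u v :: "nat \<Rightarrow> real \<Rightarrow> real"
  assumes sol: "\<And>n. solves_on g p {- real n..real n} (u n) (v n)"
    and uA: "\<And>n s. \<bar>s\<bar> \<le> real n \<Longrightarrow> \<bar>u n s\<bar> \<le> A" and vB: "\<And>n s. \<bar>s\<bar> \<le> real n \<Longrightarrow> \<bar>v n s\<bar> \<le> B"
    and lip: "\<And>x y. \<bar>g x - g y\<bar> \<le> \<Gamma> * \<bar>x - y\<bar>" and \<Gamma>: "0 \<le> \<Gamma>"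
    and g_bound: "\<And>x. \<bar>g x\<bar> \<le> M" and p_bound: "\<And>t. \<bar>p t\<bar> \<le> M" and p: "continuous_on UNIV p"
    and large: "\<And>n. \<exists>s. \<bar>s\<bar> \<le> D \<and> (D \<le> real n \<longrightarrow> c \<le> \<bar>u n s\<bar>)"
  shows "\<exists>w z. solves_on g p UNIV w z \<and> (\<forall>s. \<bar>w s\<bar> \<le> A \<and> \<bar>z s\<bar> \<le> B) \<and> (\<exists>s. c \<le> \<bar>w s\<bar>)"
proof -
  obtain q where q: "\<And>n. \<bar>q n\<bar> \<le> D" "\<And>n. D \<le> real n \<Longrightarrow> c \<le> \<bar>u n (q n)\<bar>" using large by metis
  \<comment> \<open>The marked point joins the initial data, so that one subsequence serves all
    three.\<close>
  have "bounded (range (\<lambda>n. (u n 0, v n 0, q n)))"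
  proof -
    have "range (\<lambda>n. (u n 0, v n 0, q n)) \<subseteq> cbox (-A, -B, -D) (A, B, D)"
      using uA[of 0] vB[of 0] q(1) by (auto simp: abs_le_iff) (metis minus_le_iff)+
    then show ?thesis using bounded_cbox bounded_subset by blast
  qed
  then obtain l r where r: "strict_mono r" and l: "((\<lambda>n. (u n 0, v n 0, q n)) \<circ> r) \<longlonglongrightarrow> l"
    using bounded_imp_convergent_subsequence by blast
  obtain x y q0 where lxy: "l = (x, y, q0)" by (cases l)
  have lim: "(\<lambda>n. u (r n) 0) \<longlonglongrightarrow> x" "(\<lambda>n. v (r n) 0) \<longlonglongrightarrow> y" "(\<lambda>n. q (r n)) \<longlonglongrightarrow> q0"
    using tendsto_fst[OF l] tendsto_fst[OF tendsto_snd[OF l]] tendsto_snd[OF tendsto_snd[OF l]] by (auto simp: lxy o_def)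
  have rn: "real n \<le> real (r n)" for n using seq_suble[OF r] by simp
  have sub: "solves_on g p {-T..T} (u (r n)) (v (r n))" if "T \<le> real n" for T n
    by (rule solves_on_subset[OF sol]) (use that rn[of n] in auto)
  have cauchy: "Cauchy (\<lambda>n. u (r n) t) \<and> Cauchy (\<lambda>n. v (r n) t)" for t
  proof -
    define C where "C = exp ((1 + \<Gamma>) * \<bar>t\<bar>)"
    have C: "0 < C" by (simp add: C_def)
    have est: "(u (r m) t - u (r n) t)\<^sup>2 + (v (r m) t - v (r n) t)\<^sup>2 \<le>
        ((u (r m) 0 - u (r n) 0)\<^sup>2 + (v (r m) 0 - v (r n) 0)\<^sup>2) * C"
      if "\<bar>t\<bar> + 1 \<le> real m" "\<bar>t\<bar> + 1 \<le> real n" for m n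
      unfolding C_def by (rule solves_on_gronwall[OF sub[OF that(1)] sub[OF that(2)] lip \<Gamma>]) simp
    have key: "\<exists>N. \<forall>m\<ge>N. \<forall>n\<ge>N. (u (r m) t - u (r n) t)\<^sup>2 + (v (r m) t - v (r n) t)\<^sup>2 < e\<^sup>2" if "0 < e" for e
    proof -
      \<comment> \<open>Two squared errors below that of \<open>e'\<close> at time 0, amplified by
        \<open>C\<close>, stay below the square of \<open>e\<close>.\<close>
      define e' where "e' = e / sqrt (2 * C)"
      have e': "0 < e'" "e'\<^sup>2 * (2 * C) = e\<^sup>2" using that C by (auto simp: e'_def power_divide)
      obtain N1 where N1: "\<And>m n. m \<ge> N1 \<Longrightarrow> n \<ge> N1 \<Longrightarrow> \<bar>u (r m) 0 - u (r n) 0\<bar> < e'"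
        using LIMSEQ_imp_Cauchy[OF lim(1)] e'(1) unfolding Cauchy_def dist_real_def by metis
      obtain N2 where N2: "\<And>m n. m \<ge> N2 \<Longrightarrow> n \<ge> N2 \<Longrightarrow> \<bar>v (r m) 0 - v (r n) 0\<bar> < e'"
        using LIMSEQ_imp_Cauchy[OF lim(2)] e'(1) unfolding Cauchy_def dist_real_def by metis
      obtain N3 where N3: "\<bar>t\<bar> + 1 \<le> real N3" using real_arch_simple by blast
      show ?thesis
      proof (intro exI[of _ "max N1 (max N2 N3)"] allI impI)
        fix m n assume mn: "max N1 (max N2 N3) \<le> m" "max N1 (max N2 N3) \<le> n"
        have sq: "(u (r m) 0 - u (r n) 0)\<^sup>2 < e'\<^sup>2" "(v (r m) 0 - v (r n) 0)\<^sup>2 < e'\<^sup>2"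
          using N1[of m n] N2[of m n] mn power_strict_mono[of "\<bar>_\<bar>" e' 2] by auto
        have "real N3 \<le> real m" "real N3 \<le> real n" using mn by auto
        then have "(u (r m) t - u (r n) t)\<^sup>2 + (v (r m) t - v (r n) t)\<^sup>2 \<le>
            ((u (r m) 0 - u (r n) 0)\<^sup>2 + (v (r m) 0 - v (r n) 0)\<^sup>2) * C"
          using N3 by (intro est) auto
        also have "\<dots> < (e'\<^sup>2 + e'\<^sup>2) * C" using sq C by (intro mult_strict_right_mono add_strict_mono)
        also have "\<dots> = e\<^sup>2" using e'(2) by (simp add: algebra_simps)
        finally show "(u (r m) t - u (r n) t)\<^sup>2 + (v (r m) t - v (r n) t)\<^sup>2 < e\<^sup>2" .
      qed
    qed
    have small: "\<bar>a\<bar> < e \<and> \<bar>b\<bar> < e" if "a\<^sup>2 + b\<^sup>2 < e\<^sup>2" "0 < e" for a b e :: real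
    proof -
      have "\<bar>a\<bar>\<^sup>2 < e\<^sup>2" "\<bar>b\<bar>\<^sup>2 < e\<^sup>2" using that(1) zero_le_power2[of a] zero_le_power2[of b] by (simp_all, linarith+)
      then show ?thesis using that(2) power2_less_imp_less[of "\<bar>a\<bar>" e] power2_less_imp_less[of "\<bar>b\<bar>" e] by auto
    qed
    show ?thesis unfolding Cauchy_def dist_real_def using key small by metis
  qed
  define w where "w = (\<lambda>t. lim (\<lambda>n. u (r n) t))"
  define z where "z = (\<lambda>t. lim (\<lambda>n. v (r n) t))"
  have w: "(\<lambda>n. u (r n) t) \<longlonglongrightarrow> w t" and z: "(\<lambda>n. v (r n) t) \<longlonglongrightarrow> z t" for t
    using cauchy[of t] by (auto simp: w_def z_def Cauchy_convergent_iff convergent_LIMSEQ_iff)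
  have ev: "\<forall>\<^sub>F n in sequentially. T \<le> real (r n)" for T
  proof -
    obtain N where "T \<le> real N" using real_arch_simple by blast
    then show ?thesis using rn by (intro eventually_sequentiallyI[of N]) (meson of_nat_mono order_trans)
  qed
  have M: "0 \<le> M" using g_bound[of 0] by linarith
  have B: "0 \<le> B" using vB[of 0 0] by simp
  have lipu: "\<bar>u n s - u n t\<bar> \<le> B * \<bar>s - t\<bar>" if "\<bar>s\<bar> \<le> real n" "\<bar>t\<bar> \<le> real n" for n s t
    by (rule real_lipschitz_of_derivative[of "{- real n..real n}" "u n" "v n"])
      (use that sol[of n] vB[where n=n] in \<open>auto simp: solves_on_def abs_le_iff\<close>)
  have lipv: "\<bar>v n s - v n t\<bar> \<le> 2 * M * \<bar>s - t\<bar>" if "\<bar>s\<bar> \<le> real n" "\<bar>t\<bar> \<le> real n" for n s t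
  proof (rule real_lipschitz_of_derivative[of "{- real n..real n}" "v n" "\<lambda>t. p t - g (u n t)"])
    show "\<bar>p x - g (u n x)\<bar> \<le> 2 * M" for x using p_bound[of x] g_bound[of "u n x"] by linarith
  qed (use that sol[of n] in \<open>auto simp: solves_on_def abs_le_iff\<close>)
  have dw: "(w has_real_derivative z t) (at t)" for t
  proof (rule has_real_derivative_of_estimate)
    fix e :: real assume e: "0 < e"
    \<comment> \<open>Velocities change at rate at most 2 M, so within \<delta> of \<open>t\<close>
      they differ from the one at \<open>t\<close> by at most \<open>e\<close>, for all
      \<open>n\<close> simultaneously; the 1 covers M = 0.\<close>
    define \<delta> where "\<delta> = e / (2 * M + 1)"
    have \<delta>: "0 < \<delta>" "2 * M * \<delta> \<le> e" using e M by (auto simp: \<delta>_def field_simps)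
    have "\<bar>w s - w t - z t * (s - t)\<bar> \<le> e * \<bar>s - t\<bar>" if s: "\<bar>s - t\<bar> < \<delta>" for s
    proof (rule tendsto_upperbound)
      show "(\<lambda>n. \<bar>u (r n) s - u (r n) t - v (r n) t * (s - t)\<bar>) \<longlonglongrightarrow> \<bar>w s - w t - z t * (s - t)\<bar>"
        by (intro tendsto_intros w z)
      show "\<forall>\<^sub>F n in sequentially. \<bar>u (r n) s - u (r n) t - v (r n) t * (s - t)\<bar> \<le> e * \<bar>s - t\<bar>"
        using ev[of "\<bar>t\<bar> + \<bar>s\<bar>"]
      proof eventually_elim
        case (elim n)
        have sub: "closed_segment t s \<subseteq> {- real (r n)..real (r n)}"
          using elim by (auto simp: closed_segment_eq_real_ivl split: if_splits)
        note ss = solves_on_subset[OF sol sub]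
        have "\<bar>(u (r n) s - v (r n) t * s) - (u (r n) t - v (r n) t * t)\<bar> \<le> e * \<bar>s - t\<bar>"
        proof (rule real_lipschitz_of_derivative[of "closed_segment t s" _ "\<lambda>y. v (r n) y - v (r n) t"])
          fix y assume y: "y \<in> closed_segment t s"
          show "((\<lambda>s. u (r n) s - v (r n) t * s) has_real_derivative v (r n) y - v (r n) t) (at y within closed_segment t s)"
            using solves_onD(1)[OF ss y] by (auto intro!: derivative_eq_intros)
          have "\<bar>v (r n) y - v (r n) t\<bar> \<le> 2 * M * \<bar>y - t\<bar>" by (rule lipv) (use subsetD[OF sub y] elim in \<open>auto simp: abs_le_iff\<close>)
          also have "\<dots> \<le> 2 * M * \<delta>"
            using y s M by (intro mult_left_mono) (auto simp: closed_segment_eq_real_ivl split: if_splits)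
          finally show "\<bar>v (r n) y - v (r n) t\<bar> \<le> e" using \<delta> by simp
        qed auto
        then show ?case by (simp add: algebra_simps)
      qed
    qed simp
    then show "\<exists>\<delta>>0. \<forall>s. \<bar>s - t\<bar> < \<delta> \<longrightarrow> \<bar>w s - w t - z t * (s - t)\<bar> \<le> e * \<bar>s - t\<bar>" using \<delta> by blast
  qed
  have dz: "(z has_real_derivative p t - g (w t)) (at t)" for t
  proof (rule has_real_derivative_of_estimate)
    fix e :: real assume e: "0 < e"
    have "isCont p t" using p by (simp add: continuous_on_eq_continuous_at)
    then obtain \<delta>1 where \<delta>1: "0 < \<delta>1" "\<And>s. \<bar>s - t\<bar> < \<delta>1 \<Longrightarrow> \<bar>p s - p t\<bar> < e / 2"
      using e unfolding isCont_def LIM_def dist_real_def by (metis abs_zero diff_self half_gt_zero)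
    define \<delta>2 where "\<delta>2 = e / (2 * (\<Gamma> * B + 1))"
    have gb: "0 \<le> \<Gamma> * B" using \<Gamma> B by simp
    then have \<delta>2: "0 < \<delta>2" "\<Gamma> * B * \<delta>2 \<le> e / 2" using e by (auto simp: \<delta>2_def field_simps)
    define \<delta> where "\<delta> = min \<delta>1 \<delta>2"
    have \<delta>: "0 < \<delta>" "\<delta> \<le> \<delta>1" "\<delta> \<le> \<delta>2" using \<delta>1 \<delta>2 by (auto simp: \<delta>_def)
    have gw: "(\<lambda>n. g (u (r n) t)) \<longlonglongrightarrow> g (w t)"
    proof -
      have "\<Gamma>-lipschitz_on UNIV g" using lip \<Gamma> by (intro lipschitz_onI) (auto simp: dist_real_def)
      then have "continuous_on UNIV g" by (rule lipschitz_on_continuous_on)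
      then have "isCont g (w t)" by (simp add: continuous_on_eq_continuous_at)
      then show ?thesis using w by (rule isCont_tendsto_compose)
    qed
    have "\<bar>z s - z t - (p t - g (w t)) * (s - t)\<bar> \<le> e * \<bar>s - t\<bar>" if s: "\<bar>s - t\<bar> < \<delta>" for s
    proof (rule tendsto_upperbound)
      show "(\<lambda>n. \<bar>v (r n) s - v (r n) t - (p t - g (u (r n) t)) * (s - t)\<bar>) \<longlonglongrightarrow> \<bar>z s - z t - (p t - g (w t)) * (s - t)\<bar>"
        by (intro tendsto_intros gw z)
      show "\<forall>\<^sub>F n in sequentially. \<bar>v (r n) s - v (r n) t - (p t - g (u (r n) t)) * (s - t)\<bar> \<le> e * \<bar>s - t\<bar>"
        using ev[of "\<bar>t\<bar> + \<bar>s\<bar>"]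
      proof eventually_elim
        case (elim n)
        have sub: "closed_segment t s \<subseteq> {- real (r n)..real (r n)}"
          using elim by (auto simp: closed_segment_eq_real_ivl split: if_splits)
        note ss = solves_on_subset[OF sol sub]
        define c where "c = p t - g (u (r n) t)"
        have "\<bar>(v (r n) s - c * s) - (v (r n) t - c * t)\<bar> \<le> e * \<bar>s - t\<bar>"
        proof (rule real_lipschitz_of_derivative[of "closed_segment t s" _ "\<lambda>y. p y - g (u (r n) y) - c"])
          fix y assume y: "y \<in> closed_segment t s"
          show "((\<lambda>s. v (r n) s - c * s) has_real_derivative p y - g (u (r n) y) - c) (at y within closed_segment t s)"
            using solves_onD(2)[OF ss y] by (auto intro!: derivative_eq_intros)
          have yt: "\<bar>y - t\<bar> < \<delta>" using y s by (auto simp: closed_segment_eq_real_ivl split: if_splits)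
          have "\<bar>u (r n) y - u (r n) t\<bar> \<le> B * \<bar>y - t\<bar>" by (rule lipu) (use subsetD[OF sub y] elim in \<open>auto simp: abs_le_iff\<close>)
          also have "\<dots> \<le> B * \<delta>2" using yt \<delta> B by (intro mult_left_mono) auto
          finally have "\<Gamma> * \<bar>u (r n) y - u (r n) t\<bar> \<le> \<Gamma> * (B * \<delta>2)" using \<Gamma> by (intro mult_left_mono)
          then have "\<bar>g (u (r n) y) - g (u (r n) t)\<bar> \<le> e / 2"
            using lip[of "u (r n) y" "u (r n) t"] \<delta>2(2) by (simp add: mult.assoc)
          moreover have "\<bar>p y - p t\<bar> < e / 2" using \<delta>1(2)[of y] yt \<delta> by simp
          ultimately show "\<bar>p y - g (u (r n) y) - c\<bar> \<le> e" unfolding c_def by linarith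
        qed auto
        then show ?case by (simp add: c_def algebra_simps)
      qed
    qed simp
    then show "\<exists>\<delta>>0. \<forall>s. \<bar>s - t\<bar> < \<delta> \<longrightarrow> \<bar>z s - z t - (p t - g (w t)) * (s - t)\<bar> \<le> e * \<bar>s - t\<bar>" using \<delta> by blast
  qed
  have bw: "\<bar>w s\<bar> \<le> A" "\<bar>z s\<bar> \<le> B" for s
  proof -
    show "\<bar>w s\<bar> \<le> A"
      by (rule tendsto_upperbound[OF tendsto_rabs[OF w]])
        (use ev[of "\<bar>s\<bar>"] in \<open>auto elim!: eventually_mono intro: uA\<close>)
    show "\<bar>z s\<bar> \<le> B"
      by (rule tendsto_upperbound[OF tendsto_rabs[OF z]])
        (use ev[of "\<bar>s\<bar>"] in \<open>auto elim!: eventually_mono intro: vB\<close>)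
  qed
  have q0: "\<bar>q0\<bar> \<le> D" by (rule tendsto_upperbound[OF tendsto_rabs[OF lim(3)]]) (use q(1) in auto)
  have "c \<le> \<bar>w q0\<bar>"
  proof (rule tendsto_lowerbound)
    \<comment> \<open>The large values occur at \<open>q (r n)\<close> and not at the limit point;
      the Lipschitz constant \<open>B\<close> bridges the distance, which tends to 0.\<close>
    show "(\<lambda>n. \<bar>u (r n) q0\<bar> + B * \<bar>q (r n) - q0\<bar>) \<longlonglongrightarrow> \<bar>w q0\<bar>"
      by (rule tendsto_eq_intros refl w lim(3))+ simp
    show "\<forall>\<^sub>F n in sequentially. c \<le> \<bar>u (r n) q0\<bar> + B * \<bar>q (r n) - q0\<bar>"
      using ev[of D]
    proof eventually_elim
      case (elim n)
      have "\<bar>u (r n) (q (r n)) - u (r n) q0\<bar> \<le> B * \<bar>q (r n) - q0\<bar>"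
        by (rule lipu) (use q(1)[of "r n"] q0 elim in auto)
      then show ?case using q(2)[OF elim] by linarith
    qed
  qed simp
  then show ?thesis using dw dz bw by (intro exI[of _ w] exI[of _ z]) (auto simp: solves_on_def)
qed

text \<open>The second instance says that \<open>g\<close> tends to \<open>- gn\<close> at minus
  infinity, so positivity of \<open>gp\<close> and \<open>gn\<close> is the solvability condition
  for average 0. Sharing \<open>M\<close> and \<Gamma> loses nothing, as both are invariant under
  the reflection.\<close>

locale oscillator =
  pos: half_oscillator g p P M \<Gamma> gp +
  neg: half_oscillator "\<lambda>x. - g (- x)" "\<lambda>t. - p t" "\<lambda>t. - P t" M \<Gamma> gn
  for g p P :: "real \<Rightarrow> real" and M \<Gamma> gp gn :: real
begin

definition U :: "bool \<Rightarrow> real \<Rightarrow> real \<Rightarrow> real" where "U \<sigma> = (if \<sigma> then pos.U else neg.U)"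
definition V :: "bool \<Rightarrow> real \<Rightarrow> real \<Rightarrow> real" where "V \<sigma> = (if \<sigma> then pos.V else neg.V)"
definition h :: "bool \<Rightarrow> real \<Rightarrow> real \<Rightarrow> real" where "h \<sigma> = (if \<sigma> then pos.h else neg.h)"
definition gl :: "bool \<Rightarrow> real" where "gl \<sigma> = (if \<sigma> then gp else gn)"

lemma gl_pos: "0 < gl \<sigma>"
  using pos.gi_pos neg.gi_pos by (simp add: gl_def)

lemma twist_chain_exists:
  "\<exists>d0\<ge>max pos.L0 neg.L0. twist_chain h U V d0 (\<lambda>\<sigma>. 7 / 16 * gl \<sigma>) (\<lambda>\<sigma>. (gl \<sigma>)\<^sup>2 / 32)"
proof -
  obtain d1 where d1: "pos.L0 < d1" "\<And>a b. d1 \<le> b - a \<Longrightarrow> gp\<^sup>2 / 32 * (b - a) ^ 3 \<le> - pos.h a b \<and> - pos.h a b \<le> 2 * (gp\<^sup>2 / 32) * (b - a) ^ 3"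
    using pos.h_bounds by blast
  obtain d2 where d2: "neg.L0 < d2" "\<And>a b. d2 \<le> b - a \<Longrightarrow> gn\<^sup>2 / 32 * (b - a) ^ 3 \<le> - neg.h a b \<and> - neg.h a b \<le> 2 * (gn\<^sup>2 / 32) * (b - a) ^ 3"
    using neg.h_bounds by blast
  define d0 where "d0 = max d1 d2"
  have d0: "pos.L0 < d0" "neg.L0 < d0" "d1 \<le> d0" "d2 \<le> d0" using d1(1) d2(1) by (auto simp: d0_def)
  \<comment> \<open>The slopes lie between 7/16 and 9/16 of \<open>gl \<sigma>\<close> times the
    length, and 9/16 is at most twice 7/16, as the abstract chain demands.\<close>
  have le: "gl \<sigma> * (9 / 16) * (b - a) \<le> 2 * (7 / 16 * gl \<sigma>) * (b - a)" if "d0 \<le> b - a" for \<sigma> a b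
    using gl_pos[of \<sigma>] that d0 pos.L0(1) by (intro mult_right_mono) auto
  have bd: "7 / 16 * gl \<sigma> * (b - a) \<le> U \<sigma> a b" "U \<sigma> a b \<le> 2 * (7 / 16 * gl \<sigma>) * (b - a)"
    "7 / 16 * gl \<sigma> * (b - a) \<le> V \<sigma> a b" "V \<sigma> a b \<le> 2 * (7 / 16 * gl \<sigma>) * (b - a)" if "d0 \<le> b - a" for \<sigma> a b
    using pos.U_V_bounds[of b a] neg.U_V_bounds[of b a] le[OF that, of \<sigma>] that d0
    by (cases \<sigma>; simp add: U_def V_def gl_def)+
  have "twist_chain h U V d0 (\<lambda>\<sigma>. 7 / 16 * gl \<sigma>) (\<lambda>\<sigma>. (gl \<sigma>)\<^sup>2 / 32)"
  proof
    show "1 \<le> d0" using d0 pos.L0(1) by simp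
    show "0 < 7 / 16 * gl \<sigma>" "0 < (gl \<sigma>)\<^sup>2 / 32" for \<sigma> using gl_pos[of \<sigma>] by auto
    fix \<sigma> and a b :: real
    show "((\<lambda>b. h \<sigma> a b) has_real_derivative - (V \<sigma> a b)\<^sup>2 / 2) (at b)" if "d0 < b - a"
      using pos.h_deriv_right[of b a] neg.h_deriv_right[of b a] that d0 by (auto simp: h_def V_def)
    show "((\<lambda>a. h \<sigma> a b) has_real_derivative (U \<sigma> a b)\<^sup>2 / 2) (at a)" if "d0 < b - a"
      using pos.h_deriv_left[of b a] neg.h_deriv_left[of b a] that d0 by (auto simp: h_def U_def)
    show "(gl \<sigma>)\<^sup>2 / 32 * (b - a) ^ 3 \<le> - h \<sigma> a b" "- h \<sigma> a b \<le> 2 * ((gl \<sigma>)\<^sup>2 / 32) * (b - a) ^ 3" if "d0 \<le> b - a"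
      using d1(2)[of b a] d2(2)[of b a] that d0 by (auto simp: h_def gl_def)
  qed (rule bd; assumption)+
  then show ?thesis using d0 by (intro exI[of _ d0]) auto
qed

definition arc_pos :: "bool \<Rightarrow> real \<Rightarrow> real \<Rightarrow> real \<Rightarrow> real" where
  "arc_pos \<sigma> a b t = (if \<sigma> then fst (pos.arc a b) t else - fst (neg.arc a b) t)"
definition arc_vel :: "bool \<Rightarrow> real \<Rightarrow> real \<Rightarrow> real \<Rightarrow> real" where
  "arc_vel \<sigma> a b t = (if \<sigma> then snd (pos.arc a b) t else - snd (neg.arc a b) t)"

lemma arc_props:
  assumes L: "max pos.L0 neg.L0 \<le> b - a" and D: "b - a \<le> D"
  shows "solves_on g p {a..b} (arc_pos \<sigma> a b) (arc_vel \<sigma> a b)"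
    and "arc_pos \<sigma> a b a = 0" "arc_pos \<sigma> a b b = 0"
    and "arc_vel \<sigma> a b a = (if \<sigma> then U \<sigma> a b else - U \<sigma> a b)"
    and "arc_vel \<sigma> a b b = (if \<sigma> then - V \<sigma> a b else V \<sigma> a b)"
    and "t \<in> {a..b} \<Longrightarrow> \<bar>arc_pos \<sigma> a b t\<bar> \<le> gl \<sigma> * D\<^sup>2"
    and "t \<in> {a..b} \<Longrightarrow> \<bar>arc_vel \<sigma> a b t\<bar> \<le> (gl \<sigma> + 2 * M) * D"
    and "gl \<sigma> * (b - a)\<^sup>2 / 16 \<le> \<bar>arc_pos \<sigma> a b ((a + b) / 2)\<bar>"
proof -
  have L': "pos.L0 \<le> b - a" "neg.L0 \<le> b - a" using L by auto
  have ab: "a < b" using L' pos.L0(1) by simp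
  note P = pos.arc[OF L'(1)] and N = neg.arc[OF L'(2)]
  note PD = pos.positive_arcD[OF P] and ND = neg.positive_arcD[OF N]
  show "solves_on g p {a..b} (arc_pos \<sigma> a b) (arc_vel \<sigma> a b)"
  proof (cases \<sigma>)
    case True
    then show ?thesis using PD(1) by (simp add: arc_pos_def[abs_def] arc_vel_def[abs_def])
  next
    case False
    show ?thesis unfolding solves_on_def
    proof (intro ballI conjI)
      fix t assume t: "t \<in> {a..b}"
      show "(arc_pos \<sigma> a b has_real_derivative arc_vel \<sigma> a b t) (at t within {a..b})"
        using DERIV_minus[OF solves_onD(1)[OF ND(1) t]] False by (simp add: arc_pos_def[abs_def] arc_vel_def[abs_def])
      show "(arc_vel \<sigma> a b has_real_derivative p t - g (arc_pos \<sigma> a b t)) (at t within {a..b})"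
        using DERIV_minus[OF solves_onD(2)[OF ND(1) t]] False by (simp add: arc_pos_def[abs_def] arc_vel_def[abs_def])
    qed
  qed
  show "arc_pos \<sigma> a b a = 0" "arc_pos \<sigma> a b b = 0" using PD ND by (auto simp: arc_pos_def)
  show "arc_vel \<sigma> a b a = (if \<sigma> then U \<sigma> a b else - U \<sigma> a b)"
    "arc_vel \<sigma> a b b = (if \<sigma> then - V \<sigma> a b else V \<sigma> a b)"
    by (auto simp: arc_vel_def U_def V_def pos.U_def neg.U_def pos.V_def neg.V_def)
  show "\<bar>arc_pos \<sigma> a b t\<bar> \<le> gl \<sigma> * D\<^sup>2" "\<bar>arc_vel \<sigma> a b t\<bar> \<le> (gl \<sigma> + 2 * M) * D" if "t \<in> {a..b}"
    using pos.positive_arc_bounds[OF P ab D that] neg.positive_arc_bounds[OF N ab D that]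
    by (auto simp: arc_pos_def arc_vel_def gl_def)
  have mid: "(a + b) / 2 \<in> {a..b}" using ab by simp
  have m2: "((a + b) / 2 - a) * (b - (a + b) / 2) = (b - a)\<^sup>2 / 4"
    by (simp add: power2_eq_square field_simps)
  have "0 \<le> gp * (b - a)\<^sup>2" "0 \<le> gn * (b - a)\<^sup>2" using pos.gi_pos neg.gi_pos by auto
  then show "gl \<sigma> * (b - a)\<^sup>2 / 16 \<le> \<bar>arc_pos \<sigma> a b ((a + b) / 2)\<bar>"
    using PD(4)[OF mid] ND(4)[OF mid] unfolding m2 by (auto simp: arc_pos_def gl_def)
qed

text \<open>Arcs are glued one at a time. The matching condition concerns absolute slopes: a
  positive arc arrives downwards and the following negative one leaves downwards, so alternation
  makes the velocities equal. Midpoint values are recorded as a lower bound on the size; later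
  gluing does not alter them, since each gap ends before the current end.\<close>

lemma chain_solution:
  assumes L: "\<forall>i<N. max pos.L0 neg.L0 \<le> t (Suc i) - t i" and D: "\<forall>i<N. t (Suc i) - t i \<le> D"
    and match: "\<forall>i. Suc i < N \<longrightarrow> V (even i) (t i) (t (Suc i)) = U (odd i) (t (Suc i)) (t (Suc (Suc i)))"
    and n: "n \<le> N"
  shows "\<exists>u v. solves_on g p {t 0..t n} u v \<and> t 0 \<le> t n \<and> u (t n) = 0 \<and>
    (n < N \<longrightarrow> v (t n) = arc_vel (even n) (t n) (t (Suc n)) (t n)) \<and>
    (0 < n \<longrightarrow> (\<forall>s\<in>{t 0..t n}. \<bar>u s\<bar> \<le> (gp + gn) * D\<^sup>2 \<and> \<bar>v s\<bar> \<le> (gp + gn + 2 * M) * D)) \<and>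
    (\<forall>i<n. min gp gn * (t (Suc i) - t i)\<^sup>2 / 16 \<le> \<bar>u ((t i + t (Suc i)) / 2)\<bar> \<and> t (Suc i) \<le> t n)"
  using n
proof (induction n)
  case 0
  show ?case
    \<comment> \<open>On the single point \<open>t 0\<close> the velocity is arbitrary; prescribing
      the initial slope of the first arc lets the first gluing proceed like all others.\<close>
    by (intro exI[of _ "\<lambda>_. 0"] exI[of _ "\<lambda>_. arc_vel True (t 0) (t (Suc 0)) (t 0)"])
      (simp add: solves_on_singleton)
next
  case (Suc n)
  then obtain u v where uv: "solves_on g p {t 0..t n} u v" "t 0 \<le> t n" "u (t n) = 0"
    "v (t n) = arc_vel (even n) (t n) (t (Suc n)) (t n)"
    "0 < n \<Longrightarrow> \<forall>s\<in>{t 0..t n}. \<bar>u s\<bar> \<le> (gp + gn) * D\<^sup>2 \<and> \<bar>v s\<bar> \<le> (gp + gn + 2 * M) * D"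
    "\<And>i. i < n \<Longrightarrow> min gp gn * (t (Suc i) - t i)\<^sup>2 / 16 \<le> \<bar>u ((t i + t (Suc i)) / 2)\<bar> \<and> t (Suc i) \<le> t n"
    by auto
  have nN: "n < N" using Suc.prems by simp
  define a b where "a = t n" "b = t (Suc n)"
  have Lab: "max pos.L0 neg.L0 \<le> b - a" "b - a \<le> D" using L[rule_format, OF nN] D[rule_format, OF nN] by (auto simp: a_b_def)
  have ab: "a < b" using Lab(1) pos.L0(1) by simp
  note arc = arc_props[OF Lab, where \<sigma>="even n"]
  define u' where "u' = (\<lambda>s. if s \<le> a then u s else arc_pos (even n) a b s)"
  define v' where "v' = (\<lambda>s. if s \<le> a then v s else arc_vel (even n) a b s)"
  have D0: "0 \<le> D" using Lab ab by simp
  have gle: "gl \<sigma> \<le> gp + gn" "min gp gn \<le> gl \<sigma>" for \<sigma> using pos.gi_pos neg.gi_pos by (auto simp: gl_def)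
  have bd: "\<bar>arc_pos (even n) a b s\<bar> \<le> (gp + gn) * D\<^sup>2 \<and> \<bar>arc_vel (even n) a b s\<bar> \<le> (gp + gn + 2 * M) * D" if "s \<in> {a..b}" for s
  proof -
    have "gl (even n) * D\<^sup>2 \<le> (gp + gn) * D\<^sup>2" "(gl (even n) + 2 * M) * D \<le> (gp + gn + 2 * M) * D"
      using gle D0 by (auto intro!: mult_right_mono)
    then show ?thesis using arc(6,7)[OF that] by linarith
  qed
  have 1: "solves_on g p {t 0..b} u' v'"
    unfolding u'_def v'_def
    by (rule solves_on_glue[OF _ arc(1)]) (use uv arc ab in \<open>auto simp: a_b_def\<close>)
  have ends: "u' b = 0" "v' b = arc_vel (even n) a b b" using ab arc by (auto simp: u'_def v'_def)
  have 2: "v' b = arc_vel (even (Suc n)) b (t (Suc (Suc n))) b" if "Suc n < N"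
  proof -
    have L2: "max pos.L0 neg.L0 \<le> t (Suc (Suc n)) - b" "t (Suc (Suc n)) - b \<le> D" using L[rule_format, OF that] D[rule_format, OF that] by (auto simp: a_b_def)
    show ?thesis using match[rule_format, OF that] arc(5) arc_props(4)[OF L2, where \<sigma>="odd n"] ends by (auto simp: a_b_def)
  qed
  have 3: "\<bar>u' s\<bar> \<le> (gp + gn) * D\<^sup>2 \<and> \<bar>v' s\<bar> \<le> (gp + gn + 2 * M) * D" if s: "s \<in> {t 0..b}" for s
  proof (cases "s \<le> a")
    case False
    then show ?thesis using bd[of s] s by (simp add: u'_def v'_def)
  next
    case le: True
    show ?thesis
    proof (cases "n = 0")
      case True
      then have "s = a" using le s by (simp add: a_b_def)
      then show ?thesis using bd[of a] ab uv(3,4) arc(2) by (auto simp: u'_def v'_def a_b_def)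
    next
      case False
      then show ?thesis using uv(5) s le by (auto simp: u'_def v'_def a_b_def)
    qed
  qed
  have 4: "min gp gn * (t (Suc i) - t i)\<^sup>2 / 16 \<le> \<bar>u' ((t i + t (Suc i)) / 2)\<bar> \<and> t (Suc i) \<le> b" if "i < Suc n" for i
  proof (cases "i = n")
    case True
    have "min gp gn * (b - a)\<^sup>2 / 16 \<le> gl (even n) * (b - a)\<^sup>2 / 16"
      using gle by (intro divide_right_mono mult_right_mono) auto
    also have "\<dots> \<le> \<bar>arc_pos (even n) a b ((a + b) / 2)\<bar>" by (rule arc(8))
    also have "\<dots> = \<bar>u' ((a + b) / 2)\<bar>" using ab by (simp add: u'_def)
    finally show ?thesis using True by (simp add: a_b_def)
  next
    case False
    then have i: "i < n" using that by simp
    have "t i \<le> t (Suc i)" using L[rule_format, of i] i nN pos.L0(1) by force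
    then have "(t i + t (Suc i)) / 2 \<le> a" using uv(6)[OF i] by (simp add: a_b_def)
    then show ?thesis using uv(6)[OF i] ab by (auto simp: u'_def a_b_def)
  qed
  have "t 0 \<le> b" using uv(2) ab by (simp add: a_b_def)
  then show ?case using 1 2 3 4 ends unfolding a_b_def by (intro exI[of _ u'] exI[of _ v']) auto
qed

lemma large_bounded_solution:
  "\<exists>u v A B. solves_on g p UNIV u v \<and> (\<forall>s. \<bar>u s\<bar> \<le> A \<and> \<bar>v s\<bar> \<le> B) \<and> (\<exists>s. c \<le> \<bar>u s\<bar>)"
proof -
  obtain d0 where d0: "max pos.L0 neg.L0 \<le> d0" "twist_chain h U V d0 (\<lambda>\<sigma>. 7 / 16 * gl \<sigma>) (\<lambda>\<sigma>. (gl \<sigma>)\<^sup>2 / 32)"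
    using twist_chain_exists by blast
  interpret tc: twist_chain h U V d0 "\<lambda>\<sigma>. 7 / 16 * gl \<sigma>" "\<lambda>\<sigma>. (gl \<sigma>)\<^sup>2 / 32" by (rule d0(2))
  define m where "m = min gp gn"
  have m: "0 < m" using pos.gi_pos neg.gi_pos by (simp add: m_def)
  \<comment> \<open>The arc over a gap of length x reaches m x^2 / 16 at its midpoint; since
    \<open>d\<close> is at least 1, its square dominates 16 |c| / m.\<close>
  define d where "d = d0 + 1 + 16 * \<bar>c\<bar> / m"
  have d: "d0 < d" "16 * \<bar>c\<bar> / m \<le> d" "1 \<le> d" using m tc.d0 by (auto simp: d_def add_pos_nonneg)
  have cd: "c \<le> m * x\<^sup>2 / 16" if "d \<le> x" for x
  proof -
    have "1 * d \<le> x * x" using d that by (intro mult_mono) auto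
    then have "16 * \<bar>c\<bar> / m \<le> x\<^sup>2" using d by (simp add: power2_eq_square)
    then have "16 * \<bar>c\<bar> \<le> x\<^sup>2 * m" using m by (simp add: pos_divide_le_eq)
    moreover have "c \<le> \<bar>c\<bar>" by simp
    ultimately show ?thesis by (simp add: mult.commute)
  qed
  obtain D where D: "\<forall>n::nat. \<exists>N t. t 0 \<le> - real n \<and> real n \<le> t N \<and>
    (\<forall>i<N. d \<le> t (Suc i) - t i \<and> t (Suc i) - t i \<le> D) \<and>
    (\<forall>i. Suc i < N \<longrightarrow> V (even i) (t i) (t (Suc i)) = U (odd i) (t (Suc i)) (t (Suc (Suc i))))"
    using tc.chain_exists[OF d(1)] by blast
  define Q where "Q = (\<lambda>n u v. solves_on g p {- real n..real n} u v \<and>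
      (\<forall>s. \<bar>s\<bar> \<le> real n \<longrightarrow> \<bar>u s\<bar> \<le> (gp + gn) * D\<^sup>2 \<and> \<bar>v s\<bar> \<le> (gp + gn + 2 * M) * D) \<and>
      (\<exists>s. \<bar>s\<bar> \<le> D \<and> c \<le> \<bar>u s\<bar>))"
  have "\<exists>u v. Q n u v" for n
  proof -
    \<comment> \<open>\<open>Suc n\<close> in place of \<open>n\<close> separates the ends from 0
      even for n = 0, so the chain has at least one arc.\<close>
    obtain N t where t: "t 0 \<le> - real (Suc n)" "real (Suc n) \<le> t N"
        "\<And>i. i < N \<Longrightarrow> d \<le> t (Suc i) - t i" "\<And>i. i < N \<Longrightarrow> t (Suc i) - t i \<le> D"
        "\<And>i. Suc i < N \<Longrightarrow> V (even i) (t i) (t (Suc i)) = U (odd i) (t (Suc i)) (t (Suc (Suc i)))"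
      using D[rule_format, of "Suc n"] by blast
    have N0: "0 < N" using t(1,2) by (cases N) auto
    have "\<forall>i<N. max pos.L0 neg.L0 \<le> t (Suc i) - t i" using t(3) d d0 by fastforce
    moreover have "\<forall>i<N. t (Suc i) - t i \<le> D" using t(4) by blast
    moreover have "\<forall>i. Suc i < N \<longrightarrow> V (even i) (t i) (t (Suc i)) = U (odd i) (t (Suc i)) (t (Suc (Suc i)))"
      using t(5) by blast
    ultimately have "\<exists>u v. solves_on g p {t 0..t N} u v \<and> t 0 \<le> t N \<and> u (t N) = 0 \<and>
      (N < N \<longrightarrow> v (t N) = arc_vel (even N) (t N) (t (Suc N)) (t N)) \<and>
      (0 < N \<longrightarrow> (\<forall>s\<in>{t 0..t N}. \<bar>u s\<bar> \<le> (gp + gn) * D\<^sup>2 \<and> \<bar>v s\<bar> \<le> (gp + gn + 2 * M) * D)) \<and>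
      (\<forall>i<N. min gp gn * (t (Suc i) - t i)\<^sup>2 / 16 \<le> \<bar>u ((t i + t (Suc i)) / 2)\<bar> \<and> t (Suc i) \<le> t N)"
      by (rule chain_solution) simp
    then
    obtain u v where uv1: "solves_on g p {t 0..t N} u v"
      and uv2: "0 < N \<longrightarrow> (\<forall>s\<in>{t 0..t N}. \<bar>u s\<bar> \<le> (gp + gn) * D\<^sup>2 \<and> \<bar>v s\<bar> \<le> (gp + gn + 2 * M) * D)"
      and uv3: "\<forall>i<N. min gp gn * (t (Suc i) - t i)\<^sup>2 / 16 \<le> \<bar>u ((t i + t (Suc i)) / 2)\<bar> \<and> t (Suc i) \<le> t N"
      by (elim exE conjE) (rule that, assumption+)
    \<comment> \<open>The gap around 0 is singled out: its midpoint stays within \<open>D\<close> of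
      0 for every \<open>n\<close>, which is what keeps the large value in the limit.\<close>
    have "\<exists>i<N. t i \<le> 0 \<and> 0 < t (Suc i)"
    proof -
      define k where "k = (LEAST i. 0 < t i)"
      have kN: "0 < t N" using t(2) by simp
      have k: "0 < t k" "k \<le> N" unfolding k_def using LeastI[of "\<lambda>i. 0 < t i", OF kN] Least_le[of "\<lambda>i. 0 < t i", OF kN] by auto
      have "k \<noteq> 0" using k(1) t(1) by (cases k) auto
      then obtain i where i: "k = Suc i" by (cases k) auto
      have "\<not> 0 < t i" using not_less_Least[of i "\<lambda>i. 0 < t i"] i unfolding k_def by simp
      then show ?thesis using k i by (intro exI[of _ i]) auto
    qed
    then obtain i where i: "i < N" "t i \<le> 0" "0 < t (Suc i)" by blast
    have "- (2 * D) \<le> t i + t (Suc i)" "t i + t (Suc i) \<le> 2 * D" using i(2,3) t(4)[OF i(1)] by linarith+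
    then have "\<bar>(t i + t (Suc i)) / 2\<bar> \<le> D" unfolding abs_le_iff by (simp add: field_simps)
    moreover have "c \<le> \<bar>u ((t i + t (Suc i)) / 2)\<bar>"
      using cd[OF t(3)[OF i(1)]] uv3 i(1) unfolding m_def by fastforce
    moreover have "solves_on g p {- real n..real n} u v"
      by (rule solves_on_subset[OF uv1]) (use t in auto)
    moreover have "\<bar>u s\<bar> \<le> (gp + gn) * D\<^sup>2 \<and> \<bar>v s\<bar> \<le> (gp + gn + 2 * M) * D" if "\<bar>s\<bar> \<le> real n" for s
      using uv2 N0 that t(1,2) by (auto simp: abs_le_iff)
    ultimately show ?thesis unfolding Q_def by blast
  qed
  then obtain u v where "\<And>n. Q n (u n) (v n)" by metis
  then have uv: "\<And>n. solves_on g p {- real n..real n} (u n) (v n)"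
      "\<And>n s. \<bar>s\<bar> \<le> real n \<Longrightarrow> \<bar>u n s\<bar> \<le> (gp + gn) * D\<^sup>2"
      "\<And>n s. \<bar>s\<bar> \<le> real n \<Longrightarrow> \<bar>v n s\<bar> \<le> (gp + gn + 2 * M) * D"
      "\<And>n. \<exists>s. \<bar>s\<bar> \<le> D \<and> c \<le> \<bar>u n s\<bar>"
    unfolding Q_def by blast+
  have "\<exists>w z. solves_on g p UNIV w z \<and> (\<forall>s. \<bar>w s\<bar> \<le> (gp + gn) * D\<^sup>2 \<and> \<bar>z s\<bar> \<le> (gp + gn + 2 * M) * D) \<and> (\<exists>s. c \<le> \<bar>w s\<bar>)"
    by (rule bounded_solution_limit[OF uv(1-3) pos.g_lip _ pos.g_bound pos.p_bound pos.p_cont])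
      (use uv(4) pos.\<Gamma>_pos less_imp_le in blast)+
  then show ?thesis by blast
qed

end

section \<open>Consequences of the hypotheses and the theorem\<close>

lemma strictly_convex_on_imp_convex_on:
  assumes "strictly_convex_on S f"
  shows "convex_on S f"
proof (rule convex_onI)
  show "convex S" using assms by (simp add: strictly_convex_on_def)
  fix t x y :: real assume *: "0 < t" "t < 1" "x \<in> S" "y \<in> S"
  show "f ((1 - t) *\<^sub>R x + t *\<^sub>R y) \<le> (1 - t) * f x + t * f y"
  proof (cases "x = y")
    case True
    then show ?thesis by (simp add: algebra_simps)
  next
    case False
    then show ?thesis using assms * by (auto simp: strictly_convex_on_def intro!: less_imp_le)
  qed
qed

text \<open>For the decay estimates: on the concave side the tangent at \<open>w\<close> gives
  \<open>g'(w) w / 2 \<le> g(w) - g(w / 2)\<close>, and the right-hand side tends to 0.\<close>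

lemma sigmoid_properties:
  fixes g :: "real \<Rightarrow> real"
  assumes C2: "C2 g" and bd: "\<And>x. \<bar>g x\<bar> \<le> M" and mono: "mono g" and infl: "exactly_one_inflection_point g"
  shows "\<exists>\<Gamma>>0. \<forall>x y. \<bar>g x - g y\<bar> \<le> \<Gamma> * \<bar>x - y\<bar>"
    and "(g \<longlongrightarrow> gp) at_top \<Longrightarrow> 0 < \<epsilon> \<Longrightarrow> \<exists>R>0. \<forall>z\<ge>R. \<forall>x\<ge>z. \<forall>y\<ge>z. \<bar>g x - g y\<bar> \<le> \<epsilon> / z * \<bar>x - y\<bar>"
    and "(g \<longlongrightarrow> gm) at_bot \<Longrightarrow> 0 < \<epsilon> \<Longrightarrow> \<exists>R>0. \<forall>z\<ge>R. \<forall>x\<ge>z. \<forall>y\<ge>z. \<bar>g (- x) - g (- y)\<bar> \<le> \<epsilon> / z * \<bar>x - y\<bar>"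
proof -
  obtain s0 where s0: "strictly_convex_on {..<s0} g" "strictly_concave_on {s0<..} g"
    using infl by (auto simp: exactly_one_inflection_point_def)
  have cvx: "convex_on {..<s0} g" "convex_on {s0<..} (\<lambda>x. - g x)"
    using s0 by (auto simp: strictly_concave_on_def intro: strictly_convex_on_imp_convex_on)
  have der: "(g has_real_derivative deriv g x) (at x)" for x
    using C2 by (auto simp: C2_def DERIV_deriv_iff_real_differentiable)
  have der0: "0 \<le> deriv g x" for x
    by (rule mono_on_imp_deriv_nonneg[of UNIV, OF _ der]) (use mono in auto)
  have right: "deriv g x * (x - y) \<le> g x - g y" if "s0 < y" "s0 < x" for x y
    using convex_on_imp_above_tangent[OF cvx(2), of x y "- deriv g x"] that DERIV_minus[OF der[of x]]
    by (auto simp: interior_open has_field_derivative_at_within algebra_simps)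
  have left: "deriv g x * (y - x) \<le> g y - g x" if "y < s0" "x < s0" for x y
    using convex_on_imp_above_tangent[OF cvx(1), of x y "deriv g x"] that der[of x]
    by (auto simp: interior_open has_field_derivative_at_within algebra_simps)
  have lip_of: "\<bar>g x - g y\<bar> \<le> B * \<bar>x - y\<bar>" if "convex S" "\<And>x. x \<in> S \<Longrightarrow> deriv g x \<le> B" "x \<in> S" "y \<in> S" for S B x y
    by (rule real_lipschitz_of_derivative[of S g "deriv g"])
      (use that der der0 in \<open>auto intro: has_field_derivative_at_within\<close>)
  have "continuous_on UNIV (deriv g)"
    using C2 by (auto simp: C2_def intro!: continuous_at_imp_continuous_on differentiable_imp_continuous_within)
  then have "continuous_on {s0 - 1..s0 + 1} (deriv g)" using continuous_on_subset by blast
  then have "\<exists>x\<in>{s0 - 1..s0 + 1}. \<forall>y\<in>{s0 - 1..s0 + 1}. deriv g y \<le> deriv g x"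
    by (intro continuous_attains_sup) auto
  then obtain x0 where x0: "\<And>x. x \<in> {s0 - 1..s0 + 1} \<Longrightarrow> deriv g x \<le> deriv g x0" by blast
  \<comment> \<open>At distance more than 1 from the inflection point the tangent inequality bounds
    the derivative by a difference of values over a unit step, hence by 2 M; near it the maximum
    over a compact interval is used.\<close>
  define \<Gamma> where "\<Gamma> = max (deriv g x0) (2 * M) + 1"
  have M0: "0 \<le> M" using bd[of 0] by linarith
  have bound: "deriv g x \<le> \<Gamma>" for x
  proof -
    consider "x \<in> {s0 - 1..s0 + 1}" | "s0 + 1 < x" | "x < s0 - 1" by force
    then show ?thesis
    proof cases
      case 1
      then show ?thesis using x0 by (fastforce simp: \<Gamma>_def)
    next
      case 2
      then show ?thesis using right[of "x - 1" x] bd[of x] bd[of "x - 1"] by (auto simp: \<Gamma>_def)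
    next
      case 3
      then show ?thesis using left[of "x + 1" x] bd[of x] bd[of "x + 1"] by (auto simp: \<Gamma>_def)
    qed
  qed
  have "\<bar>g x - g y\<bar> \<le> \<Gamma> * \<bar>x - y\<bar>" for x y by (rule lip_of[of UNIV]) (use bound in auto)
  moreover have "0 < \<Gamma>" using M0 by (auto simp: \<Gamma>_def)
  ultimately show "\<exists>\<Gamma>>0. \<forall>x y. \<bar>g x - g y\<bar> \<le> \<Gamma> * \<bar>x - y\<bar>" by blast
  show "\<exists>R>0. \<forall>z\<ge>R. \<forall>x\<ge>z. \<forall>y\<ge>z. \<bar>g x - g y\<bar> \<le> \<epsilon> / z * \<bar>x - y\<bar>" if lim: "(g \<longlongrightarrow> gp) at_top" and e: "0 < \<epsilon>"
  proof -
    obtain R0 where R0: "\<And>x. R0 \<le> x \<Longrightarrow> \<bar>g x - gp\<bar> < \<epsilon> / 4"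
      using tendstoD[OF lim, of "\<epsilon> / 4"] e by (auto simp: eventually_at_top_linorder dist_real_def)
    \<comment> \<open>From here on both \<open>w\<close> and \<open>w / 2\<close> lie to the right
      of the inflection point and where \<open>g\<close> is within \<epsilon> / 4 of its
      limit.\<close>
    define R where "R = 2 * \<bar>R0\<bar> + 2 * \<bar>s0\<bar> + 1"
    have "\<bar>g x - g y\<bar> \<le> \<epsilon> / z * \<bar>x - y\<bar>" if z: "R \<le> z" "z \<le> x" "z \<le> y" for x y z
    proof (rule lip_of[of "{z..}"])
      fix w assume w: "w \<in> {z..}"
      have pos: "0 < z" "0 < w" "R0 \<le> w / 2" "s0 < w / 2" "R0 \<le> w" "s0 < w" using w z by (auto simp: R_def)
      have "deriv g w * (w - w / 2) \<le> g w - g (w / 2)" by (rule right) (use pos in auto)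
      also have "\<dots> \<le> \<epsilon> / 2" using R0[of w] R0[of "w / 2"] pos by linarith
      finally have "deriv g w \<le> \<epsilon> / w" using pos by (simp add: field_simps)
      also have "\<dots> \<le> \<epsilon> / z" using w pos e by (intro divide_left_mono) auto
      finally show "deriv g w \<le> \<epsilon> / z" .
    qed (use z in auto)
    then show ?thesis by (intro exI[of _ R]) (auto simp: R_def)
  qed
  show "\<exists>R>0. \<forall>z\<ge>R. \<forall>x\<ge>z. \<forall>y\<ge>z. \<bar>g (- x) - g (- y)\<bar> \<le> \<epsilon> / z * \<bar>x - y\<bar>" if lim: "(g \<longlongrightarrow> gm) at_bot" and e: "0 < \<epsilon>"
  proof -
    obtain R0 where R0: "\<And>x. x \<le> R0 \<Longrightarrow> \<bar>g x - gm\<bar> < \<epsilon> / 4"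
      using tendstoD[OF lim, of "\<epsilon> / 4"] e by (auto simp: eventually_at_bot_linorder dist_real_def)
    define R where "R = 2 * \<bar>R0\<bar> + 2 * \<bar>s0\<bar> + 1"
    have "\<bar>g (- x) - g (- y)\<bar> \<le> \<epsilon> / z * \<bar>x - y\<bar>" if z: "R \<le> z" "z \<le> x" "z \<le> y" for x y z
    proof -
      have "\<bar>g (- x) - g (- y)\<bar> \<le> \<epsilon> / z * \<bar>- x - - y\<bar>"
      proof (rule lip_of[of "{..- z}"])
        fix w assume w: "w \<in> {..- z}"
        have pos: "0 < z" "w < 0" "w / 2 \<le> R0" "w / 2 < s0" "w \<le> R0" "w < s0" using w z by (auto simp: R_def)
        have "deriv g w * (w / 2 - w) \<le> g (w / 2) - g w" by (rule left) (use pos in auto)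
        also have "\<dots> \<le> \<epsilon> / 2" using R0[of w] R0[of "w / 2"] pos by linarith
        finally have "deriv g w \<le> \<epsilon> / - w" using pos by (simp add: field_simps)
        also have "\<dots> \<le> \<epsilon> / z" using w pos e by (intro divide_left_mono) (auto simp: mult_neg_pos)
        finally show "deriv g w \<le> \<epsilon> / z" .
      qed (use z in auto)
      then show ?thesis by (simp add: abs_minus_commute)
    qed
    then show ?thesis by (intro exI[of _ R]) (auto simp: R_def)
  qed
qed

section \<open>Averages, essential supremum and limits of a monotone function\<close>

lemma asymptotic_averageD:
  assumes "has_asymptotic_average p A" "0 < \<epsilon>"
  obtains T0 where "0 < T0" "\<And>t T. T0 \<le> T \<Longrightarrow> \<bar>integral {t..t + T} p - A * T\<bar> \<le> \<epsilon> * T"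
proof -
  obtain T1 where T1: "\<And>t T. T1 \<le> T \<Longrightarrow> \<bar>(1 / T) * integral {t..t + T} p - A\<bar> < \<epsilon>"
    using uniform_limitD[OF assms(1)[unfolded has_asymptotic_average_def] assms(2)]
    by (auto simp: eventually_at_top_linorder dist_real_def)
  have "\<bar>integral {t..t + T} p - A * T\<bar> \<le> \<epsilon> * T" if "max 1 T1 \<le> T" for t T
  proof -
    have "\<bar>(1 / T) * integral {t..t + T} p - A\<bar> * T \<le> \<epsilon> * T"
      using T1[of T t] that by (intro mult_right_mono) auto
    also have "\<bar>(1 / T) * integral {t..t + T} p - A\<bar> * T = \<bar>((1 / T) * integral {t..t + T} p - A) * T\<bar>"
      using that by (simp add: abs_mult)
    also have "((1 / T) * integral {t..t + T} p - A) * T = integral {t..t + T} p - A * T"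
      using that by (simp add: field_simps)
    finally show ?thesis .
  qed
  then show ?thesis using that[of "max 1 T1"] by simp
qed

text \<open>Over times longer than \<open>T0\<close> the average applies, and its uniformity in the
  starting time makes the constant independent of \<open>s\<close>. Shorter times are covered by the
  bound on the integrand, whence the constant \<open>M * T0\<close>.\<close>

lemma primitive_sublinear:
  fixes p :: "real \<Rightarrow> real"
  assumes p: "continuous_on UNIV p" and bd: "\<And>t. \<bar>p t - A\<bar> \<le> M"
    and P: "\<And>t. (P has_real_derivative p t - A) (at t)"
    and avg: "has_asymptotic_average p A" and e: "0 < \<epsilon>"
  shows "\<exists>C. \<forall>s t. \<bar>P t - P s\<bar> \<le> \<epsilon> * \<bar>t - s\<bar> + C"
proof -
  obtain T0 where T0: "0 < T0" "\<And>t T. T0 \<le> T \<Longrightarrow> \<bar>integral {t..t + T} p - A * T\<bar> \<le> \<epsilon> * T"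
    using asymptotic_averageD[OF avg e] by blast
  have M0: "0 \<le> M" using bd[of 0] by linarith
  have main: "\<bar>P t - P s\<bar> \<le> \<epsilon> * (t - s) + M * T0" if st: "s \<le> t" for s t
  proof (cases "T0 \<le> t - s")
    case True
    have "((\<lambda>x. p x - A) has_integral (P t - P s)) {s..t}"
      by (rule fundamental_theorem_of_calculus[OF st])
        (use P in \<open>auto simp flip: has_real_derivative_iff_has_vector_derivative intro: has_field_derivative_at_within\<close>)
    then have "P t - P s = integral {s..t} (\<lambda>x. p x - A)" by (simp add: integral_unique)
    also have "\<dots> = integral {s..t} p - integral {s..t} (\<lambda>x. A)"
      using p continuous_on_subset by (intro integral_diff integrable_continuous_real) auto
    also have "\<dots> = integral {s..s + (t - s)} p - A * (t - s)" using st by simp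
    finally have "\<bar>P t - P s\<bar> \<le> \<epsilon> * (t - s)" using T0(2)[OF True, of s] by simp
    moreover have "0 \<le> M * T0" using M0 T0(1) by simp
    ultimately show ?thesis by linarith
  next
    case False
    have "\<bar>P t - P s\<bar> \<le> M * \<bar>t - s\<bar>"
      by (rule real_lipschitz_of_derivative[of UNIV P "\<lambda>t. p t - A"]) (use P bd in auto)
    also have "\<dots> \<le> M * T0" using False st M0 by (intro mult_left_mono) auto
    finally show ?thesis using mult_nonneg_nonneg[of \<epsilon> "t - s"] e st by linarith
  qed
  have "\<bar>P t - P s\<bar> \<le> \<epsilon> * \<bar>t - s\<bar> + M * T0" for s t
    using main[of s t] main[of t s] by (cases "s \<le> t") (auto simp: abs_minus_commute)
  then show ?thesis by blast
qed

text \<open>If |u t| exceeded the essential supremum, continuity would make |u| exceed it on a whole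
  interval around \<open>t\<close>, which is not a null set.\<close>

lemma Linf_norm_ge:
  fixes u :: "real \<Rightarrow> real"
  assumes u: "continuous_on UNIV u"
  shows "ereal \<bar>u t\<bar> \<le> Linf_norm u"
proof (rule ccontr)
  assume "\<not> ?thesis"
  then have less: "Linf_norm u < ereal \<bar>u t\<bar>" by simp
  obtain c where c: "Linf_norm u < ereal c" "c < \<bar>u t\<bar>"
    using less ereal_dense3[of "Linf_norm u" "ereal \<bar>u t\<bar>"] by (auto dest: ereal_dense2)
  have "open {s. c < \<bar>u s\<bar>}" by (intro open_Collect_less continuous_intros u)
  then obtain e where e: "0 < e" "ball t e \<subseteq> {s. c < \<bar>u s\<bar>}"
    using c(2) openE by (metis mem_Collect_eq)
  have "AE s in lborel. ereal \<bar>u s\<bar> \<le> Linf_norm u"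
    unfolding Linf_norm_def by (rule esssup_AE)
  then have "AE s in lborel. s \<notin> {t - e<..<t + e}"
  proof eventually_elim
    case (elim s)
    then have "ereal \<bar>u s\<bar> < ereal c" using c(1) by (rule order_le_less_trans)
    then have "\<not> c < \<bar>u s\<bar>" by simp
    then show ?case using e(2) unfolding ball_eq_greaterThanLessThan by blast
  qed
  then have "{t - e<..<t + e} \<in> null_sets lborel" by (subst (asm) AE_iff_null_sets[symmetric]) auto
  then show False using e(1) by (auto simp: null_sets_def)
qed

lemma mono_bounded_tendsto:
  fixes g :: "real \<Rightarrow> real"
  assumes mono: "strict_mono g" and bd: "bounded (range g)"
  obtains gp gm where "(g \<longlongrightarrow> gp) at_top" "(g \<longlongrightarrow> gm) at_bot" "\<And>x. g x < gp" "\<And>x. gm < g x"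
proof
  have ba: "bdd_above (range g)" "bdd_below (range g)"
    using bounded_imp_bdd_above[OF bd] bounded_imp_bdd_below[OF bd] by auto
  have le: "g x \<le> (SUP x. g x)" "(INF x. g x) \<le> g x" for x
    using ba by (auto intro: cSUP_upper cINF_lower)
  have mono': "g x \<le> g y" if "x \<le> y" for x y using strict_mono_less_eq[OF mono] that by simp
  show "(g \<longlongrightarrow> (SUP x. g x)) at_top"
  proof (rule increasing_tendsto)
    fix l assume "l < (SUP x. g x)"
    then obtain x where "l < g x" using ba by (auto simp: less_cSUP_iff)
    then show "\<forall>\<^sub>F n in at_top. l < g n"
      using mono' by (intro eventually_at_top_linorderI[of x]) (auto intro: less_le_trans)
  qed (simp add: le)
  show "(g \<longlongrightarrow> (INF x. g x)) at_bot"
  proof (rule decreasing_tendsto)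
    fix l assume "(INF x. g x) < l"
    then obtain x where x: "g x < l" using ba by (auto simp: cINF_less_iff)
    show "\<forall>\<^sub>F n in at_bot. g n < l"
      unfolding eventually_at_bot_linorder using mono' x by (meson le_less_trans)
  qed (simp add: le)
  show "g x < (SUP x. g x)" for x
    using strict_monoD[OF mono, of x "x + 1"] le(1)[of "x + 1"] by simp
  show "(INF x. g x) < g x" for x
    using strict_monoD[OF mono, of "x - 1" x] le(2)[of "x - 1"] by simp
qed

section \<open>Necessity of the condition and assembly of the theorem\<close>

lemma bounded_solution_derivatives:
  assumes "bounded_solution g p u"
  shows "(u has_real_derivative deriv u t) (at t)" "(deriv u has_real_derivative p t - g (u t)) (at t)"
proof -
  have *: "u differentiable at t" "deriv u differentiable at t" "deriv (deriv u) t = p t - g (u t)"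
    using assms by (auto simp: bounded_solution_def C2_def algebra_simps)
  then show "(u has_real_derivative deriv u t) (at t)" "(deriv u has_real_derivative p t - g (u t)) (at t)"
    using DERIV_deriv_iff_real_differentiable by metis+
qed

text \<open>Integrate the equation over [0, T]: the velocity contributes at most 2 K, negligible
  against T, so the means of \<open>p\<close> and of \<open>g (u t)\<close> agree in the
  limit.\<close>

lemma average_bounds:
  assumes sol: "bounded_solution g p u" and g: "continuous_on UNIV g" and p: "continuous_on UNIV p"
    and avg: "has_asymptotic_average p A" and b: "\<And>t. b1 \<le> g (u t)" "\<And>t. g (u t) \<le> b2"
  shows "b1 \<le> A" "A \<le> b2"
proof -
  note der = bounded_solution_derivatives[OF sol]
  obtain K where K: "\<And>t. \<bar>deriv u t\<bar> \<le> K"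
    using sol by (auto simp: bounded_solution_def bounded_iff)
  have K0: "0 \<le> K" using K[of 0] by linarith
  have cu: "continuous_on UNIV u" by (rule DERIV_continuous_on[OF der(1)])
  have cgu: "continuous_on S (\<lambda>t. g (u t))" for S
    by (rule continuous_on_subset[OF continuous_on_compose2[OF g cu]]) auto
  have cp: "continuous_on S p" for S using p continuous_on_subset by blast
  have main: "A \<le> b2 + \<epsilon> \<and> b1 \<le> A + \<epsilon>" if e: "0 < \<epsilon>" for \<epsilon>
  proof -
    obtain T0 where T0: "0 < T0" "\<And>t T. T0 \<le> T \<Longrightarrow> \<bar>integral {t..t + T} p - A * T\<bar> \<le> \<epsilon> / 2 * T"
      using asymptotic_averageD[OF avg, of "\<epsilon> / 2"] e by auto
    \<comment> \<open>Long enough for the average and for 2 K \<le> \<epsilon> T / 2; each of the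
      two errors takes half of \<epsilon>.\<close>
    define T where "T = T0 + 4 * K / \<epsilon>"
    have T: "T0 \<le> T" "0 < T" "2 * K \<le> \<epsilon> / 2 * T"
      using T0 K0 e by (auto simp: T_def field_simps add_pos_nonneg)
    have "((\<lambda>t. p t - g (u t)) has_integral (deriv u T - deriv u 0)) {0..T}"
      by (rule fundamental_theorem_of_calculus)
        (use T der in \<open>auto simp flip: has_real_derivative_iff_has_vector_derivative intro: has_field_derivative_at_within\<close>)
    then have "deriv u T - deriv u 0 = integral {0..T} (\<lambda>t. p t - g (u t))" by (simp add: integral_unique)
    also have "\<dots> = integral {0..T} p - integral {0..T} (\<lambda>t. g (u t))"
      by (intro integral_diff integrable_continuous_real cp cgu)
    finally have 1: "\<bar>integral {0..T} p - integral {0..T} (\<lambda>t. g (u t))\<bar> \<le> 2 * K"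
      using K[of T] K[of 0] by linarith
    have "integral {0..T} (\<lambda>t. g (u t)) \<le> integral {0..T} (\<lambda>t. b2)"
      by (intro integral_le integrable_continuous_real cgu continuous_intros b)
    then have 2: "integral {0..T} (\<lambda>t. g (u t)) \<le> b2 * T" using T by (simp add: mult.commute)
    have "integral {0..T} (\<lambda>t. b1) \<le> integral {0..T} (\<lambda>t. g (u t))"
      by (intro integral_le integrable_continuous_real cgu continuous_intros b)
    then have 3: "b1 * T \<le> integral {0..T} (\<lambda>t. g (u t))" using T by (simp add: mult.commute)
    have 4: "\<bar>integral {0..T} p - A * T\<bar> \<le> \<epsilon> / 2 * T" using T0(2)[OF T(1), of 0] by simp
    have split: "(b2 + \<epsilon>) * T = b2 * T + (\<epsilon> / 2 * T + \<epsilon> / 2 * T)" "(A + \<epsilon>) * T = A * T + (\<epsilon> / 2 * T + \<epsilon> / 2 * T)"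
      by (simp_all add: algebra_simps)
    have "A * T \<le> (b2 + \<epsilon>) * T" "b1 * T \<le> (A + \<epsilon>) * T" unfolding split using 1 2 3 4 T(3) by linarith+
    then show ?thesis using T(2) by simp
  qed
  show "A \<le> b2" by (rule field_le_epsilon) (use main in blast)
  show "b1 \<le> A" by (rule field_le_epsilon) (use main in blast)
qed

lemma solves_on_UNIV_bounded_solution:
  assumes sol: "solves_on (\<lambda>x. g x - A) (\<lambda>t. p t - A) UNIV u v" and g: "continuous_on UNIV g" and p: "continuous_on UNIV p"
    and bd: "\<And>s. \<bar>u s\<bar> \<le> B" "\<And>s. \<bar>v s\<bar> \<le> C"
  shows "bounded_solution g p u"
proof -
  have du: "(u has_real_derivative v t) (at t)" and dv: "(v has_real_derivative p t - g (u t)) (at t)" for t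
    using solves_onD[OF sol, of t] by auto
  have eq: "deriv u = v" "deriv v = (\<lambda>t. p t - g (u t))" using du dv by (auto intro!: ext DERIV_imp_deriv)
  have cu: "continuous_on UNIV u" by (rule DERIV_continuous_on[OF du])
  have "continuous_on UNIV (\<lambda>t. p t - g (u t))"
    by (intro continuous_intros p continuous_on_compose2[OF g cu]) auto
  moreover have "bounded (range u)" "bounded (range v)" using bd by (auto simp: bounded_iff)
  moreover have "u differentiable at t" "v differentiable at t" for t
    using du dv real_differentiable_def by blast+
  ultimately show ?thesis unfolding bounded_solution_def C2_def eq by simp
qed

theorem theorem1p1:
  fixes g p :: "real \<Rightarrow> real" and A :: real
  assumes "C2 g" and "bounded (range g)" and "strict_mono g"
    and "exactly_one_inflection_point g"
    and "continuous_on UNIV p" and "bounded (range p)"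
    and "has_asymptotic_average p A"
  shows "((\<exists>u. bounded_solution g p u) \<longleftrightarrow> Lim at_bot g < A \<and> A < Lim at_top g) \<and>
    (Lim at_bot g < A \<and> A < Lim at_top g \<longrightarrow>
      (\<exists>u :: nat \<Rightarrow> real \<Rightarrow> real. (\<forall>m. bounded_solution g p (u m)) \<and>
         (\<lambda>m. Linf_norm (u m)) \<longlonglongrightarrow> \<infinity>))"
proof -
  obtain gp gm where lim: "(g \<longlongrightarrow> gp) at_top" "(g \<longlongrightarrow> gm) at_bot" and strict: "\<And>x. g x < gp" "\<And>x. gm < g x"
    using mono_bounded_tendsto[OF assms(3,2)] by metis
  have Lim: "Lim at_top g = gp" "Lim at_bot g = gm"
    using lim by (auto intro!: tendsto_Lim)
  have mono: "mono g" using assms(3) by (rule strict_mono_mono)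
  have gc: "continuous_on UNIV g"
    using assms(1) by (auto simp: C2_def intro!: continuous_at_imp_continuous_on differentiable_imp_continuous_within)
  obtain Mg where Mg: "\<And>x. \<bar>g x\<bar> \<le> Mg" using assms(2) by (auto simp: bounded_iff)
  obtain Mp where Mp: "\<And>x. \<bar>p x\<bar> \<le> Mp" using assms(6) by (auto simp: bounded_iff)
  have necessary: "gm < A \<and> A < gp" if sol: "bounded_solution g p u" for u
  proof -
    obtain K where K: "\<And>t. \<bar>u t\<bar> \<le> K" using sol by (auto simp: bounded_solution_def bounded_iff)
    \<comment> \<open>Boundedness of \<open>u\<close> keeps \<open>g (u t)\<close> between
      \<open>g (- K)\<close> and \<open>g K\<close>, strictly inside the two limits; this makes the
      inequalities for \<open>A\<close> strict.\<close>
    have "- K \<le> u t" "u t \<le> K" for t using K[of t] by (simp_all add: abs_le_iff)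
    then have b: "g (- K) \<le> g (u t)" "g (u t) \<le> g K" for t using monoD[OF mono] by blast+
    show ?thesis
      using average_bounds[OF sol gc assms(5,7) b] strict(1)[of K] strict(2)[of "- K"] by simp
  qed
  have sufficient: "\<exists>u. bounded_solution g p u \<and> ereal c \<le> Linf_norm u" if A: "gm < A" "A < gp" for c
  proof -
    define M where "M = Mg + Mp + \<bar>A\<bar>"
    have "0 \<le> Mg" "0 \<le> Mp" using Mg[of 0] Mp[of 0] by linarith+
    then have gM: "\<bar>g x - A\<bar> \<le> M" and pM: "\<bar>p x - A\<bar> \<le> M" for x
      using Mg[of x] Mp[of x] by (auto simp: M_def)
    obtain \<Gamma> where \<Gamma>: "0 < \<Gamma>" "\<And>x y. \<bar>g x - g y\<bar> \<le> \<Gamma> * \<bar>x - y\<bar>"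
      using sigmoid_properties(1)[OF assms(1) Mg mono assms(4)] by blast
    have pc: "continuous_on UNIV (\<lambda>t. p t - A)" by (intro continuous_intros assms)
    obtain P where P: "\<And>t. (P has_real_derivative p t - A) (at t)"
      using antiderivative_exists[OF pc] by blast
    have small: "\<exists>C. \<forall>s t. \<bar>P t - P s\<bar> \<le> \<epsilon> * \<bar>t - s\<bar> + C" if "0 < \<epsilon>" for \<epsilon>
      by (rule primitive_sublinear[OF assms(5) pM P assms(7) that])
    \<comment> \<open>After subtraction of \<open>A\<close> the pushes at the two infinities are gp
      - A and, by reflection, A - gm; the assumed inequalities say exactly that both are
      positive.\<close>
    have "half_oscillator (\<lambda>x. g x - A) (\<lambda>t. p t - A) P M \<Gamma> (gp - A)"
    proof
      show "((\<lambda>x. g x - A) \<longlongrightarrow> gp - A) at_top" by (intro tendsto_intros lim)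
      show "\<exists>R>0. \<forall>z\<ge>R. \<forall>x\<ge>z. \<forall>y\<ge>z. \<bar>g x - A - (g y - A)\<bar> \<le> \<epsilon> / z * \<bar>x - y\<bar>" if "0 < \<epsilon>" for \<epsilon>
        using sigmoid_properties(2)[OF assms(1) Mg mono assms(4) lim(1) that] by simp
    qed (use gM pM \<Gamma> pc P small A in simp_all)
    moreover have "half_oscillator (\<lambda>x. - (g (- x) - A)) (\<lambda>t. - (p t - A)) (\<lambda>t. - P t) M \<Gamma> (A - gm)"
    proof
      have "((\<lambda>x. g (- x)) \<longlongrightarrow> gm) at_top"
        using filterlim_compose[OF lim(2) filterlim_uminus_at_bot_at_top] .
      then have "((\<lambda>x. - (g (- x) - A)) \<longlongrightarrow> - (gm - A)) at_top" by (intro tendsto_intros)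
      then show "((\<lambda>x. - (g (- x) - A)) \<longlongrightarrow> A - gm) at_top" by simp
      show "\<exists>R>0. \<forall>z\<ge>R. \<forall>x\<ge>z. \<forall>y\<ge>z. \<bar>- (g (- x) - A) - - (g (- y) - A)\<bar> \<le> \<epsilon> / z * \<bar>x - y\<bar>" if "0 < \<epsilon>" for \<epsilon>
        using sigmoid_properties(3)[OF assms(1) Mg mono assms(4) lim(2) that] by (simp add: abs_minus_commute)
      show "\<bar>- (g (- x) - A) - - (g (- y) - A)\<bar> \<le> \<Gamma> * \<bar>x - y\<bar>" for x y
        using \<Gamma>(2)[of "- x" "- y"] by (simp add: abs_minus_commute)
      show "\<bar>- (g (- x) - A)\<bar> \<le> M" for x using gM[of "- x"] by (simp only: abs_minus_cancel)
      show "\<bar>- (p x - A)\<bar> \<le> M" for x using pM[of x] by (simp only: abs_minus_cancel)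
      show "((\<lambda>t. - P t) has_real_derivative - (p t - A)) (at t)" for t by (rule DERIV_minus[OF P])
      show "\<exists>C. \<forall>s t. \<bar>- P t - - P s\<bar> \<le> \<epsilon> * \<bar>t - s\<bar> + C" if "0 < \<epsilon>" for \<epsilon>
        using small[OF that] by (simp add: abs_minus_commute)
      show "continuous_on UNIV (\<lambda>t. - (p t - A))" by (intro continuous_intros assms)
    qed (use \<Gamma> A in simp_all)
    ultimately interpret oscillator "\<lambda>x. g x - A" "\<lambda>t. p t - A" P M \<Gamma> "gp - A" "A - gm"
      by (rule oscillator.intro)
    obtain u v B C where u: "solves_on (\<lambda>x. g x - A) (\<lambda>t. p t - A) UNIV u v" "\<And>s. \<bar>u s\<bar> \<le> B" "\<And>s. \<bar>v s\<bar> \<le> C"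
      and big: "\<exists>s. c \<le> \<bar>u s\<bar>" using large_bounded_solution[of c] by blast
    from big obtain s where "c \<le> \<bar>u s\<bar>" by blast
    then have "ereal c \<le> ereal \<bar>u s\<bar>" by simp
    also have "\<dots> \<le> Linf_norm u" by (rule Linf_norm_ge[OF solves_on_continuous(1)[OF u(1)]])
    finally show ?thesis using solves_on_UNIV_bounded_solution[OF u(1) gc assms(5) u(2,3)] by blast
  qed
  have "\<exists>u. (\<forall>m. bounded_solution g p (u m)) \<and> (\<lambda>m. Linf_norm (u m)) \<longlonglongrightarrow> \<infinity>" if A: "gm < A" "A < gp"
  proof -
    have "\<forall>m::nat. \<exists>u. bounded_solution g p u \<and> ereal (real m) \<le> Linf_norm u"
      using sufficient[OF A] by blast
    from choice[OF this] obtain u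
      where u: "\<And>m::nat. bounded_solution g p (u m)" "\<And>m. ereal (real m) \<le> Linf_norm (u m)" by blast
    have "(\<lambda>m. Linf_norm (u m)) \<longlonglongrightarrow> \<infinity>"
      unfolding tendsto_PInfty
    proof
      fix r :: real
      have "\<forall>\<^sub>F m in sequentially. r < real m"
        using filterlim_real_sequentially by (simp add: filterlim_at_top_dense)
      then show "\<forall>\<^sub>F m in sequentially. ereal r < Linf_norm (u m)"
        by (rule eventually_mono) (use u(2) less_le_trans ereal_less_eq in \<open>metis less_ereal.simps(1)\<close>)
    qed
    then show ?thesis using u(1) by blast
  qed
  then show ?thesis unfolding Lim using necessary sufficient by blast
qed

end
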